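(* Let $\{G_n\}_{n\ge1}$ be a sequence of high degree almost regular graphs. Let $\Gamma_n$ be a uniform spanning tree of $G_n$ and let $T$ be a fixed finite rooted tree of height $r\ge 1$. Denote by $Y_n(T)$ the number of vertices $v$ of $G_n$ satisfying $B_{\Gamma_n}(v,r)\cong T$, where $\cong$ means rooted graph isomorphism. Then with probability tending to $1$ as $n\to\infty$, $$Y_n(T)=(1+o(1))\,\frac{|V(G_n)|\,|T_r|\,e^{-|V(T)|+|T_r|}}{|\mathrm{Stab}_T|};$$ that is, the ratio of $Y_n(T)$ to $\frac{|V(G_n)|\,|T_r|\,e^{-|V(T)|+|T_r|}}{|\mathrm{Stab}_T|}$ converges to $1$ in probability.
   Context: A sequence of finite, simple, connected graphs $\{G_n\}$ is called high degree almost regular if there exists some $d(n)\to\infty$ such that (1) at least $(1-o(1))|V(G_n)|$ of the vertices of $G_n$ have degree $(1\pm o(1))d(n)$, and (2) the sum of degrees in $G_n$ is $(1\pm o(1))d(n)|V(G_n)|$. Equivalently, there is a sequence $\delta_n\to 0$ with $|\{v\in V(G_n):|\deg(v)-d(n)|\le\delta_n d(n)\}|\ge(1-\delta_n)|V(G_n)|$ and $\big|\sum_{v}\deg(v)-d(n)|V(G_n)|\big|\le\delta_n d(n)|V(G_n)|$. The uniform spanning tree (UST) of a finite connected graph $G$ is a uniformly random element of the finite set of spanning trees of $G$. The height of a finite rooted tree $T$ is the maximal graph distance between the root and a vertex of $T$. For $T$ of height $r$, $T_r$ is the set of vertices at graph distance exactly $r$ from the root, $V(T)$ is the vertex set, and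 $\mathrm{Stab}_T$ is the set of graph automorphisms of $T$ that preserve the root. For a tree $\Gamma$, an integer $r\ge 0$ and a vertex $v$, $B_\Gamma(v,r)$ is the induced subtree of $\Gamma$, rooted at $v$, on the vertices at graph distance (in $\Gamma$) at most $r$ from $v$. *)

theory Defs
  imports "HOL-Probability.Probability" "HOL-Combinatorics.Permutations"
begin

section \<open>Simple graphs\<close>

text \<open>A graph is a pair of a vertex set and a set of edges, an edge being a two-element set
  of vertices.\<close>

type_synonym 'a sgraph = "'a set \<times> 'a set set"

abbreviation verts :: "'a sgraph \<Rightarrow> 'a set" where
  "verts G \<equiv> fst G"

abbreviation edges :: "'a sgraph \<Rightarrow> 'a set set" where
  "edges G \<equiv> snd G"

definition simple_graph :: "'a sgraph \<Rightarrow> bool" where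
  "simple_graph G \<longleftrightarrow> (\<forall>e \<in> edges G. e \<subseteq> verts G \<and> card e = 2)"

definition adj :: "'a sgraph \<Rightarrow> 'a \<Rightarrow> 'a \<Rightarrow> bool" where
  "adj G u v \<longleftrightarrow> {u, v} \<in> edges G"

definition degree_of :: "'a sgraph \<Rightarrow> 'a \<Rightarrow> nat" where
  "degree_of G v = card {u \<in> verts G. adj G v u}"

text \<open>A walk is the nonempty list of the vertices it visits, so a list of length \<open>k + 1\<close>
  is a walk with \<open>k\<close> steps.\<close>

definition walk_betw :: "'a sgraph \<Rightarrow> 'a \<Rightarrow> 'a list \<Rightarrow> 'a \<Rightarrow> bool" where
  "walk_betw G u p v \<longleftrightarrow>
     p \<noteq> [] \<and> set p \<subseteq> verts G \<and> successively (adj G) p \<and> hd p = u \<and> last p = v"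

text \<open>The graph without vertices does not count as connected.\<close>

definition graph_connected :: "'a sgraph \<Rightarrow> bool" where
  "graph_connected G \<longleftrightarrow>
     verts G \<noteq> {} \<and> (\<forall>u \<in> verts G. \<forall>v \<in> verts G. \<exists>p. walk_betw G u p v)"

text \<open>The closing edge of a cycle joins the last vertex of the list to the first.\<close>

definition cycle_in :: "'a sgraph \<Rightarrow> 'a list \<Rightarrow> bool" where
  "cycle_in G p \<longleftrightarrow>
     3 \<le> length p \<and> distinct p \<and> set p \<subseteq> verts G \<and> successively (adj G) p \<and>
     adj G (last p) (hd p)"

definition graph_tree :: "'a sgraph \<Rightarrow> bool" where
  "graph_tree G \<longleftrightarrow> simple_graph G \<and> graph_connected G \<and> (\<nexists>p. cycle_in G p)"

text \<open>The distance is meaningful only between vertices joined by a walk.\<close>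

definition gdist :: "'a sgraph \<Rightarrow> 'a \<Rightarrow> 'a \<Rightarrow> nat" where
  "gdist G u v = (LEAST k. \<exists>p. walk_betw G u p v \<and> length p = Suc k)"

definition induced_subgraph :: "'a sgraph \<Rightarrow> 'a set \<Rightarrow> 'a sgraph" where
  "induced_subgraph G S = (S, {e \<in> edges G. e \<subseteq> S})"

definition graph_ball :: "'a sgraph \<Rightarrow> 'a \<Rightarrow> nat \<Rightarrow> 'a sgraph" where
  "graph_ball G v r = induced_subgraph G {w \<in> verts G. gdist G v w \<le> r}"


section \<open>Rooted graphs\<close>

definition finite_rooted_tree :: "'a sgraph \<Rightarrow> 'a \<Rightarrow> bool" where
  "finite_rooted_tree T \<rho> \<longleftrightarrow> finite (verts T) \<and> graph_tree T \<and> \<rho> \<in> verts T"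

definition rooted_height :: "'a sgraph \<Rightarrow> 'a \<Rightarrow> nat" where
  "rooted_height T \<rho> = Max (gdist T \<rho> ` verts T)"

definition level :: "'a sgraph \<Rightarrow> 'a \<Rightarrow> nat \<Rightarrow> 'a set" where
  "level T \<rho> r = {v \<in> verts T. gdist T \<rho> v = r}"

definition rooted_isomorphism ::
    "('a \<Rightarrow> 'b) \<Rightarrow> 'a sgraph \<Rightarrow> 'a \<Rightarrow> 'b sgraph \<Rightarrow> 'b \<Rightarrow> bool" where
  "rooted_isomorphism f G u H v \<longleftrightarrow>
     bij_betw f (verts G) (verts H) \<and> f u = v \<and>
     (\<forall>x \<in> verts G. \<forall>y \<in> verts G. adj G x y \<longleftrightarrow> adj H (f x) (f y))"

definition rooted_isomorphic :: "'a sgraph \<Rightarrow> 'a \<Rightarrow> 'b sgraph \<Rightarrow> 'b \<Rightarrow> bool" where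
  "rooted_isomorphic G u H v \<longleftrightarrow> (\<exists>f. rooted_isomorphism f G u H v)"

text \<open>Requiring \<open>f permutes verts T\<close> makes \<open>f\<close> the identity outside the vertex set, so that
  each automorphism of \<open>T\<close> is represented by exactly one function on the type.\<close>

definition rooted_stab :: "'a sgraph \<Rightarrow> 'a \<Rightarrow> ('a \<Rightarrow> 'a) set" where
  "rooted_stab T \<rho> = {f. f permutes verts T \<and> rooted_isomorphism f T \<rho> T \<rho>}"


section \<open>Uniform spanning trees\<close>

definition spanning_trees :: "'a sgraph \<Rightarrow> 'a sgraph set" where
  "spanning_trees G = {H. graph_tree H \<and> verts H = verts G \<and> edges H \<subseteq> edges G}"

definition ust :: "'a sgraph \<Rightarrow> 'a sgraph pmf" where
  "ust G = pmf_of_set (spanning_trees G)"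

text \<open>The number of vertices of \<open>\<Gamma>\<close> whose \<open>r\<close>-ball in \<open>\<Gamma>\<close>, rooted at its centre, is a copy
  of \<open>(T, \<rho>)\<close>; a spanning tree \<open>\<Gamma>\<close> of \<open>G\<close> has the same vertices as \<open>G\<close>.\<close>

definition ball_count :: "'a sgraph \<Rightarrow> nat \<Rightarrow> 'b sgraph \<Rightarrow> 'b \<Rightarrow> nat" where
  "ball_count \<Gamma> r T \<rho> = card {v \<in> verts \<Gamma>. rooted_isomorphic (graph_ball \<Gamma> v r) v T \<rho>}"


section \<open>Almost regular graph sequences\<close>

text \<open>Sequences are indexed by \<open>n \<ge> 1\<close>; the value at \<open>0\<close> is irrelevant. The sequence
  \<open>\<delta>\<close> collects the error terms \<open>o(1)\<close>.\<close>

definition high_degree_almost_regular :: "(nat \<Rightarrow> 'a sgraph) \<Rightarrow> bool" where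
  "high_degree_almost_regular G \<longleftrightarrow>
     (\<forall>n\<ge>1. finite (verts (G n)) \<and> simple_graph (G n) \<and> graph_connected (G n)) \<and>
     (\<exists>(d :: nat \<Rightarrow> real) (\<delta> :: nat \<Rightarrow> real).
        filterlim d at_top sequentially \<and> \<delta> \<longlonglongrightarrow> 0 \<and>
        (\<forall>n\<ge>1.
           real (card {v \<in> verts (G n). \<bar>real (degree_of (G n) v) - d n\<bar> \<le> \<delta> n * d n})
             \<ge> (1 - \<delta> n) * real (card (verts (G n))) \<and>
           \<bar>(\<Sum>v \<in> verts (G n). real (degree_of (G n) v)) - d n * real (card (verts (G n)))\<bar>
             \<le> \<delta> n * d n * real (card (verts (G n)))))"

end

theory Submission
  imports Defs
begin

text \<open>For a subtree \<open>t\<close> of \<open>G\<close> with vertex set \<open>K\<close>, the number of spanning trees containing \<open>t\<close> is the number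
  \<open>F K\<close> of spanning forests rooted at \<open>K\<close>, and \<open>F (K \<union> {w}) / F K\<close> is the effective resistance between
  \<open>w\<close> and \<open>K\<close>. If all degrees in \<open>K\<close> are about \<open>d\<close>, the Dirichlet principle shows that \<open>t\<close> is contained
  in the uniform spanning tree with probability at least about \<open>k / d ^ (k - 1)\<close>, where \<open>k = card K\<close>.
  A matching upper bound holds after summation over the leaves \<open>w\<close> that can be attached to \<open>t\<close> at
  \<open>u\<close>: the sum of \<open>F (K \<union> {w})\<close> is at most the expected degree of \<open>u\<close> times \<open>F K\<close>, minus
  \<open>F (K - {u}) / deg u\<close>, and the expected degree is about 2 for almost all \<open>u\<close>. So the number of
  copies of every fixed tree with \<open>k\<close> vertices in the uniform spanning tree has mean about
  \<open>k * card V\<close>. It is concentrated because edges of the spanning tree are negatively correlated.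

  A ball of radius \<open>r\<close> is a copy of \<open>T\<close> whose inner vertices have no further neighbours. By inclusion-exclusion
  over the further neighbours, with \<open>s\<close> inner vertices, the number of these copies is about \<open>card V\<close> times the sum of
  \<open>(-1) ^ j / fact j * s ^ j * (k + j)\<close> over \<open>j\<close>, which is \<open>(k - s) * exp (- s)\<close>. Each ball
  isomorphic to \<open>T\<close> is counted once for every automorphism in the stabilizer.\<close>

section \<open>Spanning forests as parent functions\<close>

text \<open>A single copy may lie where resistances are exceptionally large, so no upper bound close
  to \<open>k / d ^ (k - 1)\<close> holds copy by copy. Only totals are controlled, through the fact
  that a spanning tree has \<open>card V - 1\<close> edges. The summed upper bound must be sharp:
  expected degrees alone give a factor 2 per leaf, that is \<open>2 * k\<close>, and the subtracted
  term, a Cauchy-Schwarz gain for the current through \<open>u\<close>, brings this down to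
  \<open>k + 1\<close>, where it meets the lower bound. Degrees and expected degrees are bounded
  only on a set \<open>U\<close> of almost all vertices, so counts are first made inside
  \<open>U\<close>. Extensions by a leaf in \<open>U\<close> and by a leaf in \<open>V\<close> have
  the same asymptotic mean, and almost all tree edges lie inside \<open>U\<close>; this makes the
  copies that meet the complement negligible. Errors are measured by mean absolute deviation, which
  adds up over the finitely many terms of a truncated inclusion-exclusion. Forests are parent
  functions because cutting and regrafting are then single function updates; the electrical facts
  rest on two such bijections for the Laplacian of \<open>hit\<close>.\<close>

definition leads :: "('a \<Rightarrow> 'a) \<Rightarrow> 'a \<Rightarrow> 'a \<Rightarrow> bool" where
  "leads f x y \<longleftrightarrow> (\<exists>n. (f ^^ n) x = y)"

lemma leads_refl [simp]: "leads f x x"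
  unfolding leads_def by (rule exI[of _ 0]) simp

lemma leads_trans: "leads f x y \<Longrightarrow> leads f y z \<Longrightarrow> leads f x z"
  unfolding leads_def by (metis comp_apply funpow_add)

lemma leads_image: "leads f x (f x)"
  unfolding leads_def by (rule exI[of _ 1]) simp

lemma leads_cases: "leads f x y \<longleftrightarrow> x = y \<or> leads f (f x) y"
proof
  assume "leads f x y"
  then obtain n where n: "(f ^^ n) x = y" unfolding leads_def by blast
  show "x = y \<or> leads f (f x) y"
    using n by (cases n) (auto simp: leads_def funpow_swap1)
next
  assume "x = y \<or> leads f (f x) y"
  then show "leads f x y" using leads_trans[OF leads_image] by auto
qed

lemma leads_linear:
  assumes "leads f x y" "leads f x z"
  shows "leads f y z \<or> leads f z y"
proof -
  obtain m n where mn: "(f ^^ m) x = y" "(f ^^ n) x = z" using assms unfolding leads_def by blast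
  show ?thesis
  proof (cases "m \<le> n")
    case True
    then have "(f ^^ (n - m)) y = z"
      using mn by (metis comp_apply funpow_add le_add_diff_inverse2)
    then show ?thesis unfolding leads_def by blast
  next
    case False
    then have "(f ^^ (m - n)) z = y"
      using mn by (metis comp_apply funpow_add le_add_diff_inverse2 nat_le_linear)
    then show ?thesis unfolding leads_def by blast
  qed
qed

lemma leads_fixed: "f k = k \<Longrightarrow> leads f k y \<longleftrightarrow> y = k"
proof
  assume fk: "f k = k" and "leads f k y"
  then obtain n where "(f ^^ n) k = y" unfolding leads_def by blast
  moreover have "(f ^^ n) k = k" using fk by (induction n) auto
  ultimately show "y = k" by simp
qed auto

lemma leads_upd_avoid:
  assumes "\<not> leads f y x"
  shows "leads (f(x := z)) y w \<longleftrightarrow> leads f y w"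
proof -
  have "((f(x := z)) ^^ n) y = (f ^^ n) y" for n
  proof (induction n)
    case (Suc n)
    have "(f ^^ n) y \<noteq> x" using assms unfolding leads_def by blast
    then show ?case using Suc by simp
  qed simp
  then show ?thesis unfolding leads_def by simp
qed

text \<open>A path reaches \<open>x\<close> for the first time without using the value at
  \<open>x\<close>. Formally, \<open>leads_upd_avoid\<close> is applied once to \<open>f\<close> and
  once to the updated function, undoing the update.\<close>

lemma leads_upd_to: "leads (f(x := y)) z x \<longleftrightarrow> leads f z x"
proof (cases "leads f z x")
  case False
  then show ?thesis using leads_upd_avoid by metis
next
  case True
  show ?thesis
  proof (rule ccontr)
    assume "\<not> ?thesis"
    then have "\<not> leads (f(x := y)) z x" using True by simp
    from leads_upd_avoid[OF this, of "f x" x] True show False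
      using \<open>\<not> leads (f(x := y)) z x\<close> by simp
  qed
qed

text \<open>A spanning forest rooted at \<open>K\<close> is represented by the function that sends each vertex outside
  \<open>K\<close> to its parent. It is the identity elsewhere, so the roots are exactly the fixed points
  in \<open>V\<close>.\<close>

definition forests :: "'a set \<Rightarrow> 'a set \<Rightarrow> ('a \<Rightarrow> 'a) set" where
  "forests V K = {f. (\<forall>x. x \<notin> V - K \<longrightarrow> f x = x) \<and> (\<forall>x \<in> V - K. f x \<in> V) \<and>
     (\<forall>x \<in> V. \<exists>k \<in> K. leads f x k)}"

lemma forests_fixed: "f \<in> forests V K \<Longrightarrow> x \<notin> V - K \<Longrightarrow> f x = x"
  unfolding forests_def by blast

lemma forests_in: "f \<in> forests V K \<Longrightarrow> x \<in> V \<Longrightarrow> f x \<in> V"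
  unfolding forests_def by (cases "x \<in> K") auto

lemma forests_leads: "f \<in> forests V K \<Longrightarrow> x \<in> V \<Longrightarrow> \<exists>k \<in> K. leads f x k"
  unfolding forests_def by blast

text \<open>An orbit that returns to \<open>x\<close> is periodic, but it also gets stuck at a root
  \<open>k\<close> after \<open>m\<close> steps. The iterate \<open>m * Suc n\<close> is a multiple
  of the period and at least \<open>m\<close>, so it equals both \<open>x\<close> and
  \<open>k\<close>.\<close>

lemma forests_acyclic:
  assumes "f \<in> forests V K" "x \<in> V - K"
  shows "\<not> leads f (f x) x"
proof
  assume "leads f (f x) x"
  then obtain n where n: "(f ^^ Suc n) x = x"
    unfolding leads_def by (auto simp: funpow_swap1)
  obtain k m where k: "k \<in> K" "(f ^^ m) x = k"
    using forests_leads[OF assms(1), of x] assms(2) unfolding leads_def by blast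
  have "(f ^^ (i * Suc n)) x = x" for i
  proof (induction i)
    case (Suc i)
    have "(f ^^ (Suc i * Suc n)) x = (f ^^ Suc n) ((f ^^ (i * Suc n)) x)"
      by (metis comp_apply funpow_add mult_Suc)
    then show ?case using Suc n by (simp del: funpow.simps)
  qed simp
  then have "x = (f ^^ (m * Suc n)) x" by simp
  also have "m * Suc n = m * n + m" by simp
  also have "(f ^^ (m * n + m)) x = (f ^^ (m * n)) k" using k by (simp add: funpow_add)
  also have "(f ^^ j) k = k" for j
    using forests_fixed[OF assms(1), of k] k(1) by (induction j) auto
  finally show False using k assms by simp
qed

text \<open>Vertices below \<open>x\<close> now continue through \<open>y\<close>, whose path to a
  root is untouched because it avoids \<open>x\<close>; all other paths stay as they were.\<close>

lemma forests_upd: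
  assumes f: "f \<in> forests V R" and x: "x \<in> V - R" and y: "y \<in> V" and nl: "\<not> leads f y x"
  shows "f(x := y) \<in> forests V R"
proof -
  have "\<exists>k\<in>R. leads (f(x := y)) z k" if z: "z \<in> V" for z
  proof (cases "leads f z x")
    case True
    obtain k where k: "k \<in> R" "leads f y k" using forests_leads[OF f y] by blast
    have "leads (f(x := y)) z x" using True by (simp add: leads_upd_to)
    moreover have "leads (f(x := y)) x y" using leads_image[of "f(x := y)" x] by simp
    moreover have "leads (f(x := y)) y k" using k leads_upd_avoid[OF nl] by blast
    ultimately show ?thesis using k leads_trans by metis
  next
    case False
    then show ?thesis using forests_leads[OF f z] leads_upd_avoid[OF False] by blast
  qed
  then show ?thesis using f x y unfolding forests_def by auto
qed

text \<open>Cutting the edge above \<open>u\<close> makes \<open>u\<close> a root. By the second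
  part the former parent does not end up in the tree of \<open>u\<close>, which is the condition
  under which \<open>forests_remove_root\<close> restores the edge.\<close>

lemma forests_add_root:
  assumes g: "g \<in> forests V K" and u: "u \<in> V - K"
  shows "g(u := u) \<in> forests V (insert u K)" "\<not> leads (g(u := u)) (g u) u"
proof -
  have "\<exists>k\<in>insert u K. leads (g(u := u)) z k" if z: "z \<in> V" for z
  proof (cases "leads g z u")
    case False
    then show ?thesis using forests_leads[OF g z] leads_upd_avoid[OF False] by blast
  qed (auto simp: leads_upd_to)
  then show "g(u := u) \<in> forests V (insert u K)" using g u unfolding forests_def by auto
  show "\<not> leads (g(u := u)) (g u) u"
    using forests_acyclic[OF g u] by (simp add: leads_upd_to)
qed

lemma forests_remove_root:
  assumes f: "f \<in> forests V (insert u K)" and u: "u \<in> V - K" and y: "y \<in> V"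
    and nl: "\<not> leads f y u"
  shows "f(u := y) \<in> forests V K"
proof -
  obtain k where k: "k \<in> K" "leads f y k" using forests_leads[OF f y] nl by blast
  have "\<exists>k\<in>K. leads (f(u := y)) z k" if z: "z \<in> V" for z
  proof (cases "leads f z u")
    case True
    have "leads (f(u := y)) z u" using True by (simp add: leads_upd_to)
    moreover have "leads (f(u := y)) u y" using leads_image[of "f(u := y)" u] by simp
    moreover have "leads (f(u := y)) y k" using k leads_upd_avoid[OF nl] by blast
    ultimately show ?thesis using k leads_trans by metis
  next
    case False
    then show ?thesis using forests_leads[OF f z] leads_upd_avoid[OF False] by blast
  qed
  then show ?thesis using f u y unfolding forests_def by auto
qed

lemma finite_forests: "finite V \<Longrightarrow> finite (forests V K)"
proof -
  assume V: "finite V"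
  have "inj_on (\<lambda>f. restrict f V) (forests V K)"
  proof (rule inj_onI)
    fix f g assume fg: "f \<in> forests V K" "g \<in> forests V K" "restrict f V = restrict g V"
    show "f = g"
    proof
      fix x show "f x = g x"
      proof (cases "x \<in> V")
        case True then show ?thesis using fg(3) by (metis restrict_apply')
      next
        case False then show ?thesis using fg forests_fixed by (metis DiffD1)
      qed
    qed
  qed
  moreover have "(\<lambda>f. restrict f V) ` forests V K \<subseteq> V \<rightarrow>\<^sub>E V"
    using forests_in by fastforce
  ultimately show ?thesis
    using V by (meson finite_PiE finite_imageD finite_subset)
qed

locale network =
  fixes V :: "'a set" and c :: "'a \<Rightarrow> 'a \<Rightarrow> real"
  assumes finite_V: "finite V"
    and c_sym: "c x y = c y x"
    and c_nonneg: "0 \<le> c x y"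
begin

definition weight :: "'a set \<Rightarrow> ('a \<Rightarrow> 'a) \<Rightarrow> real" where
  "weight K f = (\<Prod>x\<in>V - K. c x (f x))"

text \<open>For \<open>K \<subseteq> V\<close> this is the principal minor of the weighted Laplacian
  with the rows and columns of \<open>K\<close> deleted, by the all-minors matrix-tree
  theorem.\<close>

definition F :: "'a set \<Rightarrow> real" where
  "F K = (\<Sum>f\<in>forests V K. weight K f)"

text \<open>An unnormalised harmonic function. Divided by \<open>F (insert u K)\<close>, it is the
  probability that \<open>w\<close> lies in the tree of \<open>u\<close> in a random forest rooted
  at \<open>insert u K\<close>; divided by \<open>F K\<close>, it is the potential of a unit current
  from \<open>u\<close> to \<open>K\<close>.\<close>

definition hit :: "'a set \<Rightarrow> 'a \<Rightarrow> 'a \<Rightarrow> real" where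
  "hit K u w = (\<Sum>f | f \<in> forests V (insert u K) \<and> leads f w u. weight (insert u K) f)"

lemma weight_nonneg: "0 \<le> weight K f"
  unfolding weight_def by (intro prod_nonneg) (auto simp: c_nonneg)

lemma F_nonneg: "0 \<le> F K"
  unfolding F_def by (intro sum_nonneg) (auto simp: weight_nonneg)

lemma hit_nonneg: "0 \<le> hit K u w"
  unfolding hit_def by (intro sum_nonneg) (auto simp: weight_nonneg)

lemma hit_root [simp]: "hit K u u = F (insert u K)"
  unfolding hit_def F_def by simp

lemma hit_other_root:
  assumes "w \<in> K" "u \<notin> K"
  shows "hit K u w = 0"
proof -
  have "\<not> leads f w u" if "f \<in> forests V (insert u K)" for f
    using assms leads_fixed[of f w u] forests_fixed[OF that, of w] by auto
  then show ?thesis unfolding hit_def by (simp cong: conj_cong)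
qed

lemma F_minus_hit:
  "F (insert u K) - hit K u y =
     (\<Sum>f | f \<in> forests V (insert u K) \<and> \<not> leads f y u. weight (insert u K) f)"
proof -
  have "F (insert u K) = hit K u y +
     (\<Sum>f | f \<in> forests V (insert u K) \<and> \<not> leads f y u. weight (insert u K) f)"
    unfolding F_def hit_def
    by (subst sum.union_disjoint[symmetric])
      (auto intro!: sum.cong simp: finite_forests[OF finite_V])
  then show ?thesis by simp
qed

text \<open>The difference \<open>hit K u u - hit K u y\<close> is the weight of the forests in
  which \<open>y\<close> belongs to another tree than \<open>u\<close>. Attaching the root
  \<open>u\<close> to such a \<open>y\<close> multiplies the weight by \<open>c u y\<close> and
  produces every forest rooted at \<open>K\<close> exactly once.\<close>

lemma laplacian_hit_root:
  assumes u: "u \<in> V - K"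
  shows "(\<Sum>y\<in>V. c u y * (hit K u u - hit K u y)) = F K"
proof -
  let ?R = "insert u K"
  let ?P = "SIGMA y:V. {f \<in> forests V ?R. \<not> leads f y u}"
  have "(\<Sum>y\<in>V. c u y * (hit K u u - hit K u y)) =
      (\<Sum>y\<in>V. \<Sum>f | f \<in> forests V ?R \<and> \<not> leads f y u. c u y * weight ?R f)"
    by (simp add: F_minus_hit sum_distrib_left)
  also have "\<dots> = (\<Sum>(y, f)\<in>?P. c u y * weight ?R f)"
    by (subst sum.Sigma) (auto simp: finite_V finite_forests)
  also have "\<dots> = F K"
    unfolding F_def
  proof (rule sum.reindex_bij_witness[of _ "\<lambda>g. (g u, g(u := u))" "\<lambda>(y, f). f(u := y)"])
    fix p assume "p \<in> ?P"
    then obtain y f where p: "p = (y, f)" "y \<in> V" "f \<in> forests V ?R" "\<not> leads f y u" by auto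
    show "(\<lambda>g. (g u, g(u := u))) (case p of (y, f) \<Rightarrow> f(u := y)) = p"
      using p forests_fixed[OF p(3), of u] by auto
    show "(case p of (y, f) \<Rightarrow> f(u := y)) \<in> forests V K"
      using p forests_remove_root[OF p(3) u p(2,4)] by simp
    have V: "V - K = insert u (V - ?R)" using u by blast
    have "weight K (f(u := y)) = c u y * (\<Prod>x\<in>V - ?R. c x ((f(u := y)) x))"
      unfolding weight_def by (subst V, subst prod.insert) (use finite_V in auto)
    also have "(\<Prod>x\<in>V - ?R. c x ((f(u := y)) x)) = weight ?R f"
      unfolding weight_def by (intro prod.cong) auto
    finally show "weight K (case p of (y, f) \<Rightarrow> f(u := y)) = (case p of (y, f) \<Rightarrow> c u y * weight ?R f)"
      by (simp only: p(1) prod.case)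
  next
    fix g assume g: "g \<in> forests V K"
    show "(case (g u, g(u := u)) of (y, f) \<Rightarrow> f(u := y)) = g" by simp
    show "(g u, g(u := u)) \<in> ?P"
      using forests_add_root[OF g u] forests_in[OF g] u by simp
  qed
  finally show ?thesis .
qed

text \<open>The involution \<open>(y, f) \<mapsto> (f x, f(x := y))\<close> exchanges the pairs where only \<open>x\<close> belongs to the tree
  of \<open>u\<close> with those where only \<open>y\<close> does, and preserves \<open>c x y * weight f\<close>.\<close>

lemma laplacian_hit_interior:
  assumes x: "x \<in> V - insert u K"
  shows "(\<Sum>y\<in>V. c x y * (hit K u x - hit K u y)) = 0"
proof -
  let ?R = "insert u K"
  let ?w = "weight ?R"
  have fin: "finite {f \<in> forests V ?R. P f}" for P
    using finite_forests[OF finite_V] by simp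
  let ?A = "SIGMA y:V. {f \<in> forests V ?R. leads f x u \<and> \<not> leads f y u}"
  let ?B = "SIGMA y:V. {f \<in> forests V ?R. leads f y u \<and> \<not> leads f x u}"
  \<comment> \<open>Forests with both \<open>x\<close> and \<open>y\<close> in the tree of
    \<open>u\<close> cancel in the difference; only the two asymmetric families remain.\<close>
  have split: "hit K u a = (\<Sum>f | f \<in> forests V ?R \<and> leads f a u \<and> leads f b u. ?w f) +
      (\<Sum>f | f \<in> forests V ?R \<and> leads f a u \<and> \<not> leads f b u. ?w f)" for a b
    unfolding hit_def
    by (subst sum.union_disjoint[symmetric]) (auto intro!: sum.cong simp: fin)
  have comm: "(\<Sum>f | f \<in> forests V ?R \<and> leads f a u \<and> leads f b u. ?w f) =
     (\<Sum>f | f \<in> forests V ?R \<and> leads f b u \<and> leads f a u. ?w f)" for a b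
    by (rule sum.cong) auto
  have "hit K u x - hit K u y =
      (\<Sum>f | f \<in> forests V ?R \<and> leads f x u \<and> \<not> leads f y u. ?w f) -
      (\<Sum>f | f \<in> forests V ?R \<and> leads f y u \<and> \<not> leads f x u. ?w f)" for y
    using split[of x y] split[of y x] comm[of x y] by linarith
  then have "(\<Sum>y\<in>V. c x y * (hit K u x - hit K u y)) =
      (\<Sum>y\<in>V. \<Sum>f | f \<in> forests V ?R \<and> leads f x u \<and> \<not> leads f y u. c x y * ?w f) -
      (\<Sum>y\<in>V. \<Sum>f | f \<in> forests V ?R \<and> leads f y u \<and> \<not> leads f x u. c x y * ?w f)"
    by (simp add: right_diff_distrib sum_subtractf sum_distrib_left)
  also have "\<dots> = (\<Sum>(y, f)\<in>?A. c x y * ?w f) - (\<Sum>(y, f)\<in>?B. c x y * ?w f)"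
    by (subst (1 2) sum.Sigma) (auto simp: finite_V fin)
  also have "(\<Sum>(y, f)\<in>?A. c x y * ?w f) = (\<Sum>(y, f)\<in>?B. c x y * ?w f)"
  proof -
    define s where "s = (\<lambda>(y, f). (f x, f(x := y)) :: 'a \<times> ('a \<Rightarrow> 'a))"
    have sw: "c x (f x) * ?w (f(x := y)) = c x y * ?w f" for f y
    proof -
      have V: "V - ?R = insert x (V - ?R - {x})" using x by blast
      have "?w (f(x := y)) = c x y * (\<Prod>z\<in>V - ?R - {x}. c z ((f(x := y)) z))"
        unfolding weight_def by (subst V, subst prod.insert) (use finite_V in auto)
      also have "(\<Prod>z\<in>V - ?R - {x}. c z ((f(x := y)) z)) = (\<Prod>z\<in>V - ?R - {x}. c z (f z))"
        by (intro prod.cong) auto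
      finally have 1: "?w (f(x := y)) = c x y * (\<Prod>z\<in>V - ?R - {x}. c z (f z))" .
      have "?w f = c x (f x) * (\<Prod>z\<in>V - ?R - {x}. c z (f z))"
        unfolding weight_def by (subst V, subst prod.insert) (use finite_V in auto)
      then show ?thesis using 1 by simp
    qed
    have toB: "s p \<in> ?B" if pA: "p \<in> ?A" for p
    proof -
      obtain y f where p: "p = (y, f)" "y \<in> V" "f \<in> forests V ?R" "leads f x u" "\<not> leads f y u"
        using pA by auto
      have yx: "\<not> leads f y x" using p leads_trans by metis
      have 1: "f(x := y) \<in> forests V ?R" using forests_upd[OF p(3) x p(2) yx] .
      have "\<not> leads f (f x) x" using forests_acyclic[OF p(3) x] .
      moreover have "leads f (f x) u" using p(4) x leads_cases[of f x u] by auto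
      ultimately have 2: "leads (f(x := y)) (f x) u" by (simp add: leads_upd_avoid)
      have "leads (f(x := y)) x u \<longleftrightarrow> leads (f(x := y)) y u"
        using leads_cases[of "f(x := y)" x u] x by auto
      then have 3: "\<not> leads (f(x := y)) x u" using leads_upd_avoid[OF yx] p(5) by simp
      have "f x \<in> V" using forests_in[OF p(3)] x by blast
      then show ?thesis using 1 2 3 p(1) by (simp add: s_def)
    qed
    have toA: "s p \<in> ?A" if pA: "p \<in> ?B" for p
    proof -
      obtain y f where p: "p = (y, f)" "y \<in> V" "f \<in> forests V ?R" "leads f y u" "\<not> leads f x u"
        using pA by auto
      \<comment> \<open>If \<open>y\<close> led to \<open>x\<close>, then by linearity of paths
        either \<open>x\<close> would lie in the tree of \<open>u\<close>, or the root
        \<open>u\<close> would lead to \<open>x\<close>.\<close>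
      have yx: "\<not> leads f y x"
        using p leads_linear[of f y x u] leads_fixed[of f u x] forests_fixed[OF p(3), of u] by auto
      have 1: "f(x := y) \<in> forests V ?R" using forests_upd[OF p(3) x p(2) yx] .
      have "\<not> leads f (f x) x" using forests_acyclic[OF p(3) x] .
      moreover have "\<not> leads f (f x) u" using p(5) x leads_cases[of f x u] by auto
      ultimately have 2: "\<not> leads (f(x := y)) (f x) u" by (simp add: leads_upd_avoid)
      have "leads (f(x := y)) x u \<longleftrightarrow> leads (f(x := y)) y u"
        using leads_cases[of "f(x := y)" x u] x by auto
      then have 3: "leads (f(x := y)) x u" using leads_upd_avoid[OF yx] p(4) by simp
      have "f x \<in> V" using forests_in[OF p(3)] x by blast
      then show ?thesis using 1 2 3 p(1) by (simp add: s_def)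
    qed
    have ss: "s (s p) = p" for p by (cases p) (simp add: s_def)
    show ?thesis
    proof (rule sum.reindex_bij_witness[of _ s s])
      fix p
      show "(case s p of (y, f) \<Rightarrow> c x y * ?w f) = (case p of (y, f) \<Rightarrow> c x y * ?w f)"
        by (cases p) (simp add: s_def sw)
    qed (use toA toB ss in auto)
  qed
  finally show ?thesis by simp
qed

end

section \<open>Effective resistance\<close>

context network begin

definition energy :: "('a \<Rightarrow> real) \<Rightarrow> ('a \<Rightarrow> real) \<Rightarrow> real" where
  "energy f g = (\<Sum>x\<in>V. \<Sum>y\<in>V. c x y * (f x - f y) * (g x - g y)) / 2"

text \<open>Discrete Green formula: after expanding \<open>g x - g y\<close>, exchanging the names
  of \<open>x\<close> and \<open>y\<close> makes the second half equal to the first, which absorbs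
  the factor 1/2.\<close>

lemma energy_laplacian: "energy f g = (\<Sum>x\<in>V. g x * (\<Sum>y\<in>V. c x y * (f x - f y)))"
proof -
  have "(\<Sum>x\<in>V. \<Sum>y\<in>V. c x y * (f x - f y) * (g x - g y)) =
      (\<Sum>x\<in>V. \<Sum>y\<in>V. c x y * (f x - f y) * g x) - (\<Sum>x\<in>V. \<Sum>y\<in>V. c x y * (f x - f y) * g y)"
    by (simp add: right_diff_distrib sum_subtractf)
  also have "(\<Sum>x\<in>V. \<Sum>y\<in>V. c x y * (f x - f y) * g y) =
      (\<Sum>x\<in>V. \<Sum>y\<in>V. c y x * (f y - f x) * g x)"
    by (rule sum.swap)
  also have "\<dots> = - (\<Sum>x\<in>V. \<Sum>y\<in>V. c x y * (f x - f y) * g x)"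
    by (simp add: sum_negf[symmetric] c_sym algebra_simps)
  finally show ?thesis
    unfolding energy_def by (simp add: sum_distrib_left mult_ac)
qed

lemma energy_sym: "energy f g = energy g f"
  unfolding energy_def by (simp add: mult_ac)

lemma energy_nonneg: "0 \<le> energy f f"
proof -
  have "0 \<le> c x y * (f x - f y) * (f x - f y)" for x y
    using c_nonneg[of x y] by (simp add: mult.assoc)
  then show ?thesis unfolding energy_def by (simp add: sum_nonneg)
qed

lemma energy_combination:
  "energy (\<lambda>x. f x + t * g x) (\<lambda>x. f x + t * g x) =
     energy f f + 2 * t * energy f g + t\<^sup>2 * energy g g"
proof -
  have "c x y * ((f x + t * g x) - (f y + t * g y)) * ((f x + t * g x) - (f y + t * g y)) =
      c x y * (f x - f y) * (f x - f y) + 2 * t * (c x y * (f x - f y) * (g x - g y)) +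
      t\<^sup>2 * (c x y * (g x - g y) * (g x - g y))" for x y
    by (simp add: algebra_simps power2_eq_square)
  then show ?thesis
    unfolding energy_def by (simp add: sum.distrib sum_distrib_left[symmetric] add_divide_distrib)
qed

lemma energy_scale: "energy (\<lambda>x. s * f x) g = s * energy f g"
  unfolding energy_def by (simp add: sum_distrib_left algebra_simps)

lemma energy_affine: "energy (\<lambda>x. 1 - f x) g = - energy f g"
  unfolding energy_def by (simp add: sum_negf[symmetric] algebra_simps)

text \<open>In the Green formula only \<open>x = u\<close> contributes, because
  \<open>\<psi>\<close> vanishes on \<open>K\<close> and \<open>hit K u\<close> is harmonic at the
  other vertices. So \<open>hit K u\<close> represents evaluation at \<open>u\<close> up to the
  factor \<open>F K\<close>.\<close>

lemma energy_hit:
  assumes u: "u \<in> V - K" and psi: "\<And>x. x \<in> K \<Longrightarrow> \<psi> x = 0"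
  shows "energy (hit K u) \<psi> = F K * \<psi> u"
proof -
  have "energy (hit K u) \<psi> = (\<Sum>x\<in>V. if x = u then F K * \<psi> u else 0)"
    unfolding energy_laplacian
  proof (rule sum.cong)
    fix x assume x: "x \<in> V"
    show "\<psi> x * (\<Sum>y\<in>V. c x y * (hit K u x - hit K u y)) = (if x = u then F K * \<psi> u else 0)"
      using laplacian_hit_root[OF u] laplacian_hit_interior[of x u K] x psi[of x] by auto
  qed simp
  then show ?thesis using u finite_V by simp
qed

text \<open>If \<open>F (insert u K)\<close> were 0, then \<open>hit K u\<close> would vanish at
  \<open>u\<close> and its Laplacian there, which is \<open>F K\<close>, could not be
  positive.\<close>

lemma F_pos_insert:
  assumes "F K > 0" "u \<in> V - K"
  shows "F (insert u K) > 0"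
proof (rule ccontr)
  assume "\<not> ?thesis"
  then have 0: "F (insert u K) = 0" using F_nonneg[of "insert u K"] by simp
  have "F K = (\<Sum>y\<in>V. c u y * (0 - hit K u y))"
    using laplacian_hit_root[OF assms(2)] 0 by simp
  also have "\<dots> \<le> 0"
    by (intro sum_nonpos) (simp add: c_nonneg hit_nonneg mult_nonneg_nonneg)
  finally show False using assms by simp
qed

text \<open>Cauchy-Schwarz between \<open>\<psi>\<close> and \<open>hit K u\<close>, whose pairing
  with \<open>\<psi>\<close> is known exactly. Every test function thus bounds the resistance
  \<open>F (insert u K) / F K\<close> from below.\<close>

lemma dirichlet_principle:
  assumes K: "F K > 0" and u: "u \<in> V - K" and psi: "\<And>x. x \<in> K \<Longrightarrow> \<psi> x = 0"
  shows "F K * (\<psi> u)\<^sup>2 \<le> F (insert u K) * energy \<psi> \<psi>"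
proof -
  let ?A = "hit K u"
  have pos: "F (insert u K) > 0" using F_pos_insert[OF K u] .
  have A\<psi>: "energy \<psi> ?A = F K * \<psi> u" using energy_hit[OF u psi] energy_sym by simp
  have "u \<notin> K" using u by simp
  then have AA: "energy ?A ?A = F K * F (insert u K)"
    using energy_hit[OF u, of ?A] hit_other_root[of _ K u] by simp
  \<comment> \<open>The minimiser in \<open>t\<close> of the energy of
    \<open>\<psi> + t * hit K u\<close>.\<close>
  define t where "t = - \<psi> u / F (insert u K)"
  have "0 \<le> energy \<psi> \<psi> + 2 * t * (F K * \<psi> u) + t\<^sup>2 * (F K * F (insert u K))"
    using energy_nonneg[of "\<lambda>x. \<psi> x + t * ?A x"] unfolding energy_combination A\<psi> AA .
  also have "\<dots> = energy \<psi> \<psi> - F K * (\<psi> u)\<^sup>2 / F (insert u K)"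
    using pos unfolding t_def by (simp add: field_simps power2_eq_square)
  finally have "F K * (\<psi> u)\<^sup>2 / F (insert u K) \<le> energy \<psi> \<psi>" by simp
  then show ?thesis using pos by (simp add: field_simps)
qed

end

text \<open>Resistances decrease when conductances grow: the potential for \<open>c'\<close> serves
  as test function for \<open>c\<close>, where its energy is at most as large.\<close>

lemma rayleigh_step:
  assumes n: "network V c" and n': "network V c'"
    and le: "\<And>x y. c x y \<le> c' x y"
    and pos: "network.F V c K > 0" "network.F V c' K > 0" and w: "w \<in> V - K"
  shows "network.F V c K * network.F V c' (insert w K) \<le> network.F V c (insert w K) * network.F V c' K"
proof -
  interpret a: network V c by fact
  interpret b: network V c' by fact
  let ?\<psi> = "b.hit K w"
  have "w \<notin> K" using w by simp
  then have z: "?\<psi> x = 0" if "x \<in> K" for x using that b.hit_other_root by simp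
  have "a.energy ?\<psi> ?\<psi> \<le> b.energy ?\<psi> ?\<psi>"
    unfolding a.energy_def b.energy_def
    by (intro divide_right_mono sum_mono) (auto simp: mult.assoc intro!: mult_right_mono le)
  also have "\<dots> = b.F K * b.F (insert w K)"
    using b.energy_hit[OF w z] by simp
  finally have up: "a.F (insert w K) * a.energy ?\<psi> ?\<psi> \<le> a.F (insert w K) * (b.F K * b.F (insert w K))"
    by (intro mult_left_mono a.F_nonneg)
  have lo: "a.F K * (b.F (insert w K))\<^sup>2 \<le> a.F (insert w K) * a.energy ?\<psi> ?\<psi>"
    using a.dirichlet_principle[of K w ?\<psi>] pos(1) w z by simp
  have "b.F (insert w K) * (a.F K * b.F (insert w K)) \<le> b.F (insert w K) * (a.F (insert w K) * b.F K)"
    using order_trans[OF lo up] by (simp only: power2_eq_square mult_ac)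
  then show ?thesis using b.F_pos_insert[OF pos(2) w] by (simp del: mult_le_cancel_left add: mult_le_cancel_left_pos)
qed

text \<open>Connectedness in the form in which it enters: the total weight of spanning trees is
  positive, for every choice of the root.\<close>

locale connected_network = network +
  assumes F_pos_single: "x \<in> V \<Longrightarrow> F {x} > 0"
begin

lemma F_pos:
  assumes "K \<subseteq> V" "K \<noteq> {}"
  shows "F K > 0"
proof -
  have "finite K" using assms finite_V finite_subset by blast
  from this assms(2,1) show ?thesis
    by (induction rule: finite_ne_induct) (auto intro!: F_pos_single F_pos_insert)
qed

text \<open>\<open>F (insert w K) / F K\<close> is the effective resistance between \<open>w\<close> and \<open>K\<close>. The test function for the
  resistance between \<open>w\<close> and \<open>u\<close> is a combination of two potentials that are orthogonal in energy:
  the one of the unit current from \<open>w\<close> to \<open>K\<close>, and \<open>v\<close>, which is 0 at \<open>u\<close> and 1 on \<open>K - {u}\<close>.\<close>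

lemma single_root_bound:
  assumes K: "K \<subseteq> V" "u \<in> K" and ne: "K - {u} \<noteq> {}" and w: "w \<in> V - {u}"
  defines "C \<equiv> F (K - {u}) / F K"
    and "v \<equiv> (\<lambda>w. 1 - hit (K - {u}) u w / F K)"
  shows "(if w \<in> K then 0 else F (insert w K) / F K) + (v w)\<^sup>2 / C \<le> F {u, w} / F {u}"
proof -
  let ?K0 = "K - {u}" and ?p = "hit (K - {u}) u"
  have Kins: "insert u ?K0 = K" using K by blast
  have FK: "F K > 0" using F_pos K by blast
  have FK0: "F ?K0 > 0" using F_pos[of ?K0] K ne by blast
  have Fu: "F {u} > 0" using F_pos_single K by blast
  have Fuw: "F {u, w} > 0" using F_pos[of "{u, w}"] K w by blast
  \<comment> \<open>\<open>C\<close> is the effective conductance between \<open>u\<close> and the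
    rest of \<open>K\<close>; it will be the energy of \<open>v\<close>.\<close>
  have C: "C > 0" unfolding C_def using FK FK0 by simp
  have u: "u \<in> V - ?K0" using K by blast
  have p0: "?p x = 0" if "x \<in> ?K0" for x using hit_other_root[OF that, of u] by simp
  have pu: "?p u = F K" using Kins hit_root[of ?K0 u] by metis
  have vu: "v u = 0" unfolding v_def using pu FK by simp
  have v0: "v x = 1" if "x \<in> ?K0" for x unfolding v_def using p0[OF that] by simp
  have v_energy: "energy v g = - (F ?K0 * g u) / F K" if "\<And>x. x \<in> ?K0 \<Longrightarrow> g x = 0" for g
  proof -
    have "energy v g = - energy (\<lambda>x. (1 / F K) * ?p x) g"
      unfolding v_def using energy_affine[of "\<lambda>x. (1 / F K) * ?p x" g] by simp
    also have "\<dots> = - (F ?K0 * g u) / F K"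
      unfolding energy_scale using energy_hit[OF u, of g] that by simp
    finally show ?thesis .
  qed
  have "energy v v = energy v (\<lambda>x. 1 - ?p x / F K)" unfolding v_def ..
  also have "\<dots> = - energy (\<lambda>x. ?p x / F K) v"
    by (subst energy_sym, subst energy_affine) (rule refl)
  also have "\<dots> = - energy v (\<lambda>x. ?p x / F K)" by (subst energy_sym) (rule refl)
  also have "\<dots> = C"
    by (subst v_energy) (use p0 pu FK in \<open>auto simp: C_def\<close>)
  finally have vv: "energy v v = C" .
  show ?thesis
  proof (cases "w \<in> K")
    case True
    then have "v w = 1" using v0 w by simp
    have "F {u} * (v w)\<^sup>2 \<le> F (insert w {u}) * energy v v"
      using dirichlet_principle[of "{u}" w v] Fu w vu by simp
    then have "F {u} \<le> F {u, w} * C" using \<open>v w = 1\<close> vv by (simp add: insert_commute)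
    then show ?thesis using True \<open>v w = 1\<close> Fu C by (simp add: field_simps)
  next
    case False
    define R where "R = F (insert w K) / F K"
    have wK: "w \<in> V - K" using w False by blast
    have FwK: "F (insert w K) > 0" using F_pos_insert[OF FK wK] .
    have R: "R > 0" unfolding R_def using FwK FK by simp
    define h where "h = (\<lambda>x. (1 / F K) * hit K w x)"
    have h0: "h x = 0" if "x \<in> K" for x unfolding h_def using hit_other_root[OF that False] by simp
    have hw: "h w = R" unfolding h_def R_def by simp
    have hg: "energy h g = g w" if "\<And>x. x \<in> K \<Longrightarrow> g x = 0" for g
      unfolding h_def energy_scale using energy_hit[OF wK, of g] that FK by simp
    have hh: "energy h h = R" using hg[OF h0] hw by simp
    have hv: "energy h v = 0"
      by (subst energy_sym, subst v_energy) (use h0 K in auto)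
    \<comment> \<open>On the span of \<open>h\<close> and \<open>v\<close> this function represents
      evaluation at \<open>w\<close>. Its energy therefore equals its value at \<open>w\<close>, and
      it gives the best Dirichlet bound available in that span.\<close>
    define f where "f = (\<lambda>x. h x + (v w / C) * v x)"
    define Q where "Q = R + (v w)\<^sup>2 / C"
    have ff: "energy f f = Q"
      unfolding f_def energy_combination hh hv vv Q_def using C
      by (simp add: power2_eq_square)
    have fw: "f w = Q" unfolding f_def hw Q_def by (simp add: power2_eq_square)
    have "f u = 0" unfolding f_def using vu h0 K by simp
    then have "F {u} * Q\<^sup>2 \<le> F {u, w} * Q"
      using dirichlet_principle[of "{u}" w f] Fu w ff fw by (simp add: insert_commute)
    moreover have "Q > 0" unfolding Q_def using R C by (simp add: add_pos_nonneg)
    ultimately have "F {u} * Q \<le> F {u, w}" by (simp add: power2_eq_square)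
    then show ?thesis using False Fu unfolding Q_def R_def by (simp add: field_simps)
  qed
qed

text \<open>\<open>single_root_bound\<close> is summed over \<open>w\<close> with weights
  \<open>c u w\<close>. The current of \<open>v\<close> at \<open>u\<close> has strength exactly
  \<open>C\<close>, so by Cauchy-Schwarz the squares of \<open>v\<close> sum to at least
  \<open>C\<^sup>2 / d\<close>, where \<open>d\<close> is the total conductance at \<open>u\<close>.
  After division by \<open>C\<close> this is the subtracted term.\<close>

lemma extension_bound:
  assumes K: "K \<subseteq> V" "u \<in> K" and ne: "K - {u} \<noteq> {}" and deg: "(\<Sum>w\<in>V. c u w) > 0"
  shows "(\<Sum>w\<in>V - K. c u w * F (insert w K)) \<le>
     F K * (\<Sum>w\<in>V - {u}. c u w * (F {u, w} / F {u})) - F (K - {u}) / (\<Sum>w\<in>V. c u w)"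
proof -
  define d where "d = (\<Sum>w\<in>V. c u w)"
  define C where "C = F (K - {u}) / F K"
  define v where "v = (\<lambda>w. 1 - hit (K - {u}) u w / F K)"
  have FK: "F K > 0" using F_pos K by blast
  have C: "C > 0" unfolding C_def using F_pos[of "K - {u}"] K ne FK by force
  have Kins: "insert u (K - {u}) = K" using K by blast
  have pu: "hit (K - {u}) u u = F K" using Kins hit_root[of "K - {u}" u] by metis
  have vu: "v u = 0" unfolding v_def using pu FK by simp
  have u: "u \<in> V - (K - {u})" using K by blast
  have "(\<Sum>w\<in>V. c u w * v w) = (\<Sum>w\<in>V. c u w * (hit (K - {u}) u u - hit (K - {u}) u w)) / F K"
    unfolding v_def pu sum_divide_distrib using FK by (intro sum.cong) (auto simp: field_simps)
  then have cv: "(\<Sum>w\<in>V. c u w * v w) = C"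
    unfolding laplacian_hit_root[OF u] C_def .
  \<comment> \<open>The weighted variance of \<open>v\<close> around its mean
    \<open>C / d\<close>.\<close>
  have "0 \<le> (\<Sum>w\<in>V. c u w * (v w - C / d)\<^sup>2)"
    by (intro sum_nonneg) (simp add: c_nonneg)
  also have "\<dots> = (\<Sum>w\<in>V. c u w * (v w)\<^sup>2) - 2 * (C / d) * (\<Sum>w\<in>V. c u w * v w) + (C / d)\<^sup>2 * d"
    unfolding d_def sum_distrib_left sum.distrib[symmetric] sum_subtractf[symmetric]
    by (intro sum.cong) (auto simp: power2_eq_square algebra_simps)
  also have "\<dots> = (\<Sum>w\<in>V. c u w * (v w)\<^sup>2) - C\<^sup>2 / d"
    unfolding cv using deg by (simp add: d_def[symmetric] power2_eq_square field_simps)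
  finally have cs: "C\<^sup>2 / d \<le> (\<Sum>w\<in>V. c u w * (v w)\<^sup>2)" by simp
  have "(\<Sum>w\<in>V. c u w * (v w)\<^sup>2) = (\<Sum>w\<in>V - {u}. c u w * (v w)\<^sup>2)"
    by (rule sum.mono_neutral_right) (use finite_V vu in auto)
  then have cs': "C / d \<le> (\<Sum>w\<in>V - {u}. c u w * ((v w)\<^sup>2 / C))"
    using cs C unfolding sum_divide_distrib[symmetric] times_divide_eq_right
    by (simp add: power2_eq_square field_simps)
  have eq: "(\<Sum>w\<in>V - K. c u w * (F (insert w K) / F K)) =
      (\<Sum>w\<in>V - {u}. c u w * (if w \<in> K then 0 else F (insert w K) / F K))"
    by (rule sum.mono_neutral_cong_left) (use finite_V K in auto)
  have "(\<Sum>w\<in>V - K. c u w * (F (insert w K) / F K)) + C / d \<le>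
     (\<Sum>w\<in>V - {u}. c u w * (if w \<in> K then 0 else F (insert w K) / F K)) +
     (\<Sum>w\<in>V - {u}. c u w * ((v w)\<^sup>2 / C))"
    unfolding eq using cs' by simp
  also have "(\<Sum>w\<in>V - {u}. c u w * (if w \<in> K then 0 else F (insert w K) / F K)) + (\<Sum>w\<in>V - {u}. c u w * ((v w)\<^sup>2 / C)) =
      (\<Sum>w\<in>V - {u}. c u w * ((if w \<in> K then 0 else F (insert w K) / F K) + (v w)\<^sup>2 / C))"
    by (simp add: sum.distrib distrib_left)
  also have "\<dots> \<le> (\<Sum>w\<in>V - {u}. c u w * (F {u, w} / F {u}))"
    using single_root_bound[OF K ne] unfolding C_def v_def
    by (intro sum_mono mult_left_mono) (auto simp: c_nonneg)
  finally have "F K * ((\<Sum>w\<in>V - K. c u w * (F (insert w K) / F K)) + C / d) \<le>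
      F K * (\<Sum>w\<in>V - {u}. c u w * (F {u, w} / F {u}))"
    using FK by (intro mult_left_mono) auto
  moreover have "F K * (\<Sum>w\<in>V - K. c u w * (F (insert w K) / F K)) = (\<Sum>w\<in>V - K. c u w * F (insert w K))"
    unfolding sum_distrib_left using FK by (intro sum.cong) auto
  moreover have "F K * (C / d) = F (K - {u}) / d" unfolding C_def using FK by simp
  ultimately show ?thesis unfolding d_def[symmetric] by (simp only: distrib_left)
qed

end

text \<open>Adding the vertices of \<open>K\<close> to the root set one at a time writes
  \<open>F K / F {x}\<close> as a product of resistances, and \<open>rayleigh_step\<close> compares
  the factors.\<close>

lemma rayleigh_monotonicity:
  assumes n: "connected_network V c" and n': "connected_network V c'"
    and le: "\<And>x y. c x y \<le> c' x y"
    and K: "K \<subseteq> V" "x \<in> K"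
  shows "network.F V c {x} * network.F V c' K \<le> network.F V c K * network.F V c' {x}"
proof -
  interpret a: connected_network V c by fact
  interpret b: connected_network V c' by fact
  have x: "x \<in> V" using K by blast
  have "a.F {x} * b.F (insert x L) \<le> a.F (insert x L) * b.F {x}" if "finite L" "L \<subseteq> V - {x}" for L
    using that
  proof (induction L rule: finite_induct)
    case (insert w L)
    let ?K = "insert x L" and ?K' = "insert x (insert w L)"
    have w: "w \<in> V - ?K" using insert by blast
    have KV: "?K \<subseteq> V" using insert x by blast
    have "a.F ?K > 0" "b.F ?K > 0" using a.F_pos[OF KV] b.F_pos[OF KV] by blast+
    then have step: "a.F ?K * b.F ?K' \<le> a.F ?K' * b.F ?K"
      using rayleigh_step[OF a.network_axioms b.network_axioms le _ _ w] by (simp add: insert_commute)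
    have "a.F ?K * (a.F {x} * b.F ?K') \<le> a.F {x} * (a.F ?K' * b.F ?K)"
      using mult_left_mono[OF step a.F_nonneg[of "{x}"]] by (simp add: mult_ac)
    also have "\<dots> \<le> a.F ?K' * (a.F ?K * b.F {x})"
      using mult_left_mono[OF insert.IH a.F_nonneg[of ?K']] insert by (simp add: mult_ac)
    finally have "a.F ?K * (a.F {x} * b.F ?K') \<le> a.F ?K * (a.F ?K' * b.F {x})"
      by (simp add: mult_ac)
    then show ?case using \<open>a.F ?K > 0\<close> by simp
  qed simp
  moreover have "finite (K - {x})" using K a.finite_V finite_subset by blast
  moreover have "K - {x} \<subseteq> V - {x}" using K by blast
  ultimately show ?thesis using K by (metis insert_Diff)
qed

section \<open>Trees and parent functions\<close>

text \<open>A relation instead of vertex lists, so that relation powers measure distances and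
  closures express reachability. Membership in \<open>verts G\<close> is included because
  \<open>adj\<close> looks at edges only.\<close>

definition step :: "'a sgraph \<Rightarrow> 'a \<Rightarrow> 'a \<Rightarrow> bool" where
  "step G a b \<longleftrightarrow> a \<in> verts G \<and> b \<in> verts G \<and> adj G a b"

lemma adj_sym: "adj G a b \<longleftrightarrow> adj G b a"
  unfolding adj_def by (simp add: insert_commute)

lemma step_sym: "step G a b \<longleftrightarrow> step G b a"
  unfolding step_def using adj_sym by metis

lemma steps_sym: "(step G ^^ k) u v \<longleftrightarrow> (step G ^^ k) v u"
proof -
  have "(step G ^^ k) u v \<Longrightarrow> (step G ^^ k) v u" for u v
  proof (induction k arbitrary: v)
    case (Suc k)
    then obtain w where "(step G ^^ k) u w" "step G w v" by auto
    then show ?case using Suc.IH relpowp_Suc_I2[of "step G" v w k u] step_sym by metis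
  qed simp
  then show ?thesis by blast
qed

lemma walk_iff_steps:
  "(\<exists>p. walk_betw G u p v \<and> length p = Suc k) \<longleftrightarrow> u \<in> verts G \<and> (step G ^^ k) u v"
proof (induction k arbitrary: u)
  case 0
  show ?case
  proof
    assume "\<exists>p. walk_betw G u p v \<and> length p = Suc 0"
    then show "u \<in> verts G \<and> (step G ^^ 0) u v"
      unfolding walk_betw_def by (auto simp: length_Suc_conv)
  next
    assume "u \<in> verts G \<and> (step G ^^ 0) u v"
    then have "walk_betw G u [u] v" unfolding walk_betw_def by auto
    then show "\<exists>p. walk_betw G u p v \<and> length p = Suc 0" by force
  qed
next
  case (Suc k)
  show ?case
  proof
    assume "\<exists>p. walk_betw G u p v \<and> length p = Suc (Suc k)"
    then obtain w q where p: "walk_betw G u (u # w # q) v" "length q = k"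
      unfolding walk_betw_def by (auto simp: length_Suc_conv)
    then have "walk_betw G w (w # q) v" unfolding walk_betw_def by auto
    then have "(step G ^^ k) w v" using Suc[of w] p(2) by auto
    moreover have "step G u w" using p unfolding walk_betw_def step_def by auto
    ultimately show "u \<in> verts G \<and> (step G ^^ Suc k) u v"
      using relpowp_Suc_I2[of "step G" u w k v] unfolding step_def by auto
  next
    assume u: "u \<in> verts G \<and> (step G ^^ Suc k) u v"
    then obtain w where w: "step G u w" "(step G ^^ k) w v" using relpowp_Suc_D2 by metis
    then obtain p where p: "walk_betw G w p v" "length p = Suc k" using Suc[of w] unfolding step_def by auto
    then have "walk_betw G u (u # p) v"
      using w u unfolding walk_betw_def step_def by (auto simp: successively_Cons)
    then show "\<exists>p. walk_betw G u p v \<and> length p = Suc (Suc k)" using p by force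
  qed
qed

lemma gdist_eq: "u \<in> verts G \<Longrightarrow> gdist G u v = (LEAST k. (step G ^^ k) u v)"
  unfolding gdist_def walk_iff_steps by simp

lemma walk_iff_reach: "(\<exists>p. walk_betw G u p v) \<longleftrightarrow> u \<in> verts G \<and> (step G)\<^sup>*\<^sup>* u v"
proof -
  have "(\<exists>p. walk_betw G u p v) \<longleftrightarrow> (\<exists>k p. walk_betw G u p v \<and> length p = Suc k)"
    unfolding walk_betw_def by (metis length_Suc_conv neq_Nil_conv)
  also have "\<dots> \<longleftrightarrow> u \<in> verts G \<and> (\<exists>k. (step G ^^ k) u v)" unfolding walk_iff_steps by blast
  finally show ?thesis by (simp add: rtranclp_power)
qed

lemma connected_iff_reach:
  "graph_connected G \<longleftrightarrow> verts G \<noteq> {} \<and> (\<forall>u\<in>verts G. \<forall>v\<in>verts G. (step G)\<^sup>*\<^sup>* u v)"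
  unfolding graph_connected_def walk_iff_reach by blast

lemma reach_sym: "(step G)\<^sup>*\<^sup>* u v \<Longrightarrow> (step G)\<^sup>*\<^sup>* v u"
  by (induction rule: rtranclp_induct) (auto intro: converse_rtranclp_into_rtranclp step_sym[THEN iffD1])

lemma distinct_walk:
  assumes "walk_betw G u p v"
  shows "\<exists>q. walk_betw G u q v \<and> distinct q"
proof -
  define n where "n = (LEAST n. \<exists>q. walk_betw G u q v \<and> length q = n)"
  have "\<exists>q. walk_betw G u q v \<and> length q = n"
    unfolding n_def by (rule LeastI_ex) (use assms in blast)
  then obtain q where q: "walk_betw G u q v" "length q = n" by blast
  have "distinct q"
  proof (rule ccontr)
    assume "\<not> distinct q"
    then obtain xs ys zs y where d: "q = xs @ [y] @ ys @ [y] @ zs" using not_distinct_decomp by blast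
    have "walk_betw G u (xs @ [y] @ zs) v"
      using q(1) unfolding d walk_betw_def
      by (auto simp: successively_append_iff successively_Cons hd_append last_append split: if_splits)
    then have "n \<le> length (xs @ [y] @ zs)" unfolding n_def by (intro Least_le) blast
    then show False using q(2) d by simp
  qed
  then show ?thesis using q by blast
qed

definition tree_of :: "'a set \<Rightarrow> 'a \<Rightarrow> ('a \<Rightarrow> 'a) \<Rightarrow> 'a sgraph" where
  "tree_of V x f = (V, (\<lambda>y. {y, f y}) ` (V - {x}))"

lemma forests_neq: "f \<in> forests V K \<Longrightarrow> y \<in> V - K \<Longrightarrow> f y \<noteq> y"
  using forests_acyclic leads_refl by metis

lemma forests_not_involutive: "f \<in> forests V K \<Longrightarrow> y \<in> V - K \<Longrightarrow> f (f y) \<noteq> y"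
  using forests_acyclic leads_image by metis

lemma cycle_neighbours:
  assumes "cycle_in G p" "i < length p"
  shows "adj G (p ! i) (p ! (Suc i mod length p))"
proof (cases "Suc i < length p")
  case True
  then show ?thesis using assms unfolding cycle_in_def successively_conv_nth by simp
next
  case False
  then have "Suc i = length p" using assms by simp
  moreover have "p \<noteq> []" using assms by auto
  ultimately show ?thesis
    using assms unfolding cycle_in_def by (metis diff_Suc_1 hd_conv_nth last_conv_nth mod_self)
qed

text \<open>For acyclicity, a vertex \<open>z\<close> of maximal depth on a cycle can be joined
  there only to its parent, since a child would be deeper; but its two neighbours on the cycle are
  different vertices.\<close>

lemma graph_tree_tree_of:
  assumes f: "f \<in> forests V {x}" and x: "x \<in> V"
  shows "graph_tree (tree_of V x f)"
  unfolding graph_tree_def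
proof (intro conjI)
  let ?T = "tree_of V x f"
  show "simple_graph ?T"
    unfolding simple_graph_def tree_of_def
    using forests_neq[OF f] forests_in[OF f] by (auto simp: card_insert_if) metis
  have st: "step ?T y (f y)" if "y \<in> V - {x}" for y
    using that forests_in[OF f] unfolding step_def adj_def tree_of_def by auto
  have to_root: "(step ?T)\<^sup>*\<^sup>* y x" if "y \<in> V" for y
  proof -
    have "(f ^^ n) y = x \<Longrightarrow> y \<in> V \<Longrightarrow> (step ?T)\<^sup>*\<^sup>* y x" for n
    proof (induction n arbitrary: y)
      case (Suc n)
      show ?case
      proof (cases "y = x")
        case False
        have "(step ?T)\<^sup>*\<^sup>* (f y) x"
          using Suc forests_in[OF f] by (simp add: funpow_swap1)
        then show ?thesis using st[of y] False Suc.prems by (simp add: converse_rtranclp_into_rtranclp)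
      qed simp
    qed simp
    then show ?thesis using forests_leads[OF f that] that unfolding leads_def by blast
  qed
  have "verts ?T = V" unfolding tree_of_def by simp
  then show "graph_connected ?T"
    unfolding connected_iff_reach using x to_root reach_sym rtranclp_trans by (metis (no_types) empty_iff)
  show "\<nexists>p. cycle_in ?T p"
  proof
    assume "\<exists>p. cycle_in ?T p"
    then obtain p where p: "cycle_in ?T p" by blast
    then have l3: "3 \<le> length p" and dp: "distinct p" and sp: "set p \<subseteq> V"
      unfolding cycle_in_def tree_of_def by auto
    define depth where "depth y = (LEAST n. (f ^^ n) y = x)" for y
    have depth: "depth y = Suc (depth (f y))" if y: "y \<in> V - {x}" for y
    proof -
      obtain n where "(f ^^ n) y = x" using forests_leads[OF f, of y] y unfolding leads_def by blast
      moreover have "\<not> (f ^^ 0) y = x" using y by simp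
      ultimately have "depth y = Suc (LEAST n. (f ^^ Suc n) y = x)"
        unfolding depth_def by (rule Least_Suc)
      then show ?thesis unfolding depth_def by (simp add: funpow_swap1)
    qed
    define m where "m = Max (depth ` set p)"
    have "set p \<noteq> {}" using l3 by auto
    then have "m \<in> depth ` set p" unfolding m_def by (intro Max_in) auto
    then obtain z where z: "z \<in> set p" "depth z = m" by blast
    have le: "depth y \<le> depth z" if "y \<in> set p" for y
      unfolding z(2) m_def using that by (intro Max_ge) auto
    have nb: "a = f z" if za: "adj ?T z a" "a \<in> set p" for a
    proof -
      obtain y where y: "y \<in> V - {x}" "{z, a} = {y, f y}"
        using za(1) unfolding adj_def tree_of_def by auto
      show ?thesis using y depth[OF y(1)] le[OF za(2)] by (auto simp: doubleton_eq_iff)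
    qed
    obtain i where i: "i < length p" "p ! i = z" using z by (metis in_set_conv_nth)
    \<comment> \<open>The cyclic predecessor of \<open>i\<close>, different from the successor
      because a cycle has at least three vertices.\<close>
    define j where "j = (if i = 0 then length p - 1 else i - 1)"
    have j: "j < length p" "Suc j mod length p = i" using i l3 by (auto simp: j_def)
    have "adj ?T (p ! j) z" using cycle_neighbours[OF p j(1)] j i by simp
    then have "p ! j = f z" using nb[of "p ! j"] j by (simp add: adj_sym)
    moreover have m: "Suc i mod length p < length p" using l3 by (intro mod_less_divisor) auto
    moreover have "p ! (Suc i mod length p) = f z"
      using nb[OF _ nth_mem[OF m]] cycle_neighbours[OF p i(1)] i by simp
    ultimately have "j = Suc i mod length p"
      using nth_eq_iff_index_eq[OF dp j(1) m] by simp
    then show False using i l3 unfolding j_def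
      by (cases "Suc i = length p") (auto split: if_splits)
  qed
qed

text \<open>Breadth-first search: each vertex chooses a neighbour nearer to \<open>x\<close>, and
  the decreasing distance forces every orbit to end in \<open>x\<close>. This serves both to orient
  trees and to show that spanning trees exist.\<close>

lemma connected_parent_function:
  assumes fin: "finite (verts G)" and con: "graph_connected G" and x: "x \<in> verts G"
  shows "\<exists>f \<in> forests (verts G) {x}. \<forall>y \<in> verts G - {x}. adj G y (f y) \<and> gdist G x (f y) < gdist G x y"
proof -
  define dst where "dst = gdist G x"
  have dst: "dst y = (LEAST k. (step G ^^ k) y x)" for y
    unfolding dst_def gdist_eq[OF x] by (subst steps_sym) (rule refl)
  have ex: "\<exists>z. step G y z \<and> dst z < dst y" if y: "y \<in> verts G - {x}" for y
  proof -
    have "\<exists>k. (step G ^^ k) y x"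
      using con x y unfolding connected_iff_reach by (simp add: rtranclp_power)
    then have k: "(step G ^^ dst y) y x" unfolding dst by (rule LeastI_ex)
    then obtain k where k': "dst y = Suc k" using y by (cases "dst y") auto
    then obtain z where z: "step G y z" "(step G ^^ k) z x" using k relpowp_Suc_D2 by metis
    then have "dst z \<le> k" unfolding dst by (intro Least_le)
    then show ?thesis using z k' by auto
  qed
  define f where "f y = (if y \<in> verts G - {x} then SOME z. step G y z \<and> dst z < dst y else y)" for y
  have f: "step G y (f y)" "dst (f y) < dst y" if y: "y \<in> verts G - {x}" for y
    using someI_ex[OF ex[OF y]] y unfolding f_def by auto
  have "leads f y x" if "y \<in> verts G" for y
    using that
  proof (induction "dst y" arbitrary: y rule: less_induct)
    case less
    show ?case
    proof (cases "y = x")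
      case False
      then have "leads f (f y) x" using less f[of y] unfolding step_def by blast
      then show ?thesis using leads_cases by metis
    qed simp
  qed
  moreover have "f y \<in> verts G \<and> adj G y (f y)" if "y \<in> verts G - {x}" for y
    using f(1)[OF that] unfolding step_def by simp
  ultimately have "f \<in> forests (verts G) {x}" unfolding forests_def by (auto simp: f_def)
  moreover have "adj G y (f y) \<and> gdist G x (f y) < gdist G x y" if "y \<in> verts G - {x}" for y
    using f[OF that] unfolding step_def dst_def by blast
  ultimately show ?thesis by blast
qed

text \<open>An edge outside the breadth-first tree would close a cycle with the tree path between
  its ends.\<close>

lemma tree_parent_function:
  assumes fin: "finite (verts T)" and T: "graph_tree T" and x: "x \<in> verts T"
  shows "\<exists>f \<in> forests (verts T) {x}. T = tree_of (verts T) x f \<and>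
    (\<forall>y \<in> verts T - {x}. gdist T x (f y) < gdist T x y)"
proof -
  obtain f where f: "f \<in> forests (verts T) {x}"
    "\<forall>y \<in> verts T - {x}. adj T y (f y) \<and> gdist T x (f y) < gdist T x y"
    using connected_parent_function[OF fin _ x] T unfolding graph_tree_def by blast
  let ?S = "tree_of (verts T) x f"
  have sub: "edges ?S \<subseteq> edges T" using f unfolding tree_of_def adj_def by auto
  have "edges T \<subseteq> edges ?S"
  proof
    fix e assume e: "e \<in> edges T"
    show "e \<in> edges ?S"
    proof (rule ccontr)
      assume ne: "e \<notin> edges ?S"
      have "e \<subseteq> verts T" "card e = 2" using T e unfolding graph_tree_def simple_graph_def by auto
      then obtain a b where ab: "e = {a, b}" "a \<noteq> b" "a \<in> verts T" "b \<in> verts T"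
        by (auto simp: card_2_iff)
      have "graph_connected ?S" using graph_tree_tree_of[OF f(1) x] unfolding graph_tree_def by blast
      then obtain p where "walk_betw ?S a p b"
        using ab unfolding graph_connected_def tree_of_def by auto
      then obtain p where p: "walk_betw ?S a p b" "distinct p" using distinct_walk by metis
      have wT: "set p \<subseteq> verts T" "successively (adj T) p" "hd p = a" "last p = b" "p \<noteq> []"
      proof -
        show "set p \<subseteq> verts T" "hd p = a" "last p = b" "p \<noteq> []"
          using p unfolding walk_betw_def tree_of_def by auto
        have "successively (adj ?S) p" using p unfolding walk_betw_def by auto
        then show "successively (adj T) p"
          by (rule successively_mono) (use sub in \<open>auto simp: adj_def\<close>)
      qed
      have "length p \<noteq> 1" using wT ab by (auto simp: length_Suc_conv)
      moreover have "length p \<noteq> 2"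
        using p(1) ne ab unfolding walk_betw_def adj_def by (auto simp: length_Suc_conv numeral_2_eq_2)
      moreover have "length p \<noteq> 0" using wT by simp
      ultimately have "3 \<le> length p" by linarith
      then have "cycle_in T p"
        using wT p(2) e ab unfolding cycle_in_def adj_def by (auto simp: insert_commute)
      then show False using T unfolding graph_tree_def by blast
    qed
  qed
  then have "T = ?S" using sub unfolding tree_of_def by (simp add: prod_eq_iff)
  then show ?thesis using f by blast
qed

text \<open>Induction on the number of steps to the root. The edge \<open>{y, f y}\<close> must be a
  parent edge of \<open>g\<close>; if it were the one of \<open>f y\<close>, then agreement of
  \<open>f\<close> and \<open>g\<close> at \<open>f y\<close> would give
  \<open>f (f y) = y\<close>.\<close>

lemma tree_of_inj:
  assumes f: "f \<in> forests V {x}" and g: "g \<in> forests V {x}"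
    and e: "tree_of V x f = tree_of V x g"
  shows "f = g"
proof
  fix y
  have "f y = g y" if "y \<in> V" "(f ^^ n) y = x" for n y
    using that
  proof (induction n arbitrary: y)
    case 0
    then show ?case using forests_fixed[OF f, of x] forests_fixed[OF g, of x] by simp
  next
    case (Suc n)
    show ?case
    proof (cases "y = x")
      case True
      then show ?thesis using forests_fixed[OF f, of x] forests_fixed[OF g, of x] by simp
    next
      case False
      have IH: "f (f y) = g (f y)" using Suc forests_in[OF f] by (simp add: funpow_swap1)
      have "{y, f y} \<in> edges (tree_of V x g)"
        using False Suc.prems unfolding e[symmetric] by (simp add: tree_of_def)
      then obtain z where z: "z \<in> V - {x}" "{y, f y} = {z, g z}" unfolding tree_of_def by auto
      then show ?thesis
        using IH forests_not_involutive[OF f, of y] False Suc.prems by (auto simp: doubleton_eq_iff)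
    qed
  qed
  then show "f y = g y"
    using forests_leads[OF f, of y] forests_fixed[OF f, of y] forests_fixed[OF g, of y]
    unfolding leads_def by (cases "y \<in> V") auto
qed

definition graph_forests :: "'a sgraph \<Rightarrow> 'a set \<Rightarrow> ('a \<Rightarrow> 'a) set" where
  "graph_forests G K = {f \<in> forests (verts G) K. \<forall>y \<in> verts G - K. adj G y (f y)}"

lemma bij_betw_tree_of:
  assumes fin: "finite (verts G)" and x: "x \<in> verts G"
  shows "bij_betw (tree_of (verts G) x) (graph_forests G {x}) (spanning_trees G)"
  unfolding bij_betw_def
proof
  let ?V = "verts G"
  show "inj_on (tree_of ?V x) (graph_forests G {x})"
    by (intro inj_onI tree_of_inj[of _ ?V x]) (auto simp: graph_forests_def)
  show "tree_of ?V x ` graph_forests G {x} = spanning_trees G"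
  proof
    show "tree_of ?V x ` graph_forests G {x} \<subseteq> spanning_trees G"
      using graph_tree_tree_of[OF _ x] unfolding spanning_trees_def graph_forests_def
      by (auto simp: tree_of_def adj_def)
    show "spanning_trees G \<subseteq> tree_of ?V x ` graph_forests G {x}"
    proof
      fix T assume T: "T \<in> spanning_trees G"
      then have vT: "verts T = ?V" and sub: "edges T \<subseteq> edges G" unfolding spanning_trees_def by auto
      obtain f where f: "f \<in> forests ?V {x}" "T = tree_of ?V x f"
        using tree_parent_function[of T x] T fin x vT unfolding spanning_trees_def by auto
      have "f \<in> graph_forests G {x}"
        using f(1) sub unfolding f(2) graph_forests_def tree_of_def adj_def by auto
      then show "T \<in> tree_of ?V x ` graph_forests G {x}" using f by blast
    qed
  qed
qed

lemma finite_spanning_trees: "finite (verts G) \<Longrightarrow> finite (spanning_trees G)"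
proof (cases "verts G = {}")
  case True
  then have "spanning_trees G = {}"
    unfolding spanning_trees_def graph_tree_def graph_connected_def by auto
  then show ?thesis by simp
next
  case False
  assume fin: "finite (verts G)"
  obtain x where x: "x \<in> verts G" using False by blast
  have "finite (graph_forests G {x})" unfolding graph_forests_def using finite_forests[OF fin] by simp
  then show ?thesis using bij_betw_finite[OF bij_betw_tree_of[OF fin x]] by simp
qed

lemma spanning_trees_nonempty:
  assumes "finite (verts G)" "graph_connected G"
  shows "spanning_trees G \<noteq> {}"
proof -
  obtain x where x: "x \<in> verts G" using assms(2) unfolding graph_connected_def by blast
  have "graph_forests G {x} \<noteq> {}"
    using connected_parent_function[OF assms x] unfolding graph_forests_def by blast
  then show ?thesis using bij_betw_tree_of[OF assms(1) x] unfolding bij_betw_def by blast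
qed

lemma inj_on_parent_edge:
  assumes "f \<in> forests V K"
  shows "inj_on (\<lambda>y. {y, f y}) (V - K)"
  using forests_not_involutive[OF assms] by (intro inj_onI) (auto simp: doubleton_eq_iff)

section \<open>Forests and spanning trees that contain a prescribed subtree\<close>

fun grow :: "'a set \<Rightarrow> 'a set \<Rightarrow> ('a \<times> 'a) list \<Rightarrow> bool" where
  "grow V R [] \<longleftrightarrow> True"
| "grow V R ((w, u) # cs) \<longleftrightarrow> w \<in> V - R \<and> u \<in> R \<and> grow V (insert w R) cs"

lemma grow_snoc:
  "grow V R (cs @ [(w, u)]) \<longleftrightarrow>
     grow V R cs \<and> w \<in> V - (R \<union> fst ` set cs) \<and> u \<in> R \<union> fst ` set cs"
  by (induction V R cs rule: grow.induct) auto

lemma grow_fresh: "grow V R cs \<Longrightarrow> w \<in> R \<Longrightarrow> w \<notin> fst ` set cs"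
  by (induction V R cs rule: grow.induct) auto

text \<open>A vertex \<open>w\<close> with prescribed parent \<open>u\<close> in the root set can be
  turned into a root, which splits off the factor \<open>c w u\<close>. No condition is lost:
  hanging \<open>w\<close> below \<open>u\<close> again cannot create a cycle, because
  \<open>u\<close> is a root. The order recorded by \<open>grow\<close> lets this be
  repeated.\<close>

lemma (in network) sum_forests_constrained:
  assumes "grow V R cs" "R \<subseteq> V"
  shows "(\<Sum>f | f \<in> forests V R \<and> (\<forall>(w, u)\<in>set cs. f w = u). weight R f) =
     (\<Prod>(w, u)\<leftarrow>cs. c w u) * F (R \<union> fst ` set cs)"
  using assms
proof (induction cs arbitrary: R)
  case Nil
  then show ?case by (simp add: F_def)
next
  case (Cons a cs)
  obtain w u where a: "a = (w, u)" by (cases a)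
  have w: "w \<in> V - R" and u: "u \<in> R" and gr: "grow V (insert w R) cs" using Cons.prems a by auto
  have "w \<notin> fst ` set cs" using grow_fresh[OF gr] by simp
  then have nw: "w' \<noteq> w" if "(w', u') \<in> set cs" for w' u' using that by force
  have uV: "u \<in> V" and RV: "insert w R \<subseteq> V" using u w Cons.prems by auto
  have "(\<Sum>f | f \<in> forests V R \<and> (\<forall>(w, u)\<in>set (a # cs). f w = u). weight R f) =
     (\<Sum>f | f \<in> forests V (insert w R) \<and> (\<forall>(w, u)\<in>set cs. f w = u). c w u * weight (insert w R) f)"
  proof (rule sum.reindex_bij_witness[of _ "\<lambda>f. f(w := u)" "\<lambda>f. f(w := w)"])
    fix f assume f: "f \<in> {f \<in> forests V R. \<forall>(w, u)\<in>set (a # cs). f w = u}"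
    then have fw: "f w = u" using a by simp
    show "(f(w := w))(w := u) = f" using fw by auto
    show "f(w := w) \<in> {f \<in> forests V (insert w R). (\<forall>(w, u)\<in>set cs. f w = u)}"
      using f forests_add_root(1)[of f V R w] w nw forests_in[of f V R w] fw by auto
    have V: "V - R = insert w (V - insert w R)" using w by blast
    have "weight R f = c w (f w) * (\<Prod>x\<in>V - insert w R. c x (f x))"
      unfolding weight_def by (subst V, subst prod.insert) (use finite_V in auto)
    also have "(\<Prod>x\<in>V - insert w R. c x (f x)) = weight (insert w R) (f(w := w))"
      unfolding weight_def by (intro prod.cong) auto
    finally show "c w u * weight (insert w R) (f(w := w)) = weight R f" using fw by simp
  next
    fix f assume f: "f \<in> {f \<in> forests V (insert w R). (\<forall>(w, u)\<in>set cs. f w = u)}"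
    then have fin: "f \<in> forests V (insert w R)" by auto
    have fw: "f w = w" using forests_fixed[OF fin, of w] by simp
    then show "(f(w := u))(w := w) = f" by auto
    have "\<not> leads f u w" using leads_fixed[of f u w] forests_fixed[OF fin, of u] u w by auto
    then have "f(w := u) \<in> forests V R" using forests_remove_root[OF fin w uV] by simp
    then show "f(w := u) \<in> {f \<in> forests V R. \<forall>(w, u)\<in>set (a # cs). f w = u}"
      using f nw a by auto
  qed
  also have "\<dots> = (\<Prod>(w, u)\<leftarrow>a # cs. c w u) * F (R \<union> fst ` set (a # cs))"
    using Cons.IH[OF gr RV] a by (simp add: sum_distrib_left[symmetric] mult.assoc)
  finally show ?case .
qed

section \<open>Trees encoded by parent lists\<close>

text \<open>The list \<open>ps\<close> encodes the tree on \<open>{0..length ps}\<close> in which vertex \<open>i + 1\<close> is attached to the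
  earlier vertex \<open>ps ! i\<close>. A copy of it in a graph is the list of the images of the vertices.\<close>

definition valid_code :: "nat list \<Rightarrow> bool" where
  "valid_code ps \<longleftrightarrow> (\<forall>i<length ps. ps ! i \<le> i)"

definition copies :: "'a set \<Rightarrow> 'a set set \<Rightarrow> nat list \<Rightarrow> 'a list set" where
  "copies U E ps = {xs. length xs = Suc (length ps) \<and> distinct xs \<and> set xs \<subseteq> U \<and>
     (\<forall>i<length ps. {xs ! (ps ! i), xs ! Suc i} \<in> E)}"

definition code_edges :: "nat list \<Rightarrow> 'a list \<Rightarrow> 'a set set" where
  "code_edges ps xs = (\<lambda>i. {xs ! (ps ! i), xs ! Suc i}) ` {..<length ps}"

lemma valid_code_Nil [simp]: "valid_code []"
  unfolding valid_code_def by simp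

lemma valid_code_snoc [simp]: "valid_code (ps @ [p]) \<longleftrightarrow> valid_code ps \<and> p \<le> length ps"
  unfolding valid_code_def by (auto simp: nth_append less_Suc_eq)

lemma copies_Nil: "copies U E [] = (\<lambda>x. [x]) ` U"
  unfolding copies_def by (auto simp: length_Suc_conv)

lemma code_edges_Nil [simp]: "code_edges [] xs = {}"
  unfolding code_edges_def by simp

lemma nth_snoc_code:
  assumes "valid_code ps" "length xs = Suc (length ps)" "i < length ps"
  shows "(xs @ [w]) ! ((ps @ [p]) ! i) = xs ! (ps ! i)" "(xs @ [w]) ! Suc i = xs ! Suc i"
proof -
  have "ps ! i \<le> i" using assms unfolding valid_code_def by blast
  then show "(xs @ [w]) ! ((ps @ [p]) ! i) = xs ! (ps ! i)" "(xs @ [w]) ! Suc i = xs ! Suc i"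
    using assms by (simp_all add: nth_append)
qed

lemma code_edges_snoc:
  assumes "valid_code ps" "p \<le> length ps" "length xs = Suc (length ps)"
  shows "code_edges (ps @ [p]) (xs @ [w]) = insert {xs ! p, w} (code_edges ps xs)"
proof -
  let ?h = "\<lambda>i. {(xs @ [w]) ! ((ps @ [p]) ! i), (xs @ [w]) ! Suc i}"
  have "?h i = {xs ! (ps ! i), xs ! Suc i}" if "i < length ps" for i
    using nth_snoc_code[OF assms(1,3) that] by simp
  then have "?h ` {..<length ps} = code_edges ps xs" unfolding code_edges_def by (intro image_cong) auto
  moreover have "?h (length ps) = {xs ! p, w}" using assms by (simp add: nth_append)
  moreover have "code_edges (ps @ [p]) (xs @ [w]) = insert (?h (length ps)) (?h ` {..<length ps})"
    unfolding code_edges_def by (simp add: lessThan_Suc)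
  ultimately show ?thesis by simp
qed

lemma copies_snoc_iff:
  assumes "valid_code ps" "p \<le> length ps"
  shows "xs @ [w] \<in> copies U E (ps @ [p]) \<longleftrightarrow>
     xs \<in> copies U E ps \<and> w \<in> U - set xs \<and> {xs ! p, w} \<in> E"
proof (cases "length xs = Suc (length ps)")
  case True
  let ?h = "\<lambda>i. {(xs @ [w]) ! ((ps @ [p]) ! i), (xs @ [w]) ! Suc i} \<in> E"
  have "?h i \<longleftrightarrow> {xs ! (ps ! i), xs ! Suc i} \<in> E" if "i < length ps" for i
    using nth_snoc_code[OF assms(1) True that] by simp
  then have "(\<forall>i<length ps. ?h i) \<longleftrightarrow> (\<forall>i<length ps. {xs ! (ps ! i), xs ! Suc i} \<in> E)" by blast
  moreover have "?h (length ps) \<longleftrightarrow> {xs ! p, w} \<in> E" using assms True by (simp add: nth_append)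
  moreover have "(\<forall>i<length (ps @ [p]). ?h i) \<longleftrightarrow> (\<forall>i<length ps. ?h i) \<and> ?h (length ps)"
    unfolding length_append_singleton less_Suc_eq by blast
  ultimately show ?thesis
    using True unfolding copies_def mem_Collect_eq by auto
qed (auto simp: copies_def)

lemma copies_snoc:
  assumes "valid_code ps" "p \<le> length ps"
  shows "copies U E (ps @ [p]) =
     (\<lambda>(xs, w). xs @ [w]) ` (SIGMA xs:copies U E ps. {w \<in> U - set xs. {xs ! p, w} \<in> E})"
    (is "?L = ?R")
proof
  show "?L \<subseteq> ?R"
  proof
    fix ys assume y: "ys \<in> ?L"
    then have "ys \<noteq> []" unfolding copies_def by auto
    then obtain xs w where "ys = xs @ [w]" by (metis append_butlast_last_id)
    then show "ys \<in> ?R" using y copies_snoc_iff[OF assms] by fastforce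
  qed
  show "?R \<subseteq> ?L" using copies_snoc_iff[OF assms] by fastforce
qed

lemma finite_copies: "finite U \<Longrightarrow> finite (copies U E ps)"
  by (rule finite_subset[OF _ finite_lists_length_eq[of U "Suc (length ps)"]]) (auto simp: copies_def)

lemma sum_copies_snoc:
  assumes "valid_code ps" "p \<le> length ps" "finite U"
  shows "sum f (copies U E (ps @ [p])) =
     (\<Sum>xs\<in>copies U E ps. \<Sum>w | w \<in> U - set xs \<and> {xs ! p, w} \<in> E. f (xs @ [w]))"
proof -
  have "inj_on (\<lambda>(xs, w). xs @ [w]) (SIGMA xs:copies U E ps. {w \<in> U - set xs. {xs ! p, w} \<in> E})"
    by (auto intro!: inj_onI)
  then have "sum f (copies U E (ps @ [p])) =
     (\<Sum>(xs, w)\<in>(SIGMA xs:copies U E ps. {w \<in> U - set xs. {xs ! p, w} \<in> E}). f (xs @ [w]))"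
    unfolding copies_snoc[OF assms(1,2)] by (subst sum.reindex) (auto simp: case_prod_beta)
  then show ?thesis by (subst sum.Sigma) (auto simp: finite_copies assms(3))
qed

lemma copies_length: "xs \<in> copies U E ps \<Longrightarrow> length xs = Suc (length ps)"
  unfolding copies_def by blast

lemma copies_card: "xs \<in> copies U E ps \<Longrightarrow> card (set xs) = Suc (length ps)"
  unfolding copies_def by (auto simp: distinct_card)

lemma copies_subset: "xs \<in> copies U E ps \<Longrightarrow> set xs \<subseteq> U"
  unfolding copies_def by blast

lemma copies_mono: "U \<subseteq> U' \<Longrightarrow> E \<subseteq> E' \<Longrightarrow> copies U E ps \<subseteq> copies U' E' ps"
  unfolding copies_def by blast

lemma copies_code_edges: "xs \<in> copies U E ps \<Longrightarrow> code_edges ps xs \<subseteq> E"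
  unfolding copies_def code_edges_def by auto

lemma copies_restrict: "xs \<in> copies U E ps \<Longrightarrow> code_edges ps xs \<subseteq> E' \<Longrightarrow> xs \<in> copies U E' ps"
  unfolding copies_def code_edges_def by auto

definition parent_pairs :: "nat list \<Rightarrow> 'a list \<Rightarrow> ('a \<times> 'a) list" where
  "parent_pairs ps xs = map (\<lambda>i. (xs ! Suc i, xs ! (ps ! i))) [0..<length ps]"

lemma parent_pairs_snoc:
  assumes "valid_code ps" "p \<le> length ps" "length xs = Suc (length ps)"
  shows "parent_pairs (ps @ [p]) (xs @ [w]) = parent_pairs ps xs @ [(w, xs ! p)]"
proof -
  let ?h = "\<lambda>i. ((xs @ [w]) ! Suc i, (xs @ [w]) ! ((ps @ [p]) ! i))"
  have "?h i = (xs ! Suc i, xs ! (ps ! i))" if "i < length ps" for i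
    using nth_snoc_code[OF assms(1,3) that] by simp
  then have "map ?h [0..<length ps] = parent_pairs ps xs" unfolding parent_pairs_def by (intro map_cong) auto
  moreover have "?h (length ps) = (w, xs ! p)" using assms by (simp add: nth_append)
  moreover have "parent_pairs (ps @ [p]) (xs @ [w]) = map ?h [0..<length ps] @ [?h (length ps)]"
    unfolding parent_pairs_def by simp
  ultimately show ?thesis by simp
qed

lemma grow_parent_pairs:
  assumes "valid_code ps" "xs \<in> copies V E ps"
  shows "grow V {xs ! 0} (parent_pairs ps xs) \<and> {xs ! 0} \<union> fst ` set (parent_pairs ps xs) = set xs"
  using assms
proof (induction ps arbitrary: xs rule: rev_induct)
  case Nil
  then show ?case by (auto simp: copies_Nil parent_pairs_def)
next
  case (snoc p ps)
  then have v: "valid_code ps" "p \<le> length ps" by auto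
  obtain ys w where ys: "xs = ys @ [w]" "ys \<in> copies V E ps" "w \<in> V - set ys"
    using snoc.prems(2) unfolding copies_snoc[OF v] by auto
  have l: "length ys = Suc (length ps)" using ys copies_length by blast
  have IH: "grow V {ys ! 0} (parent_pairs ps ys)" "{ys ! 0} \<union> fst ` set (parent_pairs ps ys) = set ys"
    using snoc.IH[OF v(1) ys(2)] by auto
  have "xs ! 0 = ys ! 0" using ys l by (simp add: nth_append)
  moreover have "ys ! p \<in> set ys" using l v by simp
  ultimately show ?case
    unfolding ys(1) parent_pairs_snoc[OF v l] grow_snoc using IH ys by auto
qed

text \<open>With the root at \<open>xs ! 0\<close>, the edges of the copy must be oriented towards
  the earlier vertex. By induction, an earlier vertex already has a still earlier one as parent, so
  it cannot have the later one.\<close>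

lemma code_edges_tree_of:
  assumes v: "valid_code ps" and xs: "xs \<in> copies V E ps" and f: "f \<in> forests V {xs ! 0}"
  shows "code_edges ps xs \<subseteq> edges (tree_of V (xs ! 0) f) \<longleftrightarrow>
     (\<forall>(w, u)\<in>set (parent_pairs ps xs). f w = u)"
proof
  have d: "distinct xs" and l: "length xs = Suc (length ps)" and sub: "set xs \<subseteq> V"
    using xs unfolding copies_def by auto
  have vi: "ps ! i \<le> i" if "i < length ps" for i using v that unfolding valid_code_def by blast
  {
    assume A: "code_edges ps xs \<subseteq> edges (tree_of V (xs ! 0) f)"
    have "f (xs ! Suc i) = xs ! (ps ! i)" if "i < length ps" for i
      using that
    proof (induction i rule: less_induct)
      case (less i)
      have "{xs ! (ps ! i), xs ! Suc i} \<in> edges (tree_of V (xs ! 0) f)"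
        using A less.prems unfolding code_edges_def by auto
      then obtain y where y: "y \<in> V - {xs ! 0}" "{xs ! (ps ! i), xs ! Suc i} = {y, f y}"
        unfolding tree_of_def by auto
      show ?case
      proof (cases "y = xs ! Suc i")
        case True
        then show ?thesis using y by (auto simp: doubleton_eq_iff)
      next
        case False
        then have yp: "y = xs ! (ps ! i)" "f y = xs ! Suc i" using y by (auto simp: doubleton_eq_iff)
        then have "ps ! i \<noteq> 0" using y by (metis DiffD2 singletonI)
        then obtain j where j: "ps ! i = Suc j" by (cases "ps ! i") auto
        then have ji: "j < i" using vi[OF less.prems] by simp
        then have "f (xs ! Suc j) = xs ! (ps ! j)" using less by simp
        then have "xs ! Suc i = xs ! (ps ! j)" using yp j by simp
        moreover have "ps ! j < Suc i" using vi[of j] ji less.prems by simp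
        ultimately show ?thesis
          using d l less.prems nth_eq_iff_index_eq[of xs "Suc i" "ps ! j"] by simp
      qed
    qed
    then show "\<forall>(w, u)\<in>set (parent_pairs ps xs). f w = u" unfolding parent_pairs_def by auto
  }
  {
    assume A: "\<forall>(w, u)\<in>set (parent_pairs ps xs). f w = u"
    show "code_edges ps xs \<subseteq> edges (tree_of V (xs ! 0) f)"
    proof
      fix e assume "e \<in> code_edges ps xs"
      then obtain i where i: "i < length ps" "e = {xs ! (ps ! i), xs ! Suc i}" unfolding code_edges_def by auto
      then have "f (xs ! Suc i) = xs ! (ps ! i)" using A unfolding parent_pairs_def by auto
      moreover have "xs ! Suc i \<in> V - {xs ! 0}"
        using i l sub d nth_eq_iff_index_eq[of xs "Suc i" 0] nth_mem[of "Suc i" xs] by auto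
      ultimately show "e \<in> edges (tree_of V (xs ! 0) f)"
        using i unfolding tree_of_def by (auto simp: insert_commute)
    qed
  }
qed

section \<open>Spanning trees of a graph with weighted edges\<close>

definition edge_net :: "'a sgraph \<Rightarrow> ('a set \<Rightarrow> real) \<Rightarrow> 'a \<Rightarrow> 'a \<Rightarrow> real" where
  "edge_net G W x y = (if {x, y} \<in> edges G then W {x, y} else 0)"

locale finite_connected_graph =
  fixes G :: "'a sgraph"
  assumes fin: "finite (verts G)" and simple: "simple_graph G" and conn: "graph_connected G"
begin

lemma network_edge_net:
  assumes "\<And>e. 0 \<le> W e"
  shows "network (verts G) (edge_net G W)"
  by unfold_locales (auto simp: fin edge_net_def insert_commute assms)

lemma sum_forests_trees:
  assumes W: "\<And>e. 0 \<le> W e" and x: "x \<in> verts G"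
  shows "(\<Sum>f | f \<in> forests (verts G) {x} \<and> P (tree_of (verts G) x f).
       network.weight (verts G) (edge_net G W) {x} f) =
     (\<Sum>\<Gamma> | \<Gamma> \<in> spanning_trees G \<and> P \<Gamma>. \<Prod>e\<in>edges \<Gamma>. W e)"
proof -
  interpret network "verts G" "edge_net G W" by (rule network_edge_net[OF W])
  let ?V = "verts G" and ?t = "tree_of (verts G) x"
  have bij: "bij_betw ?t (graph_forests G {x}) (spanning_trees G)" by (rule bij_betw_tree_of[OF fin x])
  have w: "weight {x} f = (if \<forall>y\<in>?V - {x}. adj G y (f y) then \<Prod>e\<in>edges (?t f). W e else 0)"
    if f: "f \<in> forests ?V {x}" for f
  proof (cases "\<forall>y\<in>?V - {x}. adj G y (f y)")
    case True
    then have "weight {x} f = (\<Prod>y\<in>?V - {x}. W {y, f y})"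
      unfolding weight_def edge_net_def adj_def by (intro prod.cong) auto
    also have "\<dots> = (\<Prod>e\<in>edges (?t f). W e)"
      unfolding tree_of_def snd_conv by (subst prod.reindex) (use inj_on_parent_edge[OF f] in auto)
    finally show ?thesis using True by simp
  next
    case False
    then obtain y where y: "y \<in> ?V - {x}" "\<not> adj G y (f y)" by blast
    have "weight {x} f = 0"
      unfolding weight_def by (rule prod_zero) (use fin y in \<open>auto simp: edge_net_def adj_def\<close>)
    then show ?thesis using False by auto
  qed
  have "(\<Sum>f | f \<in> forests ?V {x} \<and> P (?t f). weight {x} f) =
      (\<Sum>f | f \<in> graph_forests G {x} \<and> P (?t f). \<Prod>e\<in>edges (?t f). W e)"
    by (rule sum.mono_neutral_cong_right)
      (auto simp: graph_forests_def w finite_forests[OF fin])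
  also have "\<dots> = (\<Sum>\<Gamma> | \<Gamma> \<in> spanning_trees G \<and> P \<Gamma>. \<Prod>e\<in>edges \<Gamma>. W e)"
  proof (rule sum.reindex_bij_betw[of ?t, where g = "\<lambda>\<Gamma>. \<Prod>e\<in>edges \<Gamma>. W e"])
    have img: "?t ` graph_forests G {x} = spanning_trees G" using bij unfolding bij_betw_def by blast
    have "?t ` {f \<in> graph_forests G {x}. P (?t f)} = {\<Gamma> \<in> spanning_trees G. P \<Gamma>}"
      unfolding img[symmetric] by blast
    then show "bij_betw ?t {f \<in> graph_forests G {x}. P (?t f)} {\<Gamma> \<in> spanning_trees G. P \<Gamma>}"
      using bij unfolding bij_betw_def by (auto intro: inj_on_subset)
  qed
  finally show ?thesis .
qed

lemma F_root:
  assumes "\<And>e. 0 \<le> W e" "x \<in> verts G"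
  shows "network.F (verts G) (edge_net G W) {x} = (\<Sum>\<Gamma>\<in>spanning_trees G. \<Prod>e\<in>edges \<Gamma>. W e)"
  using sum_forests_trees[OF assms, where P = "\<lambda>_. True"] network.F_def[OF network_edge_net[OF assms(1)]] by simp

lemma connected_network_edge_net:
  assumes "\<And>e. 0 < W e"
  shows "connected_network (verts G) (edge_net G W)"
proof -
  have W: "\<And>e. 0 \<le> W e" using assms less_imp_le by blast
  interpret network "verts G" "edge_net G W" by (rule network_edge_net[OF W])
  show ?thesis
  proof unfold_locales
    fix x assume x: "x \<in> verts G"
    have "0 < (\<Sum>\<Gamma>\<in>spanning_trees G. \<Prod>e\<in>edges \<Gamma>. W e)"
      by (rule sum_pos) (auto intro: prod_pos assms finite_spanning_trees[OF fin]
          simp: spanning_trees_nonempty[OF fin conn])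
    then show "F {x} > 0" using F_root[OF W x] by simp
  qed
qed

text \<open>Rooted at the first vertex, a tree containing the copy has the parents of all other copy
  vertices prescribed, so \<open>sum_forests_constrained\<close> applies. Weights equal to 1 give
  containment probabilities; general weights are for \<open>negative_correlation\<close>.\<close>

lemma F_copy:
  assumes W: "\<And>e. 0 \<le> W e" and v: "valid_code ps" and xs: "xs \<in> copies (verts G) (edges G) ps"
  shows "(\<Sum>\<Gamma> | \<Gamma> \<in> spanning_trees G \<and> code_edges ps xs \<subseteq> edges \<Gamma>. \<Prod>e\<in>edges \<Gamma>. W e) =
     (\<Prod>i<length ps. W {xs ! (ps ! i), xs ! Suc i}) * network.F (verts G) (edge_net G W) (set xs)"
proof -
  interpret network "verts G" "edge_net G W" by (rule network_edge_net[OF W])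
  let ?x = "xs ! 0"
  have x: "?x \<in> verts G" using xs unfolding copies_def by (metis (mono_tags, lifting) mem_Collect_eq nth_mem subsetD zero_less_Suc)
  have "(\<Sum>\<Gamma> | \<Gamma> \<in> spanning_trees G \<and> code_edges ps xs \<subseteq> edges \<Gamma>. \<Prod>e\<in>edges \<Gamma>. W e) =
     (\<Sum>f | f \<in> forests (verts G) {?x} \<and> code_edges ps xs \<subseteq> edges (tree_of (verts G) ?x f). weight {?x} f)"
    by (rule sum_forests_trees[OF W x, symmetric])
  also have "\<dots> = (\<Sum>f | f \<in> forests (verts G) {?x} \<and> (\<forall>(w, u)\<in>set (parent_pairs ps xs). f w = u). weight {?x} f)"
    by (intro sum.cong) (use code_edges_tree_of[OF v xs] in auto)
  also have "\<dots> = (\<Prod>(w, u)\<leftarrow>parent_pairs ps xs. edge_net G W w u) * F (set xs)"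
    using sum_forests_constrained[of "{?x}" "parent_pairs ps xs"] grow_parent_pairs[OF v xs] x by simp
  also have "(\<Prod>(w, u)\<leftarrow>parent_pairs ps xs. edge_net G W w u) =
      (\<Prod>i<length ps. edge_net G W (xs ! Suc i) (xs ! (ps ! i)))"
    unfolding parent_pairs_def map_map comp_def prod.case
    by (subst prod.list_conv_set_nth) (auto simp: lessThan_atLeast0)
  also have "\<dots> = (\<Prod>i<length ps. W {xs ! (ps ! i), xs ! Suc i})"
    using xs unfolding edge_net_def copies_def by (intro prod.cong) (auto simp: insert_commute)
  finally show ?thesis .
qed

end

section \<open>Uniform spanning trees\<close>

lemma tree_ordered_edges:
  assumes fin: "finite V" and x: "x \<in> V" and f: "f \<in> forests V {x}"
  shows "card {(u, w). u \<in> V \<and> w \<in> V \<and> {u, w} \<in> edges (tree_of V x f)} = 2 * (card V - 1)"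
proof -
  let ?A = "(\<lambda>y. (y, f y)) ` (V - {x})" and ?B = "(\<lambda>y. (f y, y)) ` (V - {x})"
  have "{(u, w). u \<in> V \<and> w \<in> V \<and> {u, w} \<in> edges (tree_of V x f)} = ?A \<union> ?B"
    using forests_in[OF f] unfolding tree_of_def by (auto simp: doubleton_eq_iff)
  moreover have "?A \<inter> ?B = {}" using forests_not_involutive[OF f] by auto
  moreover have "card ?A = card V - 1" "card ?B = card V - 1"
    using fin x by (subst card_image; auto intro: inj_onI)+
  ultimately show ?thesis using fin by (simp add: card_Un_disjoint)
qed

context finite_connected_graph
begin

abbreviation "V \<equiv> verts G"
abbreviation "E \<equiv> edges G"

definition tau :: real where
  "tau = real (card (spanning_trees G))"

definition tree_prob :: "'a set set \<Rightarrow> real" where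
  "tree_prob A = real (card {\<Gamma> \<in> spanning_trees G. A \<subseteq> edges \<Gamma>}) / tau"

text \<open>Expectation under the uniform spanning tree, kept as a finite average; the link to
  \<open>ust\<close> is made by Markov's inequality in \<open>ust_prob_le\<close>.\<close>

definition avg :: "('a sgraph \<Rightarrow> real) \<Rightarrow> real" where
  "avg f = (\<Sum>\<Gamma>\<in>spanning_trees G. f \<Gamma>) / tau"

sublocale unit: connected_network V "edge_net G (\<lambda>_. 1)"
  by (rule connected_network_edge_net) simp

text \<open>When \<open>K\<close> is the vertex set of a subtree of \<open>G\<close>, this is the probability that the uniform spanning
  tree contains that subtree. Consequently \<open>mean_degree u\<close> below is the expected degree of \<open>u\<close>.\<close>

definition forest_ratio :: "'a set \<Rightarrow> real" where
  "forest_ratio K = unit.F K / tau"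

definition mean_degree :: "'a \<Rightarrow> real" where
  "mean_degree u = (\<Sum>w | w \<in> V - {u} \<and> {u, w} \<in> E. forest_ratio {u, w})"

abbreviation deg :: "'a \<Rightarrow> nat" where
  "deg \<equiv> degree_of G"

lemma finite_ST: "finite (spanning_trees G)"
  by (rule finite_spanning_trees[OF fin])

lemma tau_pos: "tau > 0"
  unfolding tau_def using finite_ST spanning_trees_nonempty[OF fin conn] by (simp add: card_gt_0_iff)

lemma V_nonempty: "V \<noteq> {}"
  using conn unfolding graph_connected_def by blast

lemma ST_props:
  assumes "\<Gamma> \<in> spanning_trees G"
  shows "verts \<Gamma> = V" "edges \<Gamma> \<subseteq> E" "graph_tree \<Gamma>"
  using assms unfolding spanning_trees_def by auto

lemma edge_props: "{u, w} \<in> E \<Longrightarrow> u \<in> V \<and> w \<in> V \<and> u \<noteq> w"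
  using simple unfolding simple_graph_def by (auto simp: card_insert_if)

lemma unit_F_root: "x \<in> V \<Longrightarrow> unit.F {x} = tau"
  using F_root[of "\<lambda>_. 1" x] by (simp add: tau_def)

lemma forest_ratio_single: "x \<in> V \<Longrightarrow> forest_ratio {x} = 1"
  unfolding forest_ratio_def using unit_F_root tau_pos by simp

lemma forest_ratio_nonneg: "0 \<le> forest_ratio K"
  unfolding forest_ratio_def using unit.F_nonneg tau_pos by simp

lemma tree_prob_nonneg: "0 \<le> tree_prob A"
  unfolding tree_prob_def using tau_pos by simp

lemma tree_prob_copy:
  assumes "valid_code ps" "xs \<in> copies V E ps"
  shows "tree_prob (code_edges ps xs) = forest_ratio (set xs)"
  using F_copy[of "\<lambda>_. 1", OF _ assms] unfolding tree_prob_def forest_ratio_def by simp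

lemma tree_prob_edge:
  assumes "{u, w} \<in> E"
  shows "tree_prob {{u, w}} = forest_ratio {u, w}"
proof -
  have "[u, w] \<in> copies V E [0]"
    using edge_props[OF assms] assms unfolding copies_def by auto
  then show ?thesis using tree_prob_copy[of "[0]" "[u, w]"] by (simp add: valid_code_def code_edges_def lessThan_Suc)
qed

lemma avg_card:
  assumes "finite Z"
  shows "avg (\<lambda>\<Gamma>. real (card {z \<in> Z. A z \<subseteq> edges \<Gamma>})) = (\<Sum>z\<in>Z. tree_prob (A z))"
proof -
  have "(\<Sum>\<Gamma>\<in>spanning_trees G. real (card {z \<in> Z. A z \<subseteq> edges \<Gamma>})) =
      (\<Sum>\<Gamma>\<in>spanning_trees G. \<Sum>z\<in>Z. if A z \<subseteq> edges \<Gamma> then 1 else 0)"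
    by (intro sum.cong) (auto simp: assms sum.If_cases Int_def)
  also have "\<dots> = (\<Sum>z\<in>Z. \<Sum>\<Gamma>\<in>spanning_trees G. if A z \<subseteq> edges \<Gamma> then 1 else 0)"
    by (rule sum.swap)
  also have "\<dots> = (\<Sum>z\<in>Z. real (card {\<Gamma> \<in> spanning_trees G. A z \<subseteq> edges \<Gamma>}))"
    by (intro sum.cong) (auto simp: finite_ST sum.If_cases Int_def)
  finally show ?thesis unfolding avg_def tree_prob_def by (simp add: sum_divide_distrib)
qed

lemma avg_mono: "(\<And>\<Gamma>. \<Gamma> \<in> spanning_trees G \<Longrightarrow> f \<Gamma> \<le> g \<Gamma>) \<Longrightarrow> avg f \<le> avg g"
  unfolding avg_def using tau_pos by (intro divide_right_mono sum_mono) auto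

lemma avg_add: "avg (\<lambda>\<Gamma>. f \<Gamma> + g \<Gamma>) = avg f + avg g"
  unfolding avg_def by (simp add: sum.distrib add_divide_distrib)

lemma avg_cmult: "avg (\<lambda>\<Gamma>. a * f \<Gamma>) = a * avg f"
  unfolding avg_def by (simp add: sum_distrib_left)

lemma avg_const: "avg (\<lambda>\<Gamma>. a) = a"
  unfolding avg_def using tau_pos unfolding tau_def by simp

lemma avg_sum: "avg (\<lambda>\<Gamma>. \<Sum>i\<in>I. f i \<Gamma>) = (\<Sum>i\<in>I. avg (f i))"
  unfolding avg_def by (subst sum.swap) (simp add: sum_divide_distrib)

lemma avg_cong: "(\<And>\<Gamma>. \<Gamma> \<in> spanning_trees G \<Longrightarrow> f \<Gamma> = g \<Gamma>) \<Longrightarrow> avg f = avg g"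
  unfolding avg_def by simp

lemma neighbours_eq: "{w \<in> V - {u}. {u, w} \<in> E} = {w \<in> V. {u, w} \<in> E}"
  using edge_props by auto

lemma deg_sum: "(\<Sum>w\<in>V. edge_net G (\<lambda>_. 1) u w) = real (deg u)"
  unfolding edge_net_def degree_of_def adj_def by (simp add: fin sum.If_cases Int_def)

lemma forest_ratio_extension:
  assumes K: "K \<subseteq> V" "u \<in> K" and ne: "K - {u} \<noteq> {}"
  shows "(\<Sum>w | w \<in> V - K \<and> {u, w} \<in> E. forest_ratio (insert w K)) \<le> forest_ratio K * mean_degree u - forest_ratio (K - {u}) / real (deg u)"
proof (cases "deg u = 0")
  case True
  then have "{w \<in> V. {u, w} \<in> E} = {}" unfolding degree_of_def adj_def using fin by simp
  \<comment> \<open>Without neighbours both sums are empty, and division by 0 makes the subtracted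
    term 0.\<close>
  then have "{w. w \<in> V - K \<and> {u, w} \<in> E} = {}" "{w. w \<in> V - {u} \<and> {u, w} \<in> E} = {}" by auto
  then show ?thesis using True unfolding mean_degree_def by (simp only: sum.empty) simp
next
  case False
  have t: "tau > 0" by (rule tau_pos)
  have u: "u \<in> V" using K by blast
  have "(\<Sum>w\<in>V - K. edge_net G (\<lambda>_. 1) u w * unit.F (insert w K)) \<le>
     unit.F K * (\<Sum>w\<in>V - {u}. edge_net G (\<lambda>_. 1) u w * (unit.F {u, w} / unit.F {u})) -
     unit.F (K - {u}) / (\<Sum>w\<in>V. edge_net G (\<lambda>_. 1) u w)"
    by (rule unit.extension_bound[OF K ne]) (use False deg_sum in simp)
  moreover have "(\<Sum>w\<in>V - K. edge_net G (\<lambda>_. 1) u w * unit.F (insert w K)) =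
      tau * (\<Sum>w | w \<in> V - K \<and> {u, w} \<in> E. forest_ratio (insert w K))"
    unfolding sum_distrib_left forest_ratio_def using t fin
    by (intro sum.mono_neutral_cong_right) (auto simp: edge_net_def)
  moreover have "(\<Sum>w\<in>V - {u}. edge_net G (\<lambda>_. 1) u w * (unit.F {u, w} / unit.F {u})) = mean_degree u"
    unfolding mean_degree_def forest_ratio_def unit_F_root[OF u] using fin
    by (intro sum.mono_neutral_cong_right) (auto simp: edge_net_def)
  ultimately have "tau * (\<Sum>w | w \<in> V - K \<and> {u, w} \<in> E. forest_ratio (insert w K)) \<le>
     unit.F K * mean_degree u - unit.F (K - {u}) / real (deg u)"
    unfolding deg_sum by simp
  also have "\<dots> = tau * (forest_ratio K * mean_degree u - forest_ratio (K - {u}) / real (deg u))"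
    unfolding forest_ratio_def using t by (simp add: field_simps)
  finally show ?thesis using t by simp
qed

lemma tree_edges_card:
  assumes "\<Gamma> \<in> spanning_trees G"
  shows "card {(u, w). u \<in> V \<and> w \<in> V \<and> {u, w} \<in> edges \<Gamma>} = 2 * (card V - 1)"
proof -
  obtain x where x: "x \<in> V" using V_nonempty by blast
  obtain f where "f \<in> forests V {x}" "\<Gamma> = tree_of V x f"
    using tree_parent_function[of \<Gamma> x] ST_props[OF assms] fin x by auto
  then show ?thesis using tree_ordered_edges[OF fin x] by simp
qed

lemma sum_tree_prob_pairs: "(\<Sum>(u, w) | u \<in> V \<and> w \<in> V \<and> {u, w} \<in> E. tree_prob {{u, w}}) = 2 * (real (card V) - 1)"
proof -
  let ?Z = "{(u, w). u \<in> V \<and> w \<in> V \<and> {u, w} \<in> E}"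
  have fZ: "finite ?Z" by (rule finite_subset[of _ "V \<times> V"]) (auto simp: fin)
  have "(\<Sum>z\<in>?Z. tree_prob {{fst z, snd z}}) = avg (\<lambda>\<Gamma>. real (card {z \<in> ?Z. {{fst z, snd z}} \<subseteq> edges \<Gamma>}))"
    by (rule avg_card[OF fZ, symmetric])
  also have "\<dots> = avg (\<lambda>\<Gamma>. 2 * (real (card V) - 1))"
  proof (rule avg_cong)
    fix \<Gamma> assume \<Gamma>: "\<Gamma> \<in> spanning_trees G"
    have "{z \<in> ?Z. {{fst z, snd z}} \<subseteq> edges \<Gamma>} = {(u, w). u \<in> V \<and> w \<in> V \<and> {u, w} \<in> edges \<Gamma>}"
      using ST_props(2)[OF \<Gamma>] by auto
    then show "real (card {z \<in> ?Z. {{fst z, snd z}} \<subseteq> edges \<Gamma>}) = 2 * (real (card V) - 1)"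
      using tree_edges_card[OF \<Gamma>] V_nonempty fin card_gt_0_iff[of V] by (simp add: of_nat_diff)
  qed
  finally show ?thesis unfolding avg_const by (simp add: case_prod_beta)
qed

text \<open>Every spanning tree has \<open>card V - 1\<close> edges. This is the only global source
  of upper bounds for expected degrees.\<close>

lemma sum_mean_degree: "(\<Sum>u\<in>V. mean_degree u) = 2 * (real (card V) - 1)"
proof -
  have "(\<Sum>u\<in>V. mean_degree u) = (\<Sum>u\<in>V. \<Sum>w | w \<in> V \<and> {u, w} \<in> E. tree_prob {{u, w}})"
    unfolding mean_degree_def neighbours_eq using tree_prob_edge by (intro sum.cong) auto
  also have "\<dots> = (\<Sum>(u, w)\<in>(SIGMA u:V. {w. w \<in> V \<and> {u, w} \<in> E}). tree_prob {{u, w}})"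
    by (subst sum.Sigma) (auto simp: fin)
  also have "(SIGMA u:V. {w. w \<in> V \<and> {u, w} \<in> E}) = {(u, w). u \<in> V \<and> w \<in> V \<and> {u, w} \<in> E}"
    by auto
  finally show ?thesis using sum_tree_prob_pairs by simp
qed

lemma mean_degree_nonneg: "0 \<le> mean_degree u"
  unfolding mean_degree_def using forest_ratio_nonneg by (simp add: sum_nonneg)

section \<open>Lower bounds for containment probabilities and negative correlation\<close>

lemma unit_energy:
  "unit.energy f f = (\<Sum>x\<in>V. \<Sum>y\<in>V. if {x, y} \<in> E then (f x - f y)\<^sup>2 else 0) / 2"
  unfolding unit.energy_def edge_net_def
  by (intro arg_cong[where f = "\<lambda>x. x / 2"] sum.cong) (auto simp: power2_eq_square)

text \<open>The test potential is 0 on \<open>K\<close>, 1 at \<open>w\<close>, and elsewhere the value that would be optimal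
  if all remaining vertices were shorted together.\<close>

lemma forest_ratio_insert_lower:
  assumes K: "K \<subseteq> V" "K \<noteq> {}" and w: "w \<in> V - K"
    and d: "\<And>x. x \<in> insert w K \<Longrightarrow> real (deg x) \<le> \<Delta>"
  shows "forest_ratio (insert w K) \<ge> forest_ratio K * (real (card K) + 1) / (real (card K) * (\<Delta> + real (card K) + 1))"
proof -
  define i where "i = real (card K)"
  have fK: "finite K" using K fin finite_subset by blast
  have i: "i \<ge> 1" unfolding i_def using K fK by (simp add: Suc_le_eq card_gt_0_iff)
  have D0: "\<Delta> \<ge> 0" using d[of w] by (metis insertI1 of_nat_0_le_iff order_trans)
  \<comment> \<open>With the rest shorted to one vertex joined equally strongly to \<open>w\<close>
    and to the \<open>i\<close> vertices of \<open>K\<close>, the optimal value is the mean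
    \<open>1 / (1 + i)\<close> of the boundary values.\<close>
  define \<psi> where "\<psi> x = (if x = w then 1 else if x \<in> K then 0 else 1 / (1 + i))" for x
  \<comment> \<open>\<open>a\<close> charges the squared difference along an edge to its ends in
    \<open>insert w K\<close>; \<open>b\<close> corrects the edges between \<open>w\<close> and
    \<open>K\<close>, where the difference is 1.\<close>
  define a where "a x = (if x = w then (i / (1 + i))\<^sup>2 else if x \<in> K then (1 / (1 + i))\<^sup>2 else 0)" for x
  define b :: "'a \<Rightarrow> 'a \<Rightarrow> real" where
    "b x y = (if x = w \<and> y \<in> K \<or> y = w \<and> x \<in> K then 1 else 0)" for x y
  have pt: "(\<psi> x - \<psi> y)\<^sup>2 \<le> a x + a y + b x y" for x y
  proof -
    have "1 - 1 / (1 + i) = i / (1 + i)" using i by (simp add: field_simps)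
    then have "(1 - 1 / (1 + i))\<^sup>2 = (i / (1 + i))\<^sup>2" "(1 / (1 + i) - 1)\<^sup>2 = (i / (1 + i))\<^sup>2"
      by (simp_all add: power2_commute)
    then show ?thesis unfolding \<psi>_def a_def b_def using w by auto
  qed
  have sa: "(\<Sum>x\<in>V. \<Sum>y\<in>V. if {x, y} \<in> E then a x else 0) \<le> \<Delta> * (i / (1 + i))"
  proof -
    have "(\<Sum>x\<in>V. \<Sum>y\<in>V. if {x, y} \<in> E then a x else 0) = (\<Sum>x\<in>V. a x * real (deg x))"
      unfolding degree_of_def adj_def by (intro sum.cong) (auto simp: fin sum.If_cases Int_def)
    also have "\<dots> = (\<Sum>x\<in>insert w K. a x * real (deg x))"
      by (rule sum.mono_neutral_right) (use K w fin in \<open>auto simp: a_def\<close>)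
    also have "\<dots> \<le> (\<Sum>x\<in>insert w K. a x * \<Delta>)"
      by (intro sum_mono mult_left_mono d) (auto simp: a_def)
    also have "\<dots> = ((i / (1 + i))\<^sup>2 + (\<Sum>x\<in>K. (1 / (1 + i))\<^sup>2)) * \<Delta>"
    proof -
      have "(\<Sum>x\<in>K. a x) = (\<Sum>x\<in>K. (1 / (1 + i))\<^sup>2)"
        by (intro sum.cong) (use w in \<open>auto simp: a_def\<close>)
      then show ?thesis using w fK by (simp add: sum_distrib_right[symmetric] a_def)
    qed
    also have "(i / (1 + i))\<^sup>2 + (\<Sum>x\<in>K. (1 / (1 + i))\<^sup>2) = i / (1 + i)"
    proof -
      have "(i / (1 + i))\<^sup>2 + i * (1 / (1 + i))\<^sup>2 = (i * (1 + i)) / (1 + i)\<^sup>2"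
        by (simp add: power_divide power2_eq_square add_divide_distrib[symmetric] algebra_simps)
      also have "\<dots> = i / (1 + i)" using i by (simp add: power2_eq_square)
      finally show ?thesis by (simp add: i_def)
    qed
    finally show ?thesis by (simp add: mult.commute)
  qed
  have sa': "(\<Sum>x\<in>V. \<Sum>y\<in>V. if {x, y} \<in> E then a y else 0) \<le> \<Delta> * (i / (1 + i))"
    using sa by (subst sum.swap) (simp add: insert_commute)
  have sb: "(\<Sum>x\<in>V. \<Sum>y\<in>V. if {x, y} \<in> E then b x y else 0) \<le> 2 * i"
  proof -
    have "(\<Sum>x\<in>V. \<Sum>y\<in>V. if {x, y} \<in> E then b x y else 0) \<le> (\<Sum>x\<in>V. \<Sum>y\<in>V. b x y)"
      by (intro sum_mono) (auto simp: b_def)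
    also have "\<dots> = (\<Sum>z\<in>V \<times> V. b (fst z) (snd z))"
      by (simp add: sum.cartesian_product case_prod_beta)
    also have "\<dots> = (\<Sum>z\<in>{w} \<times> K \<union> K \<times> {w}. 1)"
      by (rule sum.mono_neutral_cong_right) (use fin K w in \<open>auto simp: b_def\<close>)
    also have "\<dots> = real (card ({w} \<times> K) + card (K \<times> {w}))"
      by (subst card_Un_disjoint[symmetric]) (use fK w in auto)
    also have "\<dots> = 2 * i" unfolding i_def by (simp add: card_cartesian_product)
    finally show ?thesis .
  qed
  have "2 * unit.energy \<psi> \<psi> \<le> (\<Sum>x\<in>V. \<Sum>y\<in>V.
      (if {x, y} \<in> E then a x else 0) + (if {x, y} \<in> E then a y else 0) + (if {x, y} \<in> E then b x y else 0))"
    unfolding unit_energy using pt by (simp add: sum_mono)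
  also have "\<dots> \<le> 2 * (\<Delta> * (i / (1 + i)) + i)"
    using sa sa' sb by (simp add: sum.distrib)
  also have "\<Delta> * (i / (1 + i)) + i = i * (\<Delta> + i + 1) / (i + 1)"
    using i by (simp add: field_simps)
  finally have en: "unit.energy \<psi> \<psi> \<le> i * (\<Delta> + i + 1) / (i + 1)" by simp
  have "unit.F K * (\<psi> w)\<^sup>2 \<le> unit.F (insert w K) * unit.energy \<psi> \<psi>"
    by (rule unit.dirichlet_principle) (use unit.F_pos[OF K] w in \<open>auto simp: \<psi>_def\<close>)
  then have "unit.F K \<le> unit.F (insert w K) * unit.energy \<psi> \<psi>" by (simp add: \<psi>_def)
  also have "\<dots> \<le> unit.F (insert w K) * (i * (\<Delta> + i + 1) / (i + 1))"
    by (intro mult_left_mono en unit.F_nonneg)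
  finally have Fle: "unit.F K \<le> unit.F (insert w K) * (i * (\<Delta> + i + 1) / (i + 1))" .
  have "forest_ratio K \<le> forest_ratio (insert w K) * (i * (\<Delta> + i + 1) / (i + 1))"
    unfolding forest_ratio_def times_divide_eq_left
    by (rule divide_right_mono[OF Fle[unfolded times_divide_eq_left]]) (use tau_pos in simp)
  moreover have "i * (\<Delta> + i + 1) > 0" using i D0 by (intro mult_pos_pos) auto
  ultimately show ?thesis unfolding i_def[symmetric] using i by (simp add: pos_divide_le_eq field_simps)
qed

text \<open>Adding a vertex to a set of size \<open>i\<close> multiplies the ratio by at least
  \<open>(i + 1) / (i * M)\<close>, and these factors telescope. \<open>K\<close> may be any
  nonempty set of vertices with bounded degrees, not only the vertex set of a subtree.\<close>

lemma forest_ratio_lower: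
  assumes K: "K \<subseteq> V" "K \<noteq> {}" and d: "\<And>x. x \<in> K \<Longrightarrow> real (deg x) \<le> \<Delta>"
    and M: "\<Delta> + real (card K) \<le> M"
  shows "forest_ratio K \<ge> real (card K) / M ^ (card K - 1)"
proof -
  have "finite K" using K fin finite_subset by blast
  from this K(2,1) d M show ?thesis
  proof (induction rule: finite_ne_induct)
    case (singleton x)
    then show ?case using forest_ratio_single by simp
  next
    case (insert w K)
    define i where "i = card K"
    have fi: "i \<ge> 1" unfolding i_def using insert.hyps by (simp add: Suc_le_eq card_gt_0_iff)
    have ci: "card (insert w K) = Suc i" unfolding i_def using insert.hyps by simp
    have D0: "\<Delta> \<ge> 0" using insert.prems(2)[of w] by (metis insertI1 of_nat_0_le_iff order_trans)
    have M: "\<Delta> + real i + 1 \<le> M" using insert.prems(3) ci by simp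
    have IH: "forest_ratio K \<ge> real i / M ^ (i - 1)"
      unfolding i_def by (rule insert.IH) (use insert.prems M i_def in auto)
    have "real (card (insert w K)) / M ^ (card (insert w K) - 1) = (real i + 1) / (M ^ (i - 1) * M)"
      unfolding ci using fi by (cases i) auto
    also have "\<dots> = (real i / M ^ (i - 1)) * (real i + 1) / (real i * M)"
      using fi by simp
    also have "\<dots> \<le> forest_ratio K * (real i + 1) / (real i * (\<Delta> + real i + 1))"
      by (intro frac_le mult_mono mult_left_mono IH M) (use fi D0 forest_ratio_nonneg in \<open>auto intro!: mult_pos_pos\<close>)
    also have "\<dots> \<le> forest_ratio (insert w K)"
      unfolding i_def by (rule forest_ratio_insert_lower) (use insert in auto)
    finally show ?case .
  qed
qed

text \<open>Giving the edges of \<open>A\<close> a large weight \<open>l\<close> makes the weighted tree measure approach the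
  measure conditioned on containing \<open>A\<close>; Rayleigh monotonicity compares it with \<open>l = 1\<close>.\<close>

lemma negative_correlation:
  assumes v: "valid_code ps" and xs: "xs \<in> copies V E ps" and disj: "A \<inter> code_edges ps xs = {}"
  shows "tree_prob (A \<union> code_edges ps xs) \<le> tree_prob A * tree_prob (code_edges ps xs)"
proof (cases "A \<subseteq> E")
  case False
  then have "{\<Gamma> \<in> spanning_trees G. A \<union> code_edges ps xs \<subseteq> edges \<Gamma>} = {}"
    using ST_props(2) by blast
  then have "tree_prob (A \<union> code_edges ps xs) = 0" unfolding tree_prob_def by (simp only: card.empty of_nat_0 div_0)
  then show ?thesis using tree_prob_nonneg by simp
next
  case True
  let ?t = "code_edges ps xs" and ?x = "xs ! 0"
  let ?N = "\<lambda>B. real (card {\<Gamma> \<in> spanning_trees G. B \<subseteq> edges \<Gamma>})"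
  have "E \<subseteq> Pow V" using simple unfolding simple_graph_def by auto
  then have fE: "finite E" using fin finite_subset by blast
  then have fA: "finite A" using True finite_subset by blast
  have fG: "finite (edges \<Gamma>)" if "\<Gamma> \<in> spanning_trees G" for \<Gamma>
    using ST_props(2)[OF that] fE finite_subset by blast
  have x: "?x \<in> set xs" using xs unfolding copies_def by simp
  have sub: "set xs \<subseteq> V" using copies_subset[OF xs] .
  define m where "m = card A"
  have key: "tau * ?N (A \<union> ?t) \<le> ?N ?t * (?N A + tau / l)" if l: "l \<ge> 1" for l :: real
  proof -
    define W where "W e = (if e \<in> A then l else 1)" for e
    have W0: "\<And>e. 0 < W e" "\<And>e. 0 \<le> W e" and W1: "\<And>e. 1 \<le> W e" unfolding W_def using l by auto
    have pw: "(\<Prod>e\<in>edges \<Gamma>. W e) = l ^ card (edges \<Gamma> \<inter> A)" if "\<Gamma> \<in> spanning_trees G" for \<Gamma>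
      unfolding W_def using fG[OF that] by (simp add: prod.If_cases)
    interpret w: connected_network V "edge_net G W" by (rule connected_network_edge_net[OF W0(1)])
    have "unit.F {?x} * w.F (set xs) \<le> unit.F (set xs) * w.F {?x}"
      by (rule rayleigh_monotonicity[OF unit.connected_network_axioms w.connected_network_axioms _ sub x])
        (simp add: edge_net_def W1)
    moreover have "unit.F {?x} = tau" using unit_F_root x sub by blast
    moreover have "unit.F (set xs) = ?N ?t" using F_copy[of "\<lambda>_. 1", OF _ v xs] by simp
    \<comment> \<open>Disjointness from \<open>A\<close> leaves the edges of the copy with weight 1,
      so the product in front of \<open>F (set xs)\<close> disappears.\<close>
    moreover have "w.F (set xs) = (\<Sum>\<Gamma> | \<Gamma> \<in> spanning_trees G \<and> ?t \<subseteq> edges \<Gamma>. l ^ card (edges \<Gamma> \<inter> A))"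
    proof -
      have "(\<Prod>i<length ps. W {xs ! (ps ! i), xs ! Suc i}) = 1"
        by (rule prod.neutral) (use disj in \<open>auto simp: W_def code_edges_def\<close>)
      then have "w.F (set xs) = (\<Sum>\<Gamma> | \<Gamma> \<in> spanning_trees G \<and> ?t \<subseteq> edges \<Gamma>. \<Prod>e\<in>edges \<Gamma>. W e)"
        using F_copy[of W, OF W0(2) v xs] by simp
      also have "\<dots> = (\<Sum>\<Gamma> | \<Gamma> \<in> spanning_trees G \<and> ?t \<subseteq> edges \<Gamma>. l ^ card (edges \<Gamma> \<inter> A))"
        by (intro sum.cong) (auto simp: pw)
      finally show ?thesis .
    qed
    moreover have "w.F {?x} = (\<Sum>\<Gamma>\<in>spanning_trees G. l ^ card (edges \<Gamma> \<inter> A))"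
      using F_root[of W ?x] W0(2) x sub pw by (auto intro: sum.cong)
    ultimately have 1: "tau * (\<Sum>\<Gamma> | \<Gamma> \<in> spanning_trees G \<and> ?t \<subseteq> edges \<Gamma>. l ^ card (edges \<Gamma> \<inter> A)) \<le>
      ?N ?t * (\<Sum>\<Gamma>\<in>spanning_trees G. l ^ card (edges \<Gamma> \<inter> A))" by simp
    have "l ^ m * ?N (A \<union> ?t) = (\<Sum>\<Gamma> | \<Gamma> \<in> spanning_trees G \<and> A \<union> ?t \<subseteq> edges \<Gamma>. l ^ card (edges \<Gamma> \<inter> A))"
      by (subst sum.cong[OF refl, where h = "\<lambda>_. l ^ m"]) (auto simp: m_def Int_absorb1)
    also have "\<dots> \<le> (\<Sum>\<Gamma> | \<Gamma> \<in> spanning_trees G \<and> ?t \<subseteq> edges \<Gamma>. l ^ card (edges \<Gamma> \<inter> A))"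
      by (rule sum_mono2) (use finite_ST l in auto)
    finally have 2: "l ^ m * ?N (A \<union> ?t) \<le> \<dots>" .
    \<comment> \<open>A tree that misses an edge of \<open>A\<close> has weight at most
      \<open>l ^ (m - 1)\<close>, a fraction \<open>1 / l\<close> of the weight of a tree containing
      \<open>A\<close>.\<close>
    have "(\<Sum>\<Gamma>\<in>spanning_trees G. l ^ card (edges \<Gamma> \<inter> A)) \<le>
      (\<Sum>\<Gamma>\<in>spanning_trees G. l ^ m * ((if A \<subseteq> edges \<Gamma> then 1 else 0) + 1 / l))"
    proof (rule sum_mono)
      fix \<Gamma> assume \<Gamma>: "\<Gamma> \<in> spanning_trees G"
      show "l ^ card (edges \<Gamma> \<inter> A) \<le> l ^ m * ((if A \<subseteq> edges \<Gamma> then 1 else 0) + 1 / l)"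
      proof (cases "A \<subseteq> edges \<Gamma>")
        case True
        then show ?thesis using l by (simp add: m_def Int_absorb1 distrib_left)
      next
        case False
        then have "card (edges \<Gamma> \<inter> A) < m" unfolding m_def using fA by (intro psubset_card_mono) auto
        then obtain j where j: "m = Suc j" "card (edges \<Gamma> \<inter> A) \<le> j" by (cases m) auto
        have "l ^ card (edges \<Gamma> \<inter> A) \<le> l ^ j" using j l by (intro power_increasing) auto
        then show ?thesis using False j l by simp
      qed
    qed
    also have "\<dots> = l ^ m * (?N A + tau / l)"
      unfolding sum_distrib_left[symmetric] sum.distrib tau_def
      by (simp add: finite_ST sum.If_cases Int_def)
    finally have 3: "(\<Sum>\<Gamma>\<in>spanning_trees G. l ^ card (edges \<Gamma> \<inter> A)) \<le> l ^ m * (?N A + tau / l)" .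
    have "l ^ m * (tau * ?N (A \<union> ?t)) \<le> l ^ m * (?N ?t * (?N A + tau / l))"
    proof -
      have "l ^ m * (tau * ?N (A \<union> ?t)) = tau * (l ^ m * ?N (A \<union> ?t))" by (simp add: mult_ac)
      also have "\<dots> \<le> tau * (\<Sum>\<Gamma> | \<Gamma> \<in> spanning_trees G \<and> ?t \<subseteq> edges \<Gamma>. l ^ card (edges \<Gamma> \<inter> A))"
        using 2 tau_pos by (intro mult_left_mono) auto
      also have "\<dots> \<le> ?N ?t * (\<Sum>\<Gamma>\<in>spanning_trees G. l ^ card (edges \<Gamma> \<inter> A))" by (rule 1)
      also have "\<dots> \<le> ?N ?t * (l ^ m * (?N A + tau / l))" using 3 by (intro mult_left_mono) auto
      finally show ?thesis by (simp add: mult_ac)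
    qed
    then show ?thesis using l by (simp del: mult_le_cancel_left add: mult_le_cancel_left_pos)
  qed
  have "((\<lambda>l. ?N ?t * (?N A + tau / l)) \<longlongrightarrow> ?N ?t * (?N A + 0)) at_top"
    by (intro tendsto_intros tendsto_divide_0[OF tendsto_const] filterlim_at_top_imp_at_infinity filterlim_ident)
  moreover have "\<forall>\<^sub>F l in at_top. tau * ?N (A \<union> ?t) \<le> ?N ?t * (?N A + tau / l)"
    using eventually_ge_at_top[of 1] by eventually_elim (rule key)
  ultimately have "tau * ?N (A \<union> ?t) \<le> ?N ?t * (?N A + 0)"
    by (intro tendsto_lowerbound[of _ _ "at_top :: real filter"]) auto
  then show ?thesis unfolding tree_prob_def using tau_pos by (simp add: field_simps)
qed

end

section \<open>Copies inside a good vertex set\<close>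

text \<open>Copies whose vertices may coincide. Overlapping pairs of copies are bounded by pairs of
  these, since leaves can then be peeled off without keeping track of distinctness.\<close>

definition homs :: "'a set \<Rightarrow> 'a set set \<Rightarrow> nat list \<Rightarrow> 'a list set" where
  "homs U E ps = {xs. length xs = Suc (length ps) \<and> set xs \<subseteq> U \<and>
     (\<forall>i<length ps. {xs ! (ps ! i), xs ! Suc i} \<in> E)}"

lemma homs_Nil: "homs U E [] = (\<lambda>x. [x]) ` U"
  unfolding homs_def by (auto simp: length_Suc_conv)

lemma finite_homs: "finite U \<Longrightarrow> finite (homs U E ps)"
  by (rule finite_subset[OF _ finite_lists_length_eq[of U "Suc (length ps)"]]) (auto simp: homs_def)

lemma copies_subset_homs: "copies U E ps \<subseteq> homs U E ps"
  unfolding copies_def homs_def by blast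

lemma homs_snoc_iff:
  assumes "valid_code ps" "p \<le> length ps"
  shows "xs @ [w] \<in> homs U E (ps @ [p]) \<longleftrightarrow> xs \<in> homs U E ps \<and> w \<in> U \<and> {xs ! p, w} \<in> E"
proof (cases "length xs = Suc (length ps)")
  case True
  let ?h = "\<lambda>i. {(xs @ [w]) ! ((ps @ [p]) ! i), (xs @ [w]) ! Suc i} \<in> E"
  have "?h i \<longleftrightarrow> {xs ! (ps ! i), xs ! Suc i} \<in> E" if "i < length ps" for i
    using nth_snoc_code[OF assms(1) True that] by simp
  then have "(\<forall>i<length ps. ?h i) \<longleftrightarrow> (\<forall>i<length ps. {xs ! (ps ! i), xs ! Suc i} \<in> E)" by blast
  moreover have "?h (length ps) \<longleftrightarrow> {xs ! p, w} \<in> E" using assms True by (simp add: nth_append)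
  moreover have "(\<forall>i<length (ps @ [p]). ?h i) \<longleftrightarrow> (\<forall>i<length ps. ?h i) \<and> ?h (length ps)"
    unfolding length_append_singleton less_Suc_eq by blast
  ultimately show ?thesis
    using True unfolding homs_def mem_Collect_eq by auto
qed (auto simp: homs_def)

lemma homs_length: "xs \<in> homs U E ps \<Longrightarrow> length xs = Suc (length ps)"
  unfolding homs_def by blast

lemma homs_nth: "xs \<in> homs U E ps \<Longrightarrow> p \<le> length ps \<Longrightarrow> xs ! p \<in> U"
  unfolding homs_def by (auto simp: subset_iff)

lemma homs_snocE:
  assumes "valid_code ps" "p \<le> length ps" "ys \<in> homs U E (ps @ [p])"
  obtains xs w where "ys = xs @ [w]" "xs \<in> homs U E ps" "w \<in> U" "{xs ! p, w} \<in> E"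
proof -
  have "ys \<noteq> []" using homs_length[OF assms(3)] by auto
  then obtain xs w where y: "ys = xs @ [w]" by (metis append_butlast_last_id)
  then have "xs \<in> homs U E ps \<and> w \<in> U \<and> {xs ! p, w} \<in> E"
    using assms(3) unfolding y homs_snoc_iff[OF assms(1,2)] by simp
  then show ?thesis using that y by simp
qed

lemma card_code_edges: "card (code_edges ps xs) \<le> length ps"
  unfolding code_edges_def using card_image_le[of "{..<length ps}"] by simp

lemma finite_code_edges [simp]: "finite (code_edges ps xs)"
  unfolding code_edges_def by simp

lemma copies_iff_code_edges:
  assumes "E' \<subseteq> E"
  shows "copies U E' ps = {xs \<in> copies U E ps. code_edges ps xs \<subseteq> E'}"
  using copies_mono[OF order_refl assms] copies_code_edges copies_restrict by blast

text \<open>\<open>\<Delta>\<close> is a common degree bound, \<open>\<eta>\<close> the slack in the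
  expected degrees, and \<open>\<theta>\<close> the relative loss of degree sum when both ends of an
  edge must lie in \<open>U\<close>. In the limit \<open>\<Delta>\<close> grows and the other two
  vanish.\<close>

locale good_set = finite_connected_graph +
  fixes U :: "'a set" and \<Delta> \<eta> \<theta> :: real
  assumes U: "U \<subseteq> verts G"
    and deg_le: "u \<in> U \<Longrightarrow> real (degree_of G u) \<le> \<Delta>"
    and mean_degree_le: "u \<in> U \<Longrightarrow> finite_connected_graph.mean_degree G u \<le> 2 + \<eta>"
    and \<Delta>_pos: "0 < \<Delta>"
    and \<eta>_le: "\<eta> \<le> 1"
    and many_edges: "(1 - \<theta>) * \<Delta> * real (card (verts G)) \<le>
      (\<Sum>u\<in>U. real (card {w \<in> U. {u, w} \<in> edges G}))"
begin

definition degU :: "'a \<Rightarrow> nat" where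
  "degU u = card {w \<in> U. {u, w} \<in> E}"

abbreviation N :: real where
  "N \<equiv> real (card V)"

definition copy_count :: "nat list \<Rightarrow> real" where
  "copy_count ps = real (card (copies U E ps))"

text \<open>The expected number of copies of \<open>ps\<close> in the part of the spanning tree inside \<open>U\<close>, and the expected
  number of such copies extended by a leaf at \<open>p\<close> that may leave \<open>U\<close>.\<close>

definition mean_copies :: "nat list \<Rightarrow> real" where
  "mean_copies ps = (\<Sum>xs\<in>copies U E ps. forest_ratio (set xs))"

definition mean_extensions :: "nat list \<Rightarrow> nat \<Rightarrow> real" where
  "mean_extensions ps p = (\<Sum>xs\<in>copies U E ps. \<Sum>w | w \<in> V - set xs \<and> {xs ! p, w} \<in> E. forest_ratio (insert w (set xs)))"

lemma finU: "finite U"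
  using U fin finite_subset by blast

lemma card_U: "real (card U) \<le> N"
  using U fin card_mono by auto

lemma N_pos: "N > 0"
  using V_nonempty fin by (simp add: card_gt_0_iff)

lemma degU_le: "u \<in> U \<Longrightarrow> real (degU u) \<le> \<Delta>"
proof -
  assume u: "u \<in> U"
  have "degU u \<le> deg u"
    unfolding degU_def degree_of_def adj_def using U fin by (intro card_mono) auto
  then show ?thesis using deg_le[OF u] by linarith
qed

text \<open>The last leaf is removed. If it does not carry the weight, it has at most
  \<open>\<Delta>\<close> positions; if it does, the weight is moved to its neighbours, which
  multiplies the total by at most \<open>\<Delta>\<close>. So an error that is small in sum over
  \<open>U\<close> stays small in sum over copies.\<close>

lemma sum_copies_weight:
  assumes "valid_code ps" "p \<le> length ps" "\<And>u. 0 \<le> g u"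
  shows "(\<Sum>xs\<in>copies U E ps. g (xs ! p)) \<le> \<Delta> ^ length ps * (\<Sum>u\<in>U. g u)"
  using assms
proof (induction ps arbitrary: p g rule: rev_induct)
  case Nil
  then show ?case by (simp add: copies_Nil sum.reindex inj_on_def)
next
  case (snoc p' ps)
  then have v: "valid_code ps" "p' \<le> length ps" by auto
  have g: "\<And>u. 0 \<le> g u" by fact
  have nthU: "xs ! i \<in> U" if "xs \<in> copies U E ps" "i \<le> length ps" for xs i
    using that unfolding copies_def by (auto simp: subset_iff)
  show ?case
  proof (cases "p = Suc (length ps)")
    case True
    define g' where "g' u = (\<Sum>w | w \<in> U \<and> {u, w} \<in> E. g w)" for u
    have g'0: "0 \<le> g' u" for u unfolding g'_def using g by (simp add: sum_nonneg)
    have "(\<Sum>xs\<in>copies U E (ps @ [p']). g (xs ! p)) =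
        (\<Sum>xs\<in>copies U E ps. \<Sum>w | w \<in> U - set xs \<and> {xs ! p', w} \<in> E. g w)"
      unfolding sum_copies_snoc[OF v finU] using True
      by (intro sum.cong) (auto simp: nth_append dest: copies_length)
    also have "\<dots> \<le> (\<Sum>xs\<in>copies U E ps. g' (xs ! p'))"
      unfolding g'_def by (intro sum_mono sum_mono2) (auto simp: finU g)
    also have "\<dots> \<le> \<Delta> ^ length ps * (\<Sum>u\<in>U. g' u)" using snoc.IH[OF v, of g'] g'0 by blast
    also have "(\<Sum>u\<in>U. g' u) = (\<Sum>u\<in>U. \<Sum>w\<in>U. if {u, w} \<in> E then g w else 0)"
      unfolding g'_def by (simp add: sum.inter_filter finU)
    also have "\<dots> = (\<Sum>w\<in>U. g w * real (degU w))"
      unfolding degU_def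
      by (subst sum.swap, intro sum.cong refl)
        (simp add: sum.inter_filter[symmetric] finU insert_commute mult.commute)
    also have "\<Delta> ^ length ps * \<dots> \<le> \<Delta> ^ length ps * (\<Sum>w\<in>U. g w * \<Delta>)"
      using \<Delta>_pos by (intro mult_left_mono sum_mono degU_le) (auto simp: g)
    also have "\<dots> = \<Delta> ^ length (ps @ [p']) * (\<Sum>w\<in>U. g w)"
      by (simp add: sum_distrib_left sum_distrib_right mult_ac)
    finally show ?thesis .
  next
    case False
    then have p: "p \<le> length ps" using snoc.prems by simp
    have "(\<Sum>xs\<in>copies U E (ps @ [p']). g (xs ! p)) =
        (\<Sum>xs\<in>copies U E ps. \<Sum>w | w \<in> U - set xs \<and> {xs ! p', w} \<in> E. g (xs ! p))"
      unfolding sum_copies_snoc[OF v finU] using p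
      by (intro sum.cong) (auto simp: nth_append dest: copies_length)
    also have "\<dots> = (\<Sum>xs\<in>copies U E ps. real (card {w. w \<in> U - set xs \<and> {xs ! p', w} \<in> E}) * g (xs ! p))"
      by simp
    also have "\<dots> \<le> (\<Sum>xs\<in>copies U E ps. \<Delta> * g (xs ! p))"
    proof (intro sum_mono mult_right_mono)
      fix xs assume xs: "xs \<in> copies U E ps"
      have "card {w. w \<in> U - set xs \<and> {xs ! p', w} \<in> E} \<le> degU (xs ! p')"
        unfolding degU_def using finU by (intro card_mono) auto
      then show "real (card {w. w \<in> U - set xs \<and> {xs ! p', w} \<in> E}) \<le> \<Delta>"
        using degU_le[OF nthU[OF xs v(2)]] by linarith
    qed (rule g)
    also have "\<dots> \<le> \<Delta> * (\<Delta> ^ length ps * (\<Sum>u\<in>U. g u))"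
      unfolding sum_distrib_left[symmetric]
      by (rule mult_left_mono[OF snoc.IH[OF v(1) p g]]) (use \<Delta>_pos in simp)
    finally show ?thesis by (simp add: mult_ac)
  qed
qed

lemma copy_count_upper:
  assumes "valid_code ps"
  shows "copy_count ps \<le> N * \<Delta> ^ length ps"
proof -
  have "copy_count ps = (\<Sum>xs\<in>copies U E ps. (\<lambda>_. 1) (xs ! 0))" unfolding copy_count_def by simp
  also have "\<dots> \<le> \<Delta> ^ length ps * (\<Sum>u\<in>U. 1)" by (rule sum_copies_weight) (use assms in auto)
  also have "\<dots> \<le> \<Delta> ^ length ps * N" using card_U \<Delta>_pos by (intro mult_left_mono) auto
  finally show ?thesis by (simp add: mult.commute)
qed

lemma deficit: "(\<Sum>u\<in>U. \<Delta> - real (degU u)) \<le> \<theta> * \<Delta> * N"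
proof -
  have "(\<Sum>u\<in>U. \<Delta> - real (degU u)) = real (card U) * \<Delta> - (\<Sum>u\<in>U. real (degU u))"
    by (simp add: sum_subtractf)
  also have "\<dots> \<le> N * \<Delta> - (1 - \<theta>) * \<Delta> * N"
    using many_edges card_U \<Delta>_pos unfolding degU_def by (intro diff_mono mult_right_mono) auto
  finally show ?thesis by (simp add: algebra_simps)
qed

text \<open>A copy with \<open>k\<close> vertices can be extended at \<open>u\<close> in at least
  \<open>degU u - k\<close> ways. The shortfall of \<open>degU u\<close> from
  \<open>\<Delta>\<close> is small in total by \<open>deficit\<close>, and
  \<open>sum_copies_weight\<close> transfers this to the copies.\<close>

lemma copy_count_lower:
  assumes "valid_code ps"
  shows "copy_count ps \<ge> N * \<Delta> ^ length ps * (1 - real (Suc (length ps)) * \<theta> - (real (Suc (length ps)))\<^sup>2 / \<Delta>)"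
  using assms
proof (induction ps rule: rev_induct)
  case Nil
  have "(1 - \<theta>) * \<Delta> * N \<le> (\<Sum>u\<in>U. real (degU u))" using many_edges unfolding degU_def .
  also have "\<dots> \<le> (\<Sum>u\<in>U. \<Delta>)" by (intro sum_mono degU_le)
  finally have "\<Delta> * ((1 - \<theta>) * N) \<le> \<Delta> * real (card U)" by (simp add: mult_ac)
  then have 1: "(1 - \<theta>) * N \<le> real (card U)" using \<Delta>_pos by simp
  have "card (copies U E []) = card U" unfolding copies_Nil by (rule card_image) (auto simp: inj_on_def)
  then have "(1 - \<theta>) * N \<le> copy_count []" unfolding copy_count_def using 1 by simp
  moreover have "N * (1 / \<Delta>) \<ge> 0" using N_pos \<Delta>_pos by simp
  ultimately show ?case by (simp add: algebra_simps)
next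
  case (snoc p ps)
  then have v: "valid_code ps" "p \<le> length ps" by auto
  define l where "l = length ps"
  define k where "k = real (Suc l)"
  have k0: "k > 0" unfolding k_def by simp
  have nthU: "xs ! i \<in> U" if "xs \<in> copies U E ps" "i \<le> length ps" for xs i
    using that unfolding copies_def by (auto simp: subset_iff)
  have "copy_count (ps @ [p]) = (\<Sum>xs\<in>copies U E ps. real (card {w. w \<in> U - set xs \<and> {xs ! p, w} \<in> E}))"
    unfolding copy_count_def using sum_copies_snoc[OF v finU, of "\<lambda>_. 1::real"] by simp
  also have "\<dots> \<ge> (\<Sum>xs\<in>copies U E ps. \<Delta> - (\<Delta> - real (degU (xs ! p))) - k)"
  proof (rule sum_mono)
    fix xs assume xs: "xs \<in> copies U E ps"
    have "degU (xs ! p) \<le> card ({w. w \<in> U - set xs \<and> {xs ! p, w} \<in> E} \<union> set xs)"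
      unfolding degU_def using finU by (intro card_mono) auto
    also have "\<dots> \<le> card {w. w \<in> U - set xs \<and> {xs ! p, w} \<in> E} + card (set xs)" by (rule card_Un_le)
    finally show "\<Delta> - (\<Delta> - real (degU (xs ! p))) - k \<le> real (card {w. w \<in> U - set xs \<and> {xs ! p, w} \<in> E})"
      using copies_card[OF xs] unfolding k_def l_def by linarith
  qed
  also have "(\<Sum>xs\<in>copies U E ps. \<Delta> - (\<Delta> - real (degU (xs ! p))) - k) =
      (\<Delta> - k) * copy_count ps - (\<Sum>xs\<in>copies U E ps. \<bar>\<Delta> - real (degU (xs ! p))\<bar>)"
  proof -
    have "(\<Sum>xs\<in>copies U E ps. \<Delta> - (\<Delta> - real (degU (xs ! p))) - k) =
      (\<Sum>xs\<in>copies U E ps. (\<Delta> - k) - \<bar>\<Delta> - real (degU (xs ! p))\<bar>)"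
      using degU_le nthU[OF _ v(2)] by (intro sum.cong) fastforce+
    then show ?thesis unfolding copy_count_def by (simp add: sum_subtractf)
  qed
  finally have 1: "copy_count (ps @ [p]) \<ge> (\<Delta> - k) * copy_count ps - (\<Sum>xs\<in>copies U E ps. \<bar>\<Delta> - real (degU (xs ! p))\<bar>)" .
  have "(\<Sum>xs\<in>copies U E ps. \<bar>\<Delta> - real (degU (xs ! p))\<bar>) \<le> \<Delta> ^ l * (\<Sum>u\<in>U. \<bar>\<Delta> - real (degU u)\<bar>)"
    unfolding l_def by (rule sum_copies_weight) (use v in auto)
  also have "(\<Sum>u\<in>U. \<bar>\<Delta> - real (degU u)\<bar>) = (\<Sum>u\<in>U. \<Delta> - real (degU u))"
    using degU_le by (intro sum.cong) auto
  also have "\<Delta> ^ l * \<dots> \<le> \<Delta> ^ l * (\<theta> * \<Delta> * N)"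
    using deficit \<Delta>_pos by (intro mult_left_mono) auto
  finally have 2: "(\<Sum>xs\<in>copies U E ps. \<bar>\<Delta> - real (degU (xs ! p))\<bar>) \<le> \<Delta> ^ l * (\<theta> * \<Delta> * N)" .
  have 3: "k * copy_count ps \<le> k * (N * \<Delta> ^ l)" using copy_count_upper[OF v(1)] k0 unfolding l_def by simp
  have 4: "\<Delta> * copy_count ps \<ge> \<Delta> * (N * \<Delta> ^ l * (1 - k * \<theta> - k\<^sup>2 / \<Delta>))"
    using snoc.IH[OF v(1)] \<Delta>_pos unfolding l_def k_def by simp
  have "copy_count (ps @ [p]) \<ge> \<Delta> * (N * \<Delta> ^ l * (1 - k * \<theta> - k\<^sup>2 / \<Delta>)) - k * (N * \<Delta> ^ l) - \<Delta> ^ l * (\<theta> * \<Delta> * N)"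
    using 1 2 3 4 by (simp add: left_diff_distrib)
  also have "\<Delta> * (N * \<Delta> ^ l * (1 - k * \<theta> - k\<^sup>2 / \<Delta>)) - k * (N * \<Delta> ^ l) - \<Delta> ^ l * (\<theta> * \<Delta> * N) =
      N * \<Delta> ^ Suc l * (1 - (k + 1) * \<theta> - (k\<^sup>2 + k) / \<Delta>)"
    using \<Delta>_pos by (simp add: field_simps)
  finally have "N * \<Delta> ^ Suc l * (1 - (k + 1) * \<theta> - (k\<^sup>2 + k) / \<Delta>) \<le> copy_count (ps @ [p])" .
  moreover have "N * \<Delta> ^ Suc l * (1 - (k + 1) * \<theta> - (k + 1)\<^sup>2 / \<Delta>) \<le>
      N * \<Delta> ^ Suc l * (1 - (k + 1) * \<theta> - (k\<^sup>2 + k) / \<Delta>)"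
    using N_pos \<Delta>_pos k0
    by (intro mult_left_mono diff_left_mono divide_right_mono) (auto simp: power2_eq_square algebra_simps)
  ultimately show ?case unfolding l_def k_def by (simp add: add.commute)
qed

lemma mean_copies_lower:
  assumes M: "\<Delta> + real (Suc (length ps)) \<le> M"
  shows "mean_copies ps \<ge> real (Suc (length ps)) * copy_count ps / M ^ length ps"
proof -
  have "real (Suc (length ps)) * copy_count ps / M ^ length ps =
      (\<Sum>xs\<in>copies U E ps. real (Suc (length ps)) / M ^ length ps)"
    unfolding copy_count_def by simp
  also have "\<dots> \<le> mean_copies ps"
    unfolding mean_copies_def
  proof (rule sum_mono)
    fix xs assume xs: "xs \<in> copies U E ps"
    have "real (card (set xs)) / M ^ (card (set xs) - 1) \<le> forest_ratio (set xs)"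
      by (rule forest_ratio_lower[where \<Delta> = \<Delta>])
        (use xs copies_subset[OF xs] U copies_card[OF xs] copies_length[OF xs] deg_le M in auto)
    then show "real (Suc (length ps)) / M ^ length ps \<le> forest_ratio (set xs)" using copies_card[OF xs] by simp
  qed
  finally show ?thesis .
qed

lemma mean_copies_snoc_le:
  assumes "valid_code ps" "p \<le> length ps"
  shows "mean_copies (ps @ [p]) \<le> mean_extensions ps p"
proof -
  have "mean_copies (ps @ [p]) = (\<Sum>xs\<in>copies U E ps. \<Sum>w | w \<in> U - set xs \<and> {xs ! p, w} \<in> E. forest_ratio (insert w (set xs)))"
    unfolding mean_copies_def sum_copies_snoc[OF assms finU] by simp
  also have "\<dots> \<le> mean_extensions ps p"
    unfolding mean_extensions_def using U fin by (intro sum_mono sum_mono2) (auto simp: forest_ratio_nonneg)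
  finally show ?thesis .
qed

lemma copies_degree_pos:
  assumes v: "valid_code ps" and xs: "xs \<in> copies V E ps" and p: "p \<le> length ps" and ne: "ps \<noteq> []"
  shows "deg (xs ! p) > 0"
proof -
  have "\<exists>w. {xs ! p, w} \<in> E"
  proof (cases p)
    case 0
    have "ps ! 0 \<le> 0" "0 < length ps" using v ne unfolding valid_code_def by auto
    then show ?thesis using xs 0 unfolding copies_def by force
  next
    case (Suc i)
    then have "{xs ! (ps ! i), xs ! Suc i} \<in> E" using xs p unfolding copies_def by auto
    then show ?thesis using Suc by (metis insert_commute)
  qed
  then obtain w where "{xs ! p, w} \<in> E" by blast
  then have "w \<in> {w \<in> V. adj G (xs ! p) w}" using edge_props unfolding adj_def by blast
  then have "{w \<in> V. adj G (xs ! p) w} \<noteq> {}" by blast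
  then show ?thesis unfolding degree_of_def using fin by (simp add: card_gt_0_iff)
qed

text \<open>\<open>forest_ratio_extension\<close> is applied at \<open>xs ! p\<close>. For its
  subtracted term, \<open>forest_ratio_lower\<close> is used on the remaining
  \<open>length ps\<close> vertices, and the degree of \<open>xs ! p\<close> is at most
  \<open>M\<close>.\<close>

lemma mean_extensions_upper:
  assumes v: "valid_code ps" and p: "p \<le> length ps" and M: "\<Delta> + real (Suc (length ps)) \<le> M"
  shows "mean_extensions ps p \<le> (2 + \<eta>) * mean_copies ps - real (length ps) * copy_count ps / M ^ length ps"
proof -
  have M0: "M > 0" using M \<Delta>_pos by linarith
  have "mean_extensions ps p \<le> (\<Sum>xs\<in>copies U E ps. (2 + \<eta>) * forest_ratio (set xs) - real (length ps) / M ^ length ps)"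
    unfolding mean_extensions_def
  proof (rule sum_mono)
    fix xs assume xs: "xs \<in> copies U E ps"
    let ?u = "xs ! p"
    have l: "length xs = Suc (length ps)" and sub: "set xs \<subseteq> V" and subU: "set xs \<subseteq> U"
      using copies_length[OF xs] copies_subset[OF xs] U by auto
    have d: "distinct xs" using xs unfolding copies_def by blast
    have u: "?u \<in> set xs" using l p by simp
    then have uU: "?u \<in> U" using subU by blast
    show "(\<Sum>w | w \<in> V - set xs \<and> {?u, w} \<in> E. forest_ratio (insert w (set xs))) \<le>
        (2 + \<eta>) * forest_ratio (set xs) - real (length ps) / M ^ length ps"
    \<comment> \<open>For a single vertex \<open>forest_ratio_extension\<close> does not apply, as
      no root remains after removing it; the sum is the expected degree itself, and the subtracted
      term is 0.\<close>
    proof (cases "ps = []")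
      case True
      then obtain x where x: "xs = [x]" using l by (auto simp: length_Suc_conv)
      have "?u = x" using x p True by simp
      then have "(\<Sum>w | w \<in> V - set xs \<and> {?u, w} \<in> E. forest_ratio (insert w (set xs))) = mean_degree x"
        unfolding mean_degree_def using x by (auto intro!: sum.cong simp: insert_commute)
      also have "\<dots> \<le> 2 + \<eta>" using mean_degree_le[OF uU] \<open>?u = x\<close> by simp
      also have "2 + \<eta> = (2 + \<eta>) * forest_ratio (set xs) - real (length ps) / M ^ length ps"
        using x sub forest_ratio_single[of x] True by simp
      finally show ?thesis .
    next
      case False
      let ?l = "length ps"
      have c: "card (set xs - {?u}) = ?l" using u l d by (simp add: distinct_card)
      have ne: "set xs - {?u} \<noteq> {}" using c False by force
      have 1: "(\<Sum>w | w \<in> V - set xs \<and> {?u, w} \<in> E. forest_ratio (insert w (set xs))) \<le>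
          forest_ratio (set xs) * mean_degree ?u - forest_ratio (set xs - {?u}) / real (deg ?u)"
        by (rule forest_ratio_extension[OF sub u ne])
      have 2: "forest_ratio (set xs) * mean_degree ?u \<le> forest_ratio (set xs) * (2 + \<eta>)"
        by (intro mult_left_mono mean_degree_le uU forest_ratio_nonneg)
      have 3: "forest_ratio (set xs - {?u}) / real (deg ?u) \<ge> (real ?l / M ^ (?l - 1)) / M"
      proof (rule frac_le)
        show "real ?l / M ^ (?l - 1) \<le> forest_ratio (set xs - {?u})"
          using forest_ratio_lower[of "set xs - {?u}" \<Delta> M] c ne sub subU deg_le M by auto
        show "0 < real (deg ?u)"
          using copies_degree_pos[OF v _ p False, of xs] copies_mono[OF U order_refl] xs by auto
        show "real (deg ?u) \<le> M" using deg_le[OF uU] M by linarith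
      qed (rule forest_ratio_nonneg)
      have 4: "(real ?l / M ^ (?l - 1)) / M = real ?l / M ^ ?l"
        using False by (cases ps) auto
      show ?thesis using 1 2 3 unfolding 4 mult.commute[of "2 + \<eta>"] by linarith
    qed
  qed
  also have "\<dots> = (2 + \<eta>) * mean_copies ps - real (length ps) * copy_count ps / M ^ length ps"
    unfolding mean_copies_def copy_count_def by (simp add: sum_subtractf sum_distrib_left)
  finally show ?thesis .
qed

section \<open>The second moment of the number of copies\<close>

lemma tree_prob_insert:
  assumes e: "{u, w} \<in> E"
  shows "tree_prob (insert {u, w} A) \<le> (if {u, w} \<in> A then tree_prob A else tree_prob A * forest_ratio {u, w})"
proof (cases "{u, w} \<in> A")
  case True
  then show ?thesis by (simp add: insert_absorb)
next
  case False
  have uw: "[u, w] \<in> copies V E [0]" using edge_props[OF e] e unfolding copies_def by auto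
  have ce: "code_edges [0] [u, w] = {{u, w}}" by (simp add: code_edges_def lessThan_Suc)
  have "tree_prob (A \<union> {{u, w}}) \<le> tree_prob A * tree_prob {{u, w}}"
    using negative_correlation[of "[0]" "[u, w]" A] uw False unfolding ce by (simp add: valid_code_def)
  then show ?thesis using False tree_prob_edge[OF e] by simp
qed

text \<open>At most \<open>m\<close> choices of \<open>w\<close> repeat an edge of
  \<open>A z\<close> and cost nothing. By negative correlation the others contribute at most the
  expected degree of \<open>u z\<close>, which is at most 3 since
  \<open>\<eta> \<le> 1\<close>.\<close>

lemma tree_prob_extension:
  assumes Z: "finite Z" and u: "\<And>z. z \<in> Z \<Longrightarrow> u z \<in> U"
    and A: "\<And>z. z \<in> Z \<Longrightarrow> finite (A z) \<and> card (A z) \<le> m"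
  shows "(\<Sum>z\<in>Z. \<Sum>w | w \<in> U \<and> {u z, w} \<in> E. tree_prob (insert {u z, w} (A z))) \<le>
     (real m + 3) * (\<Sum>z\<in>Z. tree_prob (A z))"
  unfolding sum_distrib_left
proof (rule sum_mono)
  fix z assume z: "z \<in> Z"
  let ?u = "u z" and ?A = "A z"
  have inj: "inj_on (\<lambda>w. {?u, w}) Y" for Y by (auto intro!: inj_onI simp: doubleton_eq_iff)
  have "card {w. w \<in> U \<and> {?u, w} \<in> E \<and> {?u, w} \<in> ?A} = card ((\<lambda>w. {?u, w}) ` {w. w \<in> U \<and> {?u, w} \<in> E \<and> {?u, w} \<in> ?A})"
    by (rule card_image[OF inj, symmetric])
  also have "\<dots> \<le> card ?A" by (rule card_mono) (use A[OF z] in auto)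
  finally have c: "card {w. w \<in> U \<and> {?u, w} \<in> E \<and> {?u, w} \<in> ?A} \<le> m" using A[OF z] by linarith
  have "(\<Sum>w | w \<in> U \<and> {?u, w} \<in> E. tree_prob (insert {?u, w} ?A)) \<le>
      (\<Sum>w | w \<in> U \<and> {?u, w} \<in> E. (if {?u, w} \<in> ?A then tree_prob ?A else 0) + tree_prob ?A * forest_ratio {?u, w})"
    by (intro sum_mono order_trans[OF tree_prob_insert]) (auto simp: tree_prob_nonneg forest_ratio_nonneg)
  also have "\<dots> = real (card {w. w \<in> U \<and> {?u, w} \<in> E \<and> {?u, w} \<in> ?A}) * tree_prob ?A +
      tree_prob ?A * (\<Sum>w | w \<in> U \<and> {?u, w} \<in> E. forest_ratio {?u, w})"
    by (simp add: sum.distrib sum_distrib_left[symmetric] finU sum.If_cases Int_def conj_assoc)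
  also have "\<dots> \<le> real m * tree_prob ?A + tree_prob ?A * mean_degree ?u"
  proof (intro add_mono mult_right_mono mult_left_mono)
    show "(\<Sum>w | w \<in> U \<and> {?u, w} \<in> E. forest_ratio {?u, w}) \<le> mean_degree ?u"
      unfolding mean_degree_def neighbours_eq using U fin by (intro sum_mono2) (auto simp: forest_ratio_nonneg)
  qed (use c tree_prob_nonneg in auto)
  also have "\<dots> \<le> real m * tree_prob ?A + tree_prob ?A * 3"
    using mean_degree_le[OF u[OF z]] \<eta>_le by (intro add_left_mono mult_left_mono) (auto simp: tree_prob_nonneg)
  finally show "(\<Sum>w | w \<in> U \<and> {?u, w} \<in> E. tree_prob (insert {?u, w} ?A)) \<le> (real m + 3) * tree_prob ?A"
    by (simp add: algebra_simps)
qed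

lemma homs_bound:
  assumes "valid_code ps" "real (length ps) + 3 \<le> B"
  shows "(\<Sum>xs\<in>homs U E ps. tree_prob (code_edges ps xs)) \<le> B ^ length ps * N"
  using assms
proof (induction ps rule: rev_induct)
  case Nil
  have "tree_prob {} = 1" unfolding tree_prob_def tau_def using tau_pos unfolding tau_def by simp
  moreover have "real (card ((\<lambda>x. [x]) ` U)) \<le> N"
    using card_U card_image_le[OF finU, of "\<lambda>x. [x]"] by linarith
  ultimately show ?case by (simp add: homs_Nil)
next
  case (snoc p ps)
  then have v: "valid_code ps" "p \<le> length ps" by auto
  let ?Z = "homs U E ps"
  have "(\<Sum>ys\<in>homs U E (ps @ [p]). tree_prob (code_edges (ps @ [p]) ys)) =
     (\<Sum>(xs, w)\<in>(SIGMA xs:?Z. {w. w \<in> U \<and> {xs ! p, w} \<in> E}). tree_prob (insert {xs ! p, w} (code_edges ps xs)))"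
  proof (rule sum.reindex_bij_witness[of _ "\<lambda>(xs, w). xs @ [w]" "\<lambda>ys. (butlast ys, last ys)"])
    fix ys assume "ys \<in> homs U E (ps @ [p])"
    then obtain xs w where *: "ys = xs @ [w]" "xs \<in> ?Z" "w \<in> U" "{xs ! p, w} \<in> E"
      by (rule homs_snocE[OF v])
    then show "(butlast ys, last ys) \<in> (SIGMA xs:?Z. {w. w \<in> U \<and> {xs ! p, w} \<in> E})"
      "(case (butlast ys, last ys) of (xs, w) \<Rightarrow> xs @ [w]) = ys"
      "(case (butlast ys, last ys) of (xs, w) \<Rightarrow> tree_prob (insert {xs ! p, w} (code_edges ps xs))) = tree_prob (code_edges (ps @ [p]) ys)"
      using code_edges_snoc[OF v homs_length[OF *(2)]] by auto
  qed (auto simp: homs_snoc_iff[OF v])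
  also have "\<dots> = (\<Sum>xs\<in>?Z. \<Sum>w | w \<in> U \<and> {xs ! p, w} \<in> E. tree_prob (insert {xs ! p, w} (code_edges ps xs)))"
    by (subst sum.Sigma) (auto simp: finU finite_homs)
  also have "\<dots> \<le> (real (length ps) + 3) * (\<Sum>xs\<in>?Z. tree_prob (code_edges ps xs))"
    by (rule tree_prob_extension) (use finU homs_nth[OF _ v(2)] card_code_edges in \<open>auto simp: finite_homs\<close>)
  also have "\<dots> \<le> B * (B ^ length ps * N)"
    by (intro mult_mono snoc.IH v) (use snoc.prems in \<open>auto intro: sum_nonneg simp: tree_prob_nonneg\<close>)
  finally show ?case by (simp add: mult_ac)
qed

text \<open>Pairs of homomorphic copies glued at a vertex. The copy of \<open>ps'\<close> is peeled off one leaf at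
  a time; when the glued vertex itself is that leaf, the leaf is transferred to the other copy.\<close>

lemma glued_homs_bound:
  assumes "valid_code ps" "valid_code ps'" "p \<le> length ps" "b \<le> length ps'"
    and "real (length ps + length ps') + 3 \<le> B"
  shows "(\<Sum>(xs, ys) | xs \<in> homs U E ps \<and> ys \<in> homs U E ps' \<and> xs ! p = ys ! b.
      tree_prob (code_edges ps xs \<union> code_edges ps' ys)) \<le> B ^ (length ps + length ps') * N"
  using assms
proof (induction ps' arbitrary: ps p b rule: rev_induct)
  case Nil
  have "(\<Sum>(xs, ys) | xs \<in> homs U E ps \<and> ys \<in> homs U E [] \<and> xs ! p = ys ! b.
      tree_prob (code_edges ps xs \<union> code_edges [] ys)) = (\<Sum>xs\<in>homs U E ps. tree_prob (code_edges ps xs))"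
    by (rule sum.reindex_bij_witness[of _ "\<lambda>xs. (xs, [xs ! p])" fst])
      (use Nil homs_nth[OF _ Nil.prems(3)] in \<open>auto simp: homs_Nil\<close>)
  then show ?case using homs_bound[OF Nil.prems(1)] Nil.prems by simp
next
  case (snoc r qs)
  then have v: "valid_code qs" "r \<le> length qs" and vp: "valid_code ps" "p \<le> length ps" by auto
  have B: "real (length ps + length qs) + 4 \<le> B" using snoc.prems(5) by simp
  show ?case
  proof (cases "b = Suc (length qs)")
    case True
    \<comment> \<open>The glued vertex \<open>xs ! p\<close> is the last leaf of \<open>ys\<close>,
      attached at \<open>r\<close>. The same edge is read as a new leaf \<open>ys ! r\<close> of
      \<open>xs\<close> attached at \<open>p\<close>, and the copies are then glued at that new
      leaf.\<close>
    have "(\<Sum>(xs, ys) | xs \<in> homs U E ps \<and> ys \<in> homs U E (qs @ [r]) \<and> xs ! p = ys ! b.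
        tree_prob (code_edges ps xs \<union> code_edges (qs @ [r]) ys)) =
      (\<Sum>(xs, ys) | xs \<in> homs U E (ps @ [p]) \<and> ys \<in> homs U E qs \<and> xs ! Suc (length ps) = ys ! r.
        tree_prob (code_edges (ps @ [p]) xs \<union> code_edges qs ys))"
    proof (rule sum.reindex_bij_witness[of _ "\<lambda>(xs, zs). (butlast xs, zs @ [butlast xs ! p])"
          "\<lambda>(xs, ys). (xs @ [butlast ys ! r], butlast ys)"])
      fix z assume "z \<in> {(xs, ys). xs \<in> homs U E ps \<and> ys \<in> homs U E (qs @ [r]) \<and> xs ! p = ys ! b}"
      then obtain xs ys where z: "z = (xs, ys)" "xs \<in> homs U E ps" "ys \<in> homs U E (qs @ [r])" "xs ! p = ys ! b"
        by auto
      obtain zs w where y: "ys = zs @ [w]" "zs \<in> homs U E qs" "w \<in> U" "{zs ! r, w} \<in> E"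
        using homs_snocE[OF v z(3)] by blast
      have w: "w = xs ! p" using z(4) y homs_length[OF y(2)] True by (simp add: nth_append)
      have lx: "length xs = Suc (length ps)" using homs_length[OF z(2)] .
      have e: "{xs ! p, zs ! r} \<in> E" using y(4) w by (simp add: insert_commute)
      show "(case (case z of (xs, ys) \<Rightarrow> (xs @ [butlast ys ! r], butlast ys)) of
          (xs, zs) \<Rightarrow> (butlast xs, zs @ [butlast xs ! p])) = z" by (simp add: z(1) y(1) w)
      show "(case z of (xs, ys) \<Rightarrow> (xs @ [butlast ys ! r], butlast ys)) \<in>
        {(xs, ys). xs \<in> homs U E (ps @ [p]) \<and> ys \<in> homs U E qs \<and> xs ! Suc (length ps) = ys ! r}"
        by (simp add: z(1,2) y(1,2) e lx homs_nth[OF y(2) v(2)] homs_snoc_iff[OF vp] nth_append)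
      show "(case (case z of (xs, ys) \<Rightarrow> (xs @ [butlast ys ! r], butlast ys)) of
          (xs, ys) \<Rightarrow> tree_prob (code_edges (ps @ [p]) xs \<union> code_edges qs ys)) =
        (case z of (xs, ys) \<Rightarrow> tree_prob (code_edges ps xs \<union> code_edges (qs @ [r]) ys))"
        by (simp add: z(1) y(1) w code_edges_snoc[OF vp lx] code_edges_snoc[OF v homs_length[OF y(2)]] insert_commute)
    next
      fix z assume "z \<in> {(xs, ys). xs \<in> homs U E (ps @ [p]) \<and> ys \<in> homs U E qs \<and> xs ! Suc (length ps) = ys ! r}"
      then obtain xs zs where z: "z = (xs, zs)" "xs \<in> homs U E (ps @ [p])" "zs \<in> homs U E qs"
        "xs ! Suc (length ps) = zs ! r" by auto
      obtain ws w where x: "xs = ws @ [w]" "ws \<in> homs U E ps" "w \<in> U" "{ws ! p, w} \<in> E"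
        using homs_snocE[OF vp z(2)] by blast
      have w: "w = zs ! r" using z(4) x homs_length[OF x(2)] by (simp add: nth_append)
      have e: "{zs ! r, ws ! p} \<in> E" using x(4) w by (simp add: insert_commute)
      show "(case (case z of (xs, zs) \<Rightarrow> (butlast xs, zs @ [butlast xs ! p])) of
          (xs, ys) \<Rightarrow> (xs @ [butlast ys ! r], butlast ys)) = z" by (simp add: z(1) x(1) w)
      show "(case z of (xs, zs) \<Rightarrow> (butlast xs, zs @ [butlast xs ! p])) \<in>
          {(xs, ys). xs \<in> homs U E ps \<and> ys \<in> homs U E (qs @ [r]) \<and> xs ! p = ys ! b}"
        by (simp add: z(1,3) x(1,2) e True homs_length[OF z(3)] homs_nth[OF x(2) vp(2)]
            homs_snoc_iff[OF v] nth_append)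
    qed
    also have "\<dots> \<le> B ^ (length (ps @ [p]) + length qs) * N"
      by (rule snoc.IH) (use snoc.prems v vp in auto)
    finally show ?thesis by simp
  next
    case False
    then have b: "b \<le> length qs" using snoc.prems by simp
    let ?Z = "{(xs, ys). xs \<in> homs U E ps \<and> ys \<in> homs U E qs \<and> xs ! p = ys ! b}"
    have fZ: "finite ?Z"
      by (rule finite_subset[of _ "homs U E ps \<times> homs U E qs"]) (auto simp: finite_homs finU)
    have "(\<Sum>(xs, ys) | xs \<in> homs U E ps \<and> ys \<in> homs U E (qs @ [r]) \<and> xs ! p = ys ! b.
        tree_prob (code_edges ps xs \<union> code_edges (qs @ [r]) ys)) =
      (\<Sum>z\<in>(SIGMA z:?Z. {w. w \<in> U \<and> {snd z ! r, w} \<in> E}).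
        tree_prob (insert {snd (fst z) ! r, snd z} (code_edges ps (fst (fst z)) \<union> code_edges qs (snd (fst z)))))"
    proof (rule sum.reindex_bij_witness[of _ "\<lambda>z. (fst (fst z), snd (fst z) @ [snd z])"
          "\<lambda>z. ((fst z, butlast (snd z)), last (snd z))"])
      fix z assume "z \<in> {(xs, ys). xs \<in> homs U E ps \<and> ys \<in> homs U E (qs @ [r]) \<and> xs ! p = ys ! b}"
      then obtain xs ys where z: "z = (xs, ys)" "xs \<in> homs U E ps" "ys \<in> homs U E (qs @ [r])" "xs ! p = ys ! b"
        by auto
      obtain zs w where y: "ys = zs @ [w]" "zs \<in> homs U E qs" "w \<in> U" "{zs ! r, w} \<in> E"
        using homs_snocE[OF v z(3)] by blast
      let ?j = "((fst z, butlast (snd z)), last (snd z))"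
      show "(fst (fst ?j), snd (fst ?j) @ [snd ?j]) = z" using z y by simp
      show "?j \<in> (SIGMA z:?Z. {w. w \<in> U \<and> {snd z ! r, w} \<in> E})"
        using z y homs_length[OF y(2)] b by (simp add: nth_append)
      show "tree_prob (insert {snd (fst ?j) ! r, snd ?j} (code_edges ps (fst (fst ?j)) \<union> code_edges qs (snd (fst ?j)))) =
        (case z of (xs, ys) \<Rightarrow> tree_prob (code_edges ps xs \<union> code_edges (qs @ [r]) ys))"
        using z y code_edges_snoc[OF v homs_length[OF y(2)], of w] by simp
    next
      fix z assume "z \<in> (SIGMA z:?Z. {w. w \<in> U \<and> {snd z ! r, w} \<in> E})"
      then obtain xs zs w where z: "z = ((xs, zs), w)" "xs \<in> homs U E ps" "zs \<in> homs U E qs"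
        "xs ! p = zs ! b" "w \<in> U" "{zs ! r, w} \<in> E" by auto
      let ?i = "(fst (fst z), snd (fst z) @ [snd z])"
      show "((fst ?i, butlast (snd ?i)), last (snd ?i)) = z" using z by simp
      show "?i \<in> {(xs, ys). xs \<in> homs U E ps \<and> ys \<in> homs U E (qs @ [r]) \<and> xs ! p = ys ! b}"
        using z homs_length[OF z(3)] b by (simp add: homs_snoc_iff[OF v] nth_append)
    qed
    also have "\<dots> = (\<Sum>z\<in>?Z. \<Sum>w | w \<in> U \<and> {snd z ! r, w} \<in> E.
        tree_prob (insert {snd z ! r, w} (code_edges ps (fst z) \<union> code_edges qs (snd z))))"
      by (subst sum.Sigma) (auto simp: fZ finU case_prod_beta)
    also have "\<dots> \<le> (real (length ps + length qs) + 3) * (\<Sum>z\<in>?Z. tree_prob (code_edges ps (fst z) \<union> code_edges qs (snd z)))"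
    proof (rule tree_prob_extension[OF fZ])
      fix z assume z: "z \<in> ?Z"
      then show "snd z ! r \<in> U" using homs_nth[OF _ v(2)] by auto
      have "card (code_edges ps (fst z) \<union> code_edges qs (snd z)) \<le> length ps + length qs"
        using card_Un_le[of "code_edges ps (fst z)" "code_edges qs (snd z)"]
          card_code_edges[of ps "fst z"] card_code_edges[of qs "snd z"] by linarith
      then show "finite (code_edges ps (fst z) \<union> code_edges qs (snd z)) \<and>
          card (code_edges ps (fst z) \<union> code_edges qs (snd z)) \<le> length ps + length qs" by simp
    qed
    also have "\<dots> \<le> B * (B ^ (length ps + length qs) * N)"
    proof (rule mult_mono)
      show "(\<Sum>z\<in>?Z. tree_prob (code_edges ps (fst z) \<union> code_edges qs (snd z))) \<le> B ^ (length ps + length qs) * N"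
      proof -
        have "(\<Sum>z\<in>?Z. tree_prob (code_edges ps (fst z) \<union> code_edges qs (snd z))) =
            (\<Sum>(xs, ys)\<in>?Z. tree_prob (code_edges ps xs \<union> code_edges qs ys))"
          by (rule sum.cong) auto
        also have "\<dots> \<le> B ^ (length ps + length qs) * N"
          by (rule snoc.IH[OF vp(1) v(1) vp(2) b]) (use B in simp)
        finally show ?thesis .
      qed
    qed (use B in \<open>auto intro: sum_nonneg simp: tree_prob_nonneg\<close>)
    finally show ?thesis by (simp add: mult_ac)
  qed
qed

definition tree_copies :: "nat list \<Rightarrow> 'a sgraph \<Rightarrow> real" where
  "tree_copies ps \<Gamma> = real (card (copies U (edges \<Gamma>) ps))"

lemma tree_copies_eq:
  assumes "\<Gamma> \<in> spanning_trees G"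
  shows "tree_copies ps \<Gamma> = real (card {xs \<in> copies U E ps. code_edges ps xs \<subseteq> edges \<Gamma>})"
  unfolding tree_copies_def copies_iff_code_edges[OF ST_props(2)[OF assms]] ..

lemma avg_tree_copies:
  assumes "valid_code ps"
  shows "avg (tree_copies ps) = mean_copies ps"
proof -
  have "avg (tree_copies ps) = avg (\<lambda>\<Gamma>. real (card {xs \<in> copies U E ps. code_edges ps xs \<subseteq> edges \<Gamma>}))"
    by (rule avg_cong) (rule tree_copies_eq)
  also have "\<dots> = (\<Sum>xs\<in>copies U E ps. tree_prob (code_edges ps xs))"
    by (rule avg_card) (simp add: finite_copies finU)
  also have "\<dots> = mean_copies ps"
    unfolding mean_copies_def using copies_mono[OF U order_refl] by (intro sum.cong tree_prob_copy assms) auto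
  finally show ?thesis .
qed

text \<open>Disjoint pairs contribute at most the square of the mean by negative correlation.
  Overlapping pairs share a vertex in one of \<open>(Suc (length ps))\<^sup>2\<close> pairs of
  positions, and each such family is only linear in \<open>N\<close> by
  \<open>glued_homs_bound\<close>.\<close>

lemma avg_tree_copies_square:
  assumes v: "valid_code ps" and B: "2 * real (length ps) + 3 \<le> B"
  shows "avg (\<lambda>\<Gamma>. (tree_copies ps \<Gamma>)\<^sup>2) \<le> (mean_copies ps)\<^sup>2 + (real (Suc (length ps)))\<^sup>2 * (B ^ (2 * length ps) * N)"
proof -
  let ?C = "copies U E ps" and ?ce = "code_edges ps"
  let ?J = "{z \<in> ?C \<times> ?C. set (fst z) \<inter> set (snd z) \<noteq> {}}"
  let ?k = "length ps"
  have fC: "finite ?C" by (simp add: finite_copies finU)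
  have CV: "xs \<in> copies V E ps" if "xs \<in> ?C" for xs using copies_mono[OF U order_refl] that by blast
  have "avg (\<lambda>\<Gamma>. (tree_copies ps \<Gamma>)\<^sup>2) = avg (\<lambda>\<Gamma>. real (card {z \<in> ?C \<times> ?C. ?ce (fst z) \<union> ?ce (snd z) \<subseteq> edges \<Gamma>}))"
  proof (rule avg_cong)
    fix \<Gamma> assume \<Gamma>: "\<Gamma> \<in> spanning_trees G"
    let ?A = "{xs \<in> ?C. ?ce xs \<subseteq> edges \<Gamma>}"
    have "{z \<in> ?C \<times> ?C. ?ce (fst z) \<union> ?ce (snd z) \<subseteq> edges \<Gamma>} = ?A \<times> ?A" by auto
    then show "(tree_copies ps \<Gamma>)\<^sup>2 = real (card {z \<in> ?C \<times> ?C. ?ce (fst z) \<union> ?ce (snd z) \<subseteq> edges \<Gamma>})"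
      unfolding tree_copies_eq[OF \<Gamma>] by (simp add: card_cartesian_product power2_eq_square)
  qed
  also have "\<dots> = (\<Sum>z\<in>?C \<times> ?C. tree_prob (?ce (fst z) \<union> ?ce (snd z)))"
    by (rule avg_card) (simp add: fC)
  also have "\<dots> \<le> (\<Sum>z\<in>?C \<times> ?C. forest_ratio (set (fst z)) * forest_ratio (set (snd z)) +
      (if set (fst z) \<inter> set (snd z) \<noteq> {} then tree_prob (?ce (fst z) \<union> ?ce (snd z)) else 0))"
  proof (rule sum_mono)
    fix z assume "z \<in> ?C \<times> ?C"
    then obtain xs ys where z: "z = (xs, ys)" "xs \<in> ?C" "ys \<in> ?C" by auto
    have vert: "\<Union> (?ce xs) \<subseteq> set xs" if "xs \<in> ?C" for xs
    proof -
      have "ps ! i < length xs" if "i < length ps" for i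
        using v that copies_length[OF \<open>xs \<in> ?C\<close>] unfolding valid_code_def by (metis less_Suc_eq_le less_SucI order_le_less_trans)
      then show ?thesis using copies_length[OF that] unfolding code_edges_def by auto
    qed
    show "tree_prob (?ce (fst z) \<union> ?ce (snd z)) \<le> forest_ratio (set (fst z)) * forest_ratio (set (snd z)) +
      (if set (fst z) \<inter> set (snd z) \<noteq> {} then tree_prob (?ce (fst z) \<union> ?ce (snd z)) else 0)"
    proof (cases "set xs \<inter> set ys = {}")
      case True
      have "e \<noteq> {}" if "e \<in> ?ce xs" for e using that unfolding code_edges_def by auto
      then have "?ce xs \<inter> ?ce ys = {}" using vert[OF z(2)] vert[OF z(3)] True by blast
      then have "tree_prob (?ce xs \<union> ?ce ys) \<le> tree_prob (?ce xs) * tree_prob (?ce ys)"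
        by (rule negative_correlation[OF v CV[OF z(3)]])
      then show ?thesis using z tree_prob_copy[OF v CV[OF z(2)]] tree_prob_copy[OF v CV[OF z(3)]] True by simp
    next
      case False
      then show ?thesis using z forest_ratio_nonneg by simp
    qed
  qed
  also have "\<dots> = (\<Sum>z\<in>?C \<times> ?C. forest_ratio (set (fst z)) * forest_ratio (set (snd z))) + (\<Sum>z\<in>?J. tree_prob (?ce (fst z) \<union> ?ce (snd z)))"
    by (simp add: sum.distrib fC sum.inter_filter)
  also have "(\<Sum>z\<in>?C \<times> ?C. forest_ratio (set (fst z)) * forest_ratio (set (snd z))) = (mean_copies ps)\<^sup>2"
    unfolding mean_copies_def power2_eq_square sum_product by (simp add: sum.cartesian_product case_prod_beta)
  also have "(\<Sum>z\<in>?J. tree_prob (?ce (fst z) \<union> ?ce (snd z))) \<le>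
      (\<Sum>a\<le>?k. \<Sum>b\<le>?k. \<Sum>(xs, ys) | xs \<in> homs U E ps \<and> ys \<in> homs U E ps \<and> xs ! a = ys ! b. tree_prob (?ce xs \<union> ?ce ys))"
  proof -
    let ?H = "homs U E ps"
    have fH: "finite ?H" by (simp add: finite_homs finU)
    have "(\<Sum>z\<in>?J. tree_prob (?ce (fst z) \<union> ?ce (snd z))) \<le>
      (\<Sum>z\<in>?J. \<Sum>a\<le>?k. \<Sum>b\<le>?k. if fst z ! a = snd z ! b then tree_prob (?ce (fst z) \<union> ?ce (snd z)) else 0)"
    proof (rule sum_mono)
      fix z assume z: "z \<in> ?J"
      then obtain x where "x \<in> set (fst z)" "x \<in> set (snd z)" by auto
      moreover have "length (fst z) = Suc ?k" "length (snd z) = Suc ?k" using z by (auto dest!: copies_length)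
      ultimately obtain a b where ab: "a \<le> ?k" "b \<le> ?k" "fst z ! a = snd z ! b"
        by (metis in_set_conv_nth less_Suc_eq_le)
      let ?t = "\<lambda>a b. if fst z ! a = snd z ! b then tree_prob (?ce (fst z) \<union> ?ce (snd z)) else 0"
      have "?t a b \<le> (\<Sum>b\<le>?k. ?t a b)" by (rule member_le_sum) (use ab tree_prob_nonneg in auto)
      also have "\<dots> \<le> (\<Sum>a\<le>?k. \<Sum>b\<le>?k. ?t a b)"
        by (rule member_le_sum[of a _ "\<lambda>a. \<Sum>b\<le>?k. ?t a b"]) (use ab in \<open>auto intro!: sum_nonneg simp: tree_prob_nonneg\<close>)
      finally show "tree_prob (?ce (fst z) \<union> ?ce (snd z)) \<le> (\<Sum>a\<le>?k. \<Sum>b\<le>?k. ?t a b)" using ab by simp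
    qed
    also have "\<dots> \<le> (\<Sum>z\<in>?H \<times> ?H. \<Sum>a\<le>?k. \<Sum>b\<le>?k. if fst z ! a = snd z ! b then tree_prob (?ce (fst z) \<union> ?ce (snd z)) else 0)"
    proof (rule sum_mono2)
      show "?J \<subseteq> ?H \<times> ?H" using copies_subset_homs[of U E ps] by auto
      show "0 \<le> (\<Sum>a\<le>?k. \<Sum>b\<le>?k. if fst z ! a = snd z ! b then tree_prob (?ce (fst z) \<union> ?ce (snd z)) else 0)" for z
        using tree_prob_nonneg by (intro sum_nonneg) auto
    qed (simp add: fH)
    also have "\<dots> = (\<Sum>a\<le>?k. \<Sum>b\<le>?k. \<Sum>z\<in>?H \<times> ?H. if fst z ! a = snd z ! b then tree_prob (?ce (fst z) \<union> ?ce (snd z)) else 0)"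
      by (subst sum.swap, intro sum.cong refl, rule sum.swap)
    also have "\<dots> = (\<Sum>a\<le>?k. \<Sum>b\<le>?k. \<Sum>(xs, ys) | xs \<in> ?H \<and> ys \<in> ?H \<and> xs ! a = ys ! b. tree_prob (?ce xs \<union> ?ce ys))"
      by (intro sum.cong refl sum.mono_neutral_cong_right) (auto simp: fH)
    finally show ?thesis .
  qed
  also have "\<dots> \<le> (\<Sum>a\<le>?k. \<Sum>b\<le>?k. B ^ (?k + ?k) * N)"
    by (intro sum_mono glued_homs_bound v) (use B in auto)
  also have "\<dots> = (real (Suc ?k))\<^sup>2 * (B ^ (2 * ?k) * N)" by (simp add: power2_eq_square mult_2)
  finally show ?thesis by simp
qed

text \<open>The variance of the absolute value of \<open>f\<close> is nonnegative.\<close>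

lemma avg_abs_le:
  assumes "avg (\<lambda>\<Gamma>. (f \<Gamma>)\<^sup>2) \<le> t"
  shows "avg (\<lambda>\<Gamma>. \<bar>f \<Gamma>\<bar>) \<le> sqrt t"
proof -
  let ?a = "avg (\<lambda>\<Gamma>. \<bar>f \<Gamma>\<bar>)"
  have "0 = avg (\<lambda>_. 0)" by (simp add: avg_const)
  also have "\<dots> \<le> avg (\<lambda>\<Gamma>. (\<bar>f \<Gamma>\<bar> - ?a)\<^sup>2)" by (rule avg_mono) simp
  also have "\<dots> = avg (\<lambda>\<Gamma>. (f \<Gamma>)\<^sup>2 + ((- 2 * ?a) * \<bar>f \<Gamma>\<bar> + ?a\<^sup>2))"
    by (rule avg_cong) (simp add: power2_diff)
  also have "\<dots> = avg (\<lambda>\<Gamma>. (f \<Gamma>)\<^sup>2) - ?a\<^sup>2"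
    unfolding avg_add avg_cmult avg_const by (simp add: power2_eq_square)
  finally have "?a\<^sup>2 \<le> t" using assms by linarith
  then show ?thesis by (rule real_le_rsqrt)
qed

lemma avg_tree_copies_deviation:
  assumes v: "valid_code ps" and B: "2 * real (length ps) + 3 \<le> B"
  shows "avg (\<lambda>\<Gamma>. \<bar>tree_copies ps \<Gamma> / N - k\<bar>) \<le>
    sqrt ((mean_copies ps / N - k)\<^sup>2 + (real (Suc (length ps)))\<^sup>2 * B ^ (2 * length ps) / N)"
proof (rule avg_abs_le)
  have "avg (\<lambda>\<Gamma>. (tree_copies ps \<Gamma> / N - k)\<^sup>2) = avg (\<lambda>\<Gamma>. (1 / N\<^sup>2) * (tree_copies ps \<Gamma>)\<^sup>2 + ((- 2 * k / N) * tree_copies ps \<Gamma> + k\<^sup>2))"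
    by (rule avg_cong) (simp add: power2_diff power_divide)
  also have "\<dots> = (1 / N\<^sup>2) * avg (\<lambda>\<Gamma>. (tree_copies ps \<Gamma>)\<^sup>2) + ((- 2 * k / N) * mean_copies ps + k\<^sup>2)"
    unfolding avg_add avg_cmult avg_const avg_tree_copies[OF v] ..
  also have "\<dots> \<le> (1 / N\<^sup>2) * ((mean_copies ps)\<^sup>2 + (real (Suc (length ps)))\<^sup>2 * (B ^ (2 * length ps) * N)) +
      ((- 2 * k / N) * mean_copies ps + k\<^sup>2)"
    by (intro add_right_mono mult_left_mono avg_tree_copies_square[OF v B]) simp
  also have "\<dots> = (mean_copies ps / N - k)\<^sup>2 + (real (Suc (length ps)))\<^sup>2 * B ^ (2 * length ps) / N"
  proof -
    have "(1 / n\<^sup>2) * (s\<^sup>2 + a * (b * n)) + ((- 2 * k / n) * s + k\<^sup>2) = (s / n - k)\<^sup>2 + a * b / n"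
      if "n \<noteq> 0" for n s a b :: real
      using that by (simp add: field_simps power2_eq_square)
    then show ?thesis using N_pos by simp
  qed
  finally show "avg (\<lambda>\<Gamma>. (tree_copies ps \<Gamma> / N - k)\<^sup>2) \<le> (mean_copies ps / N - k)\<^sup>2 + (real (Suc (length ps)))\<^sup>2 * B ^ (2 * length ps) / N" .
qed

end

section \<open>Almost regular sequences\<close>

context finite_connected_graph
begin

definition edge_count :: "'a set \<Rightarrow> 'a set \<Rightarrow> real" where
  "edge_count A B = (\<Sum>u\<in>A. real (card {w \<in> B. {u, w} \<in> E}))"

lemma edge_count_sym:
  assumes "finite A" "finite B"
  shows "edge_count A B = edge_count B A"
proof -
  have *: "edge_count A B = (\<Sum>u\<in>A. \<Sum>w\<in>B. if {u, w} \<in> E then 1 else 0)" if "finite B" for A B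
    unfolding edge_count_def using that by (simp add: sum.inter_filter[symmetric])
  show ?thesis unfolding *[OF assms(1)] *[OF assms(2)]
    by (subst sum.swap) (simp add: insert_commute)
qed

lemma edge_count_union:
  assumes "finite A" "finite B" "A \<inter> B = {}"
  shows "edge_count (A \<union> B) C = edge_count A C + edge_count B C"
  unfolding edge_count_def by (rule sum.union_disjoint[OF assms])

lemma edge_count_le_deg:
  assumes "B \<subseteq> V"
  shows "edge_count A B \<le> (\<Sum>u\<in>A. real (deg u))"
  unfolding edge_count_def degree_of_def adj_def
  using assms fin by (intro sum_mono of_nat_mono card_mono) auto

lemma edge_count_V: "edge_count A V = (\<Sum>u\<in>A. real (deg u))"
  unfolding edge_count_def degree_of_def adj_def ..

text \<open>The degree sum over \<open>A\<close> counts the pairs inside \<open>A\<close> and the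
  pairs leaving \<open>A\<close>, and the latter are at most the degree sum over the
  complement.\<close>

lemma edge_count_inner:
  assumes A: "A \<subseteq> V"
  shows "edge_count A A \<ge> 2 * (\<Sum>u\<in>A. real (deg u)) - (\<Sum>u\<in>V. real (deg u))"
proof -
  have f: "finite A" "finite (V - A)" using A fin finite_subset by auto
  have VA: "A \<union> (V - A) = V" "A \<inter> (V - A) = {}" using A by auto
  have "(\<Sum>u\<in>A. real (deg u)) = edge_count V A"
    using edge_count_V edge_count_sym[OF f(1) fin] by simp
  also have "\<dots> = edge_count A A + edge_count (V - A) A"
    using edge_count_union[OF f VA(2)] VA(1) by simp
  also have "edge_count (V - A) A \<le> (\<Sum>u\<in>V - A. real (deg u))" by (rule edge_count_le_deg[OF A])
  also have "\<dots> = (\<Sum>u\<in>V. real (deg u)) - (\<Sum>u\<in>A. real (deg u))"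
    by (rule sum_diff[OF fin A])
  finally show ?thesis by simp
qed

text \<open>\<open>\<rho>\<close> bounds from below the share of \<open>\<Delta> * card V\<close>
  ordered edges inside \<open>V0\<close>, and each of these has tree probability at least
  \<open>2 / (\<Delta> + 2)\<close>. Together they almost exhaust the total
  \<open>2 * (card V - 1)\<close> of the expected degrees, up to a slack governed by
  \<open>\<kappa>\<close>, so few vertices of \<open>V0\<close> can have expected degree above
  \<open>2 + \<eta>\<close>. These are removed.\<close>

lemma good_set_exists:
  fixes d \<delta> :: real
  defines "V0 \<equiv> {v \<in> V. \<bar>real (deg v) - d\<bar> \<le> \<delta> * d}"
    and "\<Delta> \<equiv> (1 + \<delta>) * d"
    and "\<rho> \<equiv> (2 * (1 - \<delta>)\<^sup>2 - (1 + \<delta>)) / (1 + \<delta>)"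
  defines "\<kappa> \<equiv> 1 - \<rho> * \<Delta> / (\<Delta> + 2)"
  assumes d: "d > 0" and \<delta>: "0 \<le> \<delta>" "\<delta> < 1" and \<kappa>: "0 < \<kappa>" "\<kappa> \<le> 1"
    and V0: "real (card V0) \<ge> (1 - \<delta>) * real (card V)"
    and sumdeg: "\<bar>(\<Sum>v\<in>V. real (deg v)) - d * real (card V)\<bar> \<le> \<delta> * d * real (card V)"
  shows "\<exists>U. good_set G U \<Delta> (sqrt \<kappa>) (1 - \<rho> + 4 * sqrt \<kappa>)"
proof -
  let ?N = "real (card V)"
  \<comment> \<open>The exceptional set will have relative size at most
    \<open>2 * \<kappa> / \<eta>\<close>; the square root balances this against the slack
    \<open>\<eta>\<close>.\<close>
  define \<eta> where "\<eta> = sqrt \<kappa>"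
  have \<eta>: "0 < \<eta>" "\<eta> \<le> 1" "\<eta> * \<eta> = \<kappa>" using \<kappa> unfolding \<eta>_def by auto
  have \<Delta>0: "\<Delta> > 0" unfolding \<Delta>_def using d \<delta> by simp
  have V0V: "V0 \<subseteq> V" unfolding V0_def by blast
  have fV0: "finite V0" using V0V fin finite_subset by blast
  have dV0: "(1 - \<delta>) * d \<le> real (deg u)" "real (deg u) \<le> \<Delta>" if "u \<in> V0" for u
    using that unfolding V0_def \<Delta>_def by (auto simp: algebra_simps abs_le_iff)
  have E0: "edge_count V0 V0 \<ge> \<rho> * (\<Delta> * ?N)"
  proof -
    have "(\<Sum>u\<in>V0. real (deg u)) \<ge> (\<Sum>u\<in>V0. (1 - \<delta>) * d)" by (intro sum_mono dV0)
    then have "(\<Sum>u\<in>V0. real (deg u)) \<ge> (1 - \<delta>) * d * real (card V0)" by (simp add: mult.commute)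
    moreover have "(1 - \<delta>) * d * real (card V0) \<ge> (1 - \<delta>) * d * ((1 - \<delta>) * ?N)"
      using d \<delta> by (intro mult_left_mono V0) auto
    ultimately have "(\<Sum>u\<in>V0. real (deg u)) \<ge> (1 - \<delta>) * d * ((1 - \<delta>) * ?N)" by linarith
    moreover have "(\<Sum>v\<in>V. real (deg v)) \<le> d * ?N + \<delta> * d * ?N" using sumdeg by linarith
    ultimately have "edge_count V0 V0 \<ge> 2 * ((1 - \<delta>) * d * ((1 - \<delta>) * ?N)) - (d * ?N + \<delta> * d * ?N)"
      using edge_count_inner[OF V0V] by linarith
    also have "2 * ((1 - \<delta>) * d * ((1 - \<delta>) * ?N)) - (d * ?N + \<delta> * d * ?N) = \<rho> * (\<Delta> * ?N)"
    proof -
      have "\<rho> * \<Delta> = (2 * (1 - \<delta>)\<^sup>2 - (1 + \<delta>)) * d" unfolding \<rho>_def \<Delta>_def using \<delta> by simp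
      then have "\<rho> * (\<Delta> * ?N) = (2 * (1 - \<delta>)\<^sup>2 - (1 + \<delta>)) * d * ?N" by simp
      then show ?thesis by (simp add: power2_eq_square algebra_simps)
    qed
    finally show ?thesis .
  qed
  define B where "B = {u \<in> V0. mean_degree u > 2 + \<eta>}"
  define U where "U = V0 - B"
  have BV0: "B \<subseteq> V0" unfolding B_def by blast
  have fB: "finite B" and fU: "finite U" using BV0 fV0 finite_subset unfolding U_def by auto
  have UB: "U \<union> B = V0" "U \<inter> B = {}" unfolding U_def using BV0 by auto
  have bnd: "edge_count B W \<le> \<Delta> * real (card B)" if "W \<subseteq> V" for W
  proof -
    have "edge_count B W \<le> (\<Sum>u\<in>B. real (deg u))" by (rule edge_count_le_deg[OF that])
    also have "\<dots> \<le> (\<Sum>u\<in>B. \<Delta>)" using BV0 by (intro sum_mono dV0) auto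
    finally show ?thesis by (simp add: mult.commute)
  qed
  have split: "edge_count V0 V0 = edge_count U V0 + edge_count B V0"
    using edge_count_union[OF fU fB UB(2)] UB(1) by simp
  have DV0: "mean_degree u \<ge> real (card {w \<in> V0. {u, w} \<in> E}) * (2 / (\<Delta> + 2))" if u: "u \<in> V0" for u
  proof -
    have "real (card {w \<in> V0. {u, w} \<in> E}) * (2 / (\<Delta> + 2)) = (\<Sum>w | w \<in> V0 \<and> {u, w} \<in> E. 2 / (\<Delta> + 2))"
      by simp
    also have "\<dots> \<le> (\<Sum>w | w \<in> V0 \<and> {u, w} \<in> E. forest_ratio {u, w})"
    proof (rule sum_mono)
      fix w assume w: "w \<in> {w. w \<in> V0 \<and> {u, w} \<in> E}"
      then have uw: "u \<noteq> w" using edge_props by blast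
      have "real (card {u, w}) / (\<Delta> + 2) ^ (card {u, w} - 1) \<le> forest_ratio {u, w}"
        by (rule forest_ratio_lower[where \<Delta> = \<Delta>]) (use uw u w V0V dV0 in auto)
      then show "2 / (\<Delta> + 2) \<le> forest_ratio {u, w}" using uw by simp
    qed
    also have "\<dots> \<le> mean_degree u"
      unfolding mean_degree_def neighbours_eq using V0V fin by (intro sum_mono2) (auto simp: forest_ratio_nonneg)
    finally show ?thesis .
  qed
  have "2 * ?N \<ge> (\<Sum>u\<in>V. mean_degree u)" using sum_mean_degree by simp
  moreover have "(\<Sum>u\<in>V. mean_degree u) \<ge> (\<Sum>u\<in>V0. mean_degree u)" using V0V fin mean_degree_nonneg by (intro sum_mono2) auto
  moreover have "(\<Sum>u\<in>V0. mean_degree u) = (\<Sum>u\<in>U. mean_degree u) + (\<Sum>u\<in>B. mean_degree u)"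
    using sum.union_disjoint[OF fU fB UB(2), of mean_degree] UB(1) by simp
  moreover have "(\<Sum>u\<in>U. mean_degree u) \<ge> (\<Sum>u\<in>U. real (card {w \<in> V0. {u, w} \<in> E}) * (2 / (\<Delta> + 2)))"
    using DV0 unfolding U_def by (intro sum_mono) auto
  moreover have "(\<Sum>u\<in>U. real (card {w \<in> V0. {u, w} \<in> E}) * (2 / (\<Delta> + 2))) = edge_count U V0 * (2 / (\<Delta> + 2))"
    unfolding edge_count_def sum_distrib_right ..
  moreover have "(\<Sum>u\<in>B. mean_degree u) \<ge> (\<Sum>u\<in>B. 2 + \<eta>)" unfolding B_def by (intro sum_mono) auto
  ultimately have 1: "2 * ?N \<ge> edge_count U V0 * (2 / (\<Delta> + 2)) + (2 + \<eta>) * real (card B)"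
    by (simp add: mult.commute)
  have "edge_count U V0 \<ge> \<rho> * (\<Delta> * ?N) - \<Delta> * real (card B)"
    using E0 split bnd[OF V0V] by linarith
  then have "edge_count U V0 * (2 / (\<Delta> + 2)) \<ge> (\<rho> * (\<Delta> * ?N) - \<Delta> * real (card B)) * (2 / (\<Delta> + 2))"
    using \<Delta>0 by (intro mult_right_mono) auto
  moreover have "(\<rho> * (\<Delta> * ?N) - \<Delta> * real (card B)) * (2 / (\<Delta> + 2)) =
      2 * (\<rho> * \<Delta> / (\<Delta> + 2)) * ?N - 2 * real (card B) * (\<Delta> / (\<Delta> + 2))"
    by (simp add: divide_inverse algebra_simps)
  moreover have "2 * real (card B) * (\<Delta> / (\<Delta> + 2)) \<le> 2 * real (card B) * 1"
    using \<Delta>0 by (intro mult_left_mono) auto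
  \<comment> \<open>A vertex of \<open>B\<close> costs at most 2 in the edge term but contributes at
    least \<open>2 + \<eta>\<close> itself, so a surplus of \<open>\<eta>\<close> per vertex has to
    fit into \<open>2 * \<kappa> * ?N\<close>.\<close>
  ultimately have "2 * ?N \<ge> 2 * (1 - \<kappa>) * ?N - 2 * real (card B) + (2 + \<eta>) * real (card B)"
    using 1 unfolding \<kappa>_def by simp
  then have "\<eta> * real (card B) \<le> 2 * \<kappa> * ?N" by (simp add: algebra_simps)
  then have "\<eta> * real (card B) \<le> \<eta> * (2 * \<eta> * ?N)" unfolding \<eta>(3)[symmetric] by (simp add: mult_ac)
  then have cB: "real (card B) \<le> 2 * \<eta> * ?N" using \<eta>(1) by simp
  have UV: "U \<subseteq> V" and BV: "B \<subseteq> V" using V0V BV0 unfolding U_def by auto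
  have "edge_count U V0 = edge_count V0 U" by (rule edge_count_sym[OF fU fV0])
  also have "\<dots> = edge_count U U + edge_count B U"
    using edge_count_union[OF fU fB UB(2)] UB(1) by simp
  finally have "edge_count U U = edge_count V0 V0 - edge_count B V0 - edge_count B U" using split by simp
  \<comment> \<open>Discarding \<open>B\<close> loses its edges in both orders, at most
    \<open>\<Delta> * card B\<close> each; with \<open>card B \<le> 2 * \<eta> * ?N\<close> this
    explains the coefficient 4 of \<open>\<eta>\<close>.\<close>
  then have "edge_count U U \<ge> \<rho> * (\<Delta> * ?N) - 2 * (\<Delta> * real (card B))"
    using E0 bnd[OF V0V] bnd[OF UV] by linarith
  moreover have "\<Delta> * real (card B) \<le> \<Delta> * (2 * \<eta> * ?N)" using cB \<Delta>0 by simp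
  ultimately have EU: "edge_count U U \<ge> \<rho> * (\<Delta> * ?N) - 2 * (\<Delta> * (2 * \<eta> * ?N))" by linarith
  have "good_set G U \<Delta> \<eta> (1 - \<rho> + 4 * \<eta>)"
  proof unfold_locales
    show "U \<subseteq> V" by fact
    show "real (deg u) \<le> \<Delta>" if "u \<in> U" for u using dV0 that unfolding U_def by blast
    show "mean_degree u \<le> 2 + \<eta>" if "u \<in> U" for u using that unfolding U_def B_def by auto
    show "(1 - (1 - \<rho> + 4 * \<eta>)) * \<Delta> * ?N \<le> (\<Sum>u\<in>U. real (card {w \<in> U. {u, w} \<in> E}))"
      using EU unfolding edge_count_def by (simp add: algebra_simps)
  qed (use \<Delta>0 \<eta> in auto)
  then show ?thesis unfolding \<eta>_def by blast
qed

end

section \<open>Limits of the normalised means along the sequence\<close>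

locale good_sequence =
  fixes G :: "nat \<Rightarrow> 'a sgraph" and U :: "nat \<Rightarrow> 'a set" and \<Delta> \<eta> \<theta> :: "nat \<Rightarrow> real"
  assumes good: "\<forall>\<^sub>F n in sequentially. good_set (G n) (U n) (\<Delta> n) (\<eta> n) (\<theta> n)"
    and \<Delta>_lim: "filterlim \<Delta> at_top sequentially"
    and \<eta>_lim: "\<eta> \<longlonglongrightarrow> 0"
    and \<theta>_lim: "\<theta> \<longlonglongrightarrow> 0"
    and N_lim: "filterlim (\<lambda>n. real (card (verts (G n)))) at_top sequentially"
begin

abbreviation order :: "nat \<Rightarrow> real" where
  "order n \<equiv> real (card (verts (G n)))"

text \<open>The normalisation by a power of \<open>\<Delta> n + Suc (length ps)\<close> is the one
  in which \<open>forest_ratio_lower\<close> enters; asymptotically it agrees with the power of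
  \<open>\<Delta> n\<close>.\<close>

lemma copies_density:
  assumes v: "valid_code ps"
  shows "(\<lambda>n. good_set.copy_count (G n) (U n) ps / (order n * (\<Delta> n + real (Suc (length ps))) ^ length ps)) \<longlonglongrightarrow> 1"
proof -
  let ?I = "\<lambda>n. good_set.copy_count (G n) (U n) ps"
  let ?k = "real (Suc (length ps))"
  have inv0: "(\<lambda>n. c / \<Delta> n) \<longlonglongrightarrow> 0" for c
    by (rule tendsto_divide_0[OF tendsto_const]) (rule filterlim_at_top_imp_at_infinity[OF \<Delta>_lim])
  have lo: "(\<lambda>n. 1 - ?k * \<theta> n - ?k\<^sup>2 / \<Delta> n) \<longlonglongrightarrow> 1 - ?k * 0 - 0"
    by (intro tendsto_intros \<theta>_lim inv0)
  have "(\<lambda>n. ?I n / (order n * \<Delta> n ^ length ps)) \<longlonglongrightarrow> 1"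
  proof (rule real_tendsto_sandwich[OF _ _ _ tendsto_const])
    show "\<forall>\<^sub>F n in sequentially. 1 - ?k * \<theta> n - ?k\<^sup>2 / \<Delta> n \<le> ?I n / (order n * \<Delta> n ^ length ps)"
      using good
    proof eventually_elim
      case (elim n)
      then interpret good_set "G n" "U n" "\<Delta> n" "\<eta> n" "\<theta> n" .
      show ?case using copy_count_lower[OF v] N_pos \<Delta>_pos by (simp add: pos_le_divide_eq mult.commute)
    qed
    show "\<forall>\<^sub>F n in sequentially. ?I n / (order n * \<Delta> n ^ length ps) \<le> 1"
      using good
    proof eventually_elim
      case (elim n)
      then interpret good_set "G n" "U n" "\<Delta> n" "\<eta> n" "\<theta> n" .
      show ?case using copy_count_upper[OF v] N_pos \<Delta>_pos by (simp add: pos_divide_le_eq)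
    qed
    show "(\<lambda>n. 1 - ?k * \<theta> n - ?k\<^sup>2 / \<Delta> n) \<longlonglongrightarrow> 1" using lo by simp
  qed
  moreover have "(\<lambda>n. (1 / (1 + ?k / \<Delta> n)) ^ length ps) \<longlonglongrightarrow> (1 / (1 + 0)) ^ length ps"
    by (intro tendsto_intros inv0) auto
  ultimately have "(\<lambda>n. ?I n / (order n * \<Delta> n ^ length ps) * (1 / (1 + ?k / \<Delta> n)) ^ length ps) \<longlonglongrightarrow> 1 * (1 / (1 + 0)) ^ length ps"
    by (rule tendsto_mult)
  then have "(\<lambda>n. ?I n / (order n * \<Delta> n ^ length ps) * (1 / (1 + ?k / \<Delta> n)) ^ length ps) \<longlonglongrightarrow> 1" by simp
  moreover have "\<forall>\<^sub>F n in sequentially. ?I n / (order n * \<Delta> n ^ length ps) * (1 / (1 + ?k / \<Delta> n)) ^ length ps =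
      ?I n / (order n * (\<Delta> n + ?k) ^ length ps)"
    using good
  proof eventually_elim
    case (elim n)
    then interpret good_set "G n" "U n" "\<Delta> n" "\<eta> n" "\<theta> n" .
    have "1 / (1 + ?k / \<Delta> n) = \<Delta> n / (\<Delta> n + ?k)" using \<Delta>_pos by (simp add: field_simps)
    then show ?case using \<Delta>_pos by (simp add: power_divide)
  qed
  ultimately show ?thesis by (rule Lim_transform_eventually)
qed

text \<open>The lower bound \<open>mean_copies_lower\<close> holds for every copy, so that only the sum over the possible
  leaves has to be bounded from above. With \<open>k\<close> the number of vertices of \<open>ps\<close>, the upper
  bound tends to \<open>2 * k - (k - 1) = k + 1\<close>.\<close>

lemma mean_limits_step:
  assumes v: "valid_code ps" and p: "p \<le> length ps"
    and IH: "(\<lambda>n. good_set.mean_copies (G n) (U n) ps / order n) \<longlonglongrightarrow> real (Suc (length ps))"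
  shows "(\<lambda>n. good_set.mean_copies (G n) (U n) (ps @ [p]) / order n) \<longlonglongrightarrow> real (Suc (Suc (length ps)))"
    and "(\<lambda>n. good_set.mean_extensions (G n) (U n) ps p / order n) \<longlonglongrightarrow> real (Suc (Suc (length ps)))"
proof -
  let ?l = "length ps"
  let ?k = "real (Suc ?l)" and ?k' = "real (Suc (Suc ?l))"
  let ?lo = "\<lambda>n. ?k' * (good_set.copy_count (G n) (U n) (ps @ [p]) / (order n * (\<Delta> n + ?k') ^ Suc ?l))"
  let ?hi = "\<lambda>n. (2 + \<eta> n) * (good_set.mean_copies (G n) (U n) ps / order n) -
      real ?l * (good_set.copy_count (G n) (U n) ps / (order n * (\<Delta> n + ?k) ^ ?l))"
  let ?S = "\<lambda>n. good_set.mean_copies (G n) (U n) (ps @ [p]) / order n"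
  let ?SG = "\<lambda>n. good_set.mean_extensions (G n) (U n) ps p / order n"
  have vp: "valid_code (ps @ [p])" using v p by simp
  have lo: "?lo \<longlonglongrightarrow> ?k'"
    using tendsto_mult[OF tendsto_const copies_density[OF vp], of ?k'] by simp
  have "?hi \<longlonglongrightarrow> (2 + 0) * ?k - real ?l * 1"
    by (intro tendsto_intros \<eta>_lim IH copies_density v)
  moreover have "(2 + 0) * ?k - real ?l * 1 = ?k'" by simp
  ultimately have hi: "?hi \<longlonglongrightarrow> ?k'" by (simp only:)
  \<comment> \<open>One chain of inequalities gives both limits. Their equality later shows that few
    copies have a tree edge leaving \<open>U\<close>.\<close>
  have ev: "\<forall>\<^sub>F n in sequentially. ?lo n \<le> ?S n \<and> ?S n \<le> ?SG n \<and> ?SG n \<le> ?hi n"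
    using good
  proof eventually_elim
    case (elim n)
    then interpret good_set "G n" "U n" "\<Delta> n" "\<eta> n" "\<theta> n" .
    have 1: "?k' * copy_count (ps @ [p]) / (\<Delta> n + ?k') ^ Suc ?l \<le> mean_copies (ps @ [p])"
      using mean_copies_lower[of "ps @ [p]" "\<Delta> n + ?k'"] by simp
    have 2: "mean_extensions ps p \<le> (2 + \<eta> n) * mean_copies ps - real ?l * copy_count ps / (\<Delta> n + ?k) ^ ?l"
      by (rule mean_extensions_upper[OF v p]) simp
    have 3: "mean_copies (ps @ [p]) \<le> mean_extensions ps p" by (rule mean_copies_snoc_le[OF v p])
    have n: "0 \<le> order n" by simp
    have 4: "?lo n = (?k' * copy_count (ps @ [p]) / (\<Delta> n + ?k') ^ Suc ?l) / order n" by (simp add: mult_ac)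
    have 5: "?hi n = ((2 + \<eta> n) * mean_copies ps - real ?l * copy_count ps / (\<Delta> n + ?k) ^ ?l) / order n"
      by (simp add: diff_divide_distrib mult_ac)
    show ?case unfolding 4 5 by (intro conjI divide_right_mono 1 2 3 n)
  qed
  show "?S \<longlonglongrightarrow> ?k'"
    by (rule real_tendsto_sandwich[OF _ _ lo hi]) (use ev in \<open>auto elim!: eventually_mono\<close>)
  show "?SG \<longlonglongrightarrow> ?k'"
    by (rule real_tendsto_sandwich[OF _ _ lo hi]) (use ev in \<open>auto elim!: eventually_mono\<close>)
qed

lemma mean_copies_limit:
  assumes "valid_code ps"
  shows "(\<lambda>n. good_set.mean_copies (G n) (U n) ps / order n) \<longlonglongrightarrow> real (Suc (length ps))"
  using assms
proof (induction ps rule: rev_induct)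
  case Nil
  have "\<forall>\<^sub>F n in sequentially. good_set.copy_count (G n) (U n) [] / (order n * (\<Delta> n + real (Suc (length ([] :: nat list)))) ^ length ([] :: nat list)) =
      good_set.mean_copies (G n) (U n) [] / order n"
    using good
  proof eventually_elim
    case (elim n)
    then interpret good_set "G n" "U n" "\<Delta> n" "\<eta> n" "\<theta> n" .
    have "mean_copies [] = copy_count []"
      unfolding mean_copies_def copy_count_def copies_Nil using forest_ratio_single U by (subst sum.reindex) (auto simp: inj_on_def card_image subset_iff)
    then show ?case by simp
  qed
  then show ?case using Lim_transform_eventually[OF copies_density[OF Nil]] by simp
next
  case (snoc p ps)
  then show ?case using mean_limits_step(1)[of ps p] by simp
qed

lemma mean_extensions_limit:
  assumes "valid_code ps" "p \<le> length ps"
  shows "(\<lambda>n. good_set.mean_extensions (G n) (U n) ps p / order n) \<longlonglongrightarrow> real (Suc (Suc (length ps)))"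
  by (rule mean_limits_step(2)[OF assms mean_copies_limit[OF assms(1)]])

lemma tree_copies_limit:
  assumes v: "valid_code ps"
  shows "(\<lambda>n. finite_connected_graph.avg (G n) (\<lambda>\<Gamma>. \<bar>good_set.tree_copies (U n) ps \<Gamma> / order n - real (Suc (length ps))\<bar>)) \<longlonglongrightarrow> 0"
proof (rule real_tendsto_sandwich[OF _ _ tendsto_const])
  let ?k = "real (Suc (length ps))" and ?B = "2 * real (length ps) + 3"
  let ?hi = "\<lambda>n. sqrt ((good_set.mean_copies (G n) (U n) ps / order n - ?k)\<^sup>2 + ?k\<^sup>2 * ?B ^ (2 * length ps) / order n)"
  show "\<forall>\<^sub>F n in sequentially. finite_connected_graph.avg (G n) (\<lambda>\<Gamma>. \<bar>good_set.tree_copies (U n) ps \<Gamma> / order n - ?k\<bar>) \<le> ?hi n"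
    using good
  proof eventually_elim
    case (elim n)
    then interpret good_set "G n" "U n" "\<Delta> n" "\<eta> n" "\<theta> n" .
    show ?case by (rule avg_tree_copies_deviation[OF v]) simp
  qed
  show "\<forall>\<^sub>F n in sequentially. 0 \<le> finite_connected_graph.avg (G n) (\<lambda>\<Gamma>. \<bar>good_set.tree_copies (U n) ps \<Gamma> / order n - ?k\<bar>)"
    using good
  proof eventually_elim
    case (elim n)
    then interpret good_set "G n" "U n" "\<Delta> n" "\<eta> n" "\<theta> n" .
    show ?case using avg_mono[of "\<lambda>_. 0"] by (simp add: avg_const)
  qed
  have "?hi \<longlonglongrightarrow> sqrt ((?k - ?k)\<^sup>2 + 0)"
    by (intro tendsto_intros mean_copies_limit v tendsto_divide_0[OF tendsto_const] filterlim_at_top_imp_at_infinity[OF N_lim])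
  then show "?hi \<longlonglongrightarrow> 0" by simp
qed

end

lemma good_sequence_exists:
  assumes "high_degree_almost_regular G"
  shows "\<exists>U \<Delta> \<eta> \<theta>. good_sequence G U \<Delta> \<eta> \<theta>"
proof -
  obtain d \<delta> where dlim: "filterlim d at_top sequentially" and \<delta>lim: "\<delta> \<longlonglongrightarrow> (0::real)"
    and reg: "\<And>n. n \<ge> 1 \<Longrightarrow>
       real (card {v \<in> verts (G n). \<bar>real (degree_of (G n) v) - d n\<bar> \<le> \<delta> n * d n})
             \<ge> (1 - \<delta> n) * real (card (verts (G n))) \<and>
           \<bar>(\<Sum>v \<in> verts (G n). real (degree_of (G n) v)) - d n * real (card (verts (G n)))\<bar>
             \<le> \<delta> n * d n * real (card (verts (G n)))"
    and gr: "\<And>n. n \<ge> 1 \<Longrightarrow> finite (verts (G n)) \<and> simple_graph (G n) \<and> graph_connected (G n)"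
    using assms unfolding high_degree_almost_regular_def by blast
  have cg: "finite_connected_graph (G n)" if "n \<ge> 1" for n using gr[OF that] by unfold_locales auto
  let ?N = "\<lambda>n. real (card (verts (G n)))"
  define \<Delta> where "\<Delta> n = (1 + \<delta> n) * d n" for n
  define \<rho> where "\<rho> n = (2 * (1 - \<delta> n)\<^sup>2 - (1 + \<delta> n)) / (1 + \<delta> n)" for n
  define \<kappa> where "\<kappa> n = 1 - \<rho> n * \<Delta> n / (\<Delta> n + 2)" for n
  have "(\<lambda>n. 1 + \<delta> n) \<longlonglongrightarrow> 1 + 0" by (intro tendsto_intros \<delta>lim)
  then have "filterlim (\<lambda>n. (1 + \<delta> n) * d n) at_top sequentially"
    using filterlim_tendsto_pos_mult_at_top[OF _ _ dlim, of "\<lambda>n. 1 + \<delta> n" 1] by simp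
  then have \<Delta>lim: "filterlim \<Delta> at_top sequentially" unfolding \<Delta>_def .
  have "\<rho> \<longlonglongrightarrow> (2 * (1 - 0)\<^sup>2 - (1 + 0)) / (1 + 0)"
    unfolding \<rho>_def by (intro tendsto_intros \<delta>lim) auto
  then have \<rho>lim: "\<rho> \<longlonglongrightarrow> 1" by simp
  \<comment> \<open>Nonnegativity of \<open>\<delta> n\<close> comes from the degree sum condition,
    where it bounds an absolute value.\<close>
  have \<delta>0: "\<forall>\<^sub>F n in sequentially. d n > 0 \<and> 0 \<le> \<delta> n \<and> \<delta> n < 1"
    using filterlim_at_top_dense[THEN iffD1, OF dlim, rule_format, of 0]
      order_tendstoD(2)[OF \<delta>lim zero_less_one] eventually_ge_at_top[of 1]
  proof eventually_elim
    case (elim n)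
    interpret finite_connected_graph "G n" using cg elim by blast
    have "?N n > 0" using V_nonempty fin by (simp add: card_gt_0_iff)
    moreover have "0 \<le> \<delta> n * d n * ?N n" using reg[of n] elim by linarith
    ultimately show ?case using elim by (simp add: zero_le_mult_iff)
  qed
  have plus2: "filterlim (\<lambda>n. \<Delta> n + 2) at_top sequentially"
    using filterlim_tendsto_add_at_top[OF tendsto_const[of 2] \<Delta>lim] by (simp add: add.commute)
  have quot: "(\<lambda>n. 1 - 2 / (\<Delta> n + 2)) \<longlonglongrightarrow> 1 - 0"
    by (intro tendsto_diff tendsto_const tendsto_divide_0[OF tendsto_const] filterlim_at_top_imp_at_infinity plus2)
  have \<Delta>0: "\<forall>\<^sub>F n in sequentially. \<Delta> n > 0"
    using filterlim_at_top_dense[THEN iffD1, OF \<Delta>lim, rule_format, of 0] .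
  have "(\<lambda>n. 1 - \<rho> n * (1 - 2 / (\<Delta> n + 2))) \<longlonglongrightarrow> 1 - 1 * (1 - 0)"
    by (intro tendsto_diff tendsto_mult tendsto_const \<rho>lim quot)
  moreover have "\<forall>\<^sub>F n in sequentially. 1 - \<rho> n * (1 - 2 / (\<Delta> n + 2)) = \<kappa> n"
    using \<Delta>0 by eventually_elim (simp add: \<kappa>_def field_simps)
  ultimately have \<kappa>lim: "\<kappa> \<longlonglongrightarrow> 0" using Lim_transform_eventually by fastforce
  have \<rho>1: "\<forall>\<^sub>F n in sequentially. \<rho> n \<le> 1"
    using \<delta>0
  proof eventually_elim
    case (elim n)
    then have "(1 - \<delta> n)\<^sup>2 \<le> 1\<^sup>2" by (intro power_mono) auto
    then show ?case using elim unfolding \<rho>_def by (simp add: pos_divide_le_eq)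
  qed
  have ex: "\<forall>\<^sub>F n in sequentially. \<exists>U. good_set (G n) U (\<Delta> n) (sqrt (\<kappa> n)) (1 - \<rho> n + 4 * sqrt (\<kappa> n))"
    using \<delta>0 order_tendstoD(2)[OF \<kappa>lim zero_less_one] eventually_ge_at_top[of 1] \<rho>1 \<Delta>0
  proof eventually_elim
    case (elim n)
    interpret finite_connected_graph "G n" using cg elim by blast
    have "\<rho> n * \<Delta> n \<le> 1 * \<Delta> n" using elim by (intro mult_right_mono) auto
    then have "\<rho> n * \<Delta> n < \<Delta> n + 2" by linarith
    then have "\<rho> n * \<Delta> n / (\<Delta> n + 2) < 1" using elim by (simp add: pos_divide_less_eq)
    then have \<kappa>0: "\<kappa> n > 0" unfolding \<kappa>_def by simp
    show ?case
      unfolding \<Delta>_def \<rho>_def \<kappa>_def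
      by (rule good_set_exists)
        (use elim \<kappa>0 reg[of n] in \<open>auto simp: \<Delta>_def \<rho>_def \<kappa>_def\<close>)
  qed
  define U where "U n = (SOME U. good_set (G n) U (\<Delta> n) (sqrt (\<kappa> n)) (1 - \<rho> n + 4 * sqrt (\<kappa> n)))" for n
  have "\<forall>\<^sub>F n in sequentially. good_set (G n) (U n) (\<Delta> n) (sqrt (\<kappa> n)) (1 - \<rho> n + 4 * sqrt (\<kappa> n))"
    using ex unfolding U_def by eventually_elim (rule someI_ex)
  moreover have "(\<lambda>n. sqrt (\<kappa> n)) \<longlonglongrightarrow> 0" using tendsto_real_sqrt[OF \<kappa>lim] by simp
  moreover have "(\<lambda>n. 1 - \<rho> n + 4 * sqrt (\<kappa> n)) \<longlonglongrightarrow> 1 - 1 + 4 * sqrt 0"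
    by (intro tendsto_intros \<rho>lim \<kappa>lim)
  \<comment> \<open>A vertex of typical degree exists eventually, and its degree
    \<open>(1 - \<delta> n) * d n\<close> or more is a lower bound for the number of
    vertices.\<close>
  moreover have "filterlim ?N at_top sequentially"
  proof (rule filterlim_at_top_mono)
    have "(\<lambda>n. 1 - \<delta> n) \<longlonglongrightarrow> 1 - 0" by (intro tendsto_intros \<delta>lim)
    then show "filterlim (\<lambda>n. (1 - \<delta> n) * d n) at_top sequentially"
      using filterlim_tendsto_pos_mult_at_top[OF _ _ dlim, of "\<lambda>n. 1 - \<delta> n" 1] by simp
    show "\<forall>\<^sub>F n in sequentially. (1 - \<delta> n) * d n \<le> ?N n"
      using \<delta>0 eventually_ge_at_top[of 1]
    proof eventually_elim
      case (elim n)
      interpret finite_connected_graph "G n" using cg elim by blast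
      have "?N n > 0" using V_nonempty fin by (simp add: card_gt_0_iff)
      then have "(1 - \<delta> n) * ?N n > 0" using elim by simp
      then have "card {v \<in> V. \<bar>real (deg v) - d n\<bar> \<le> \<delta> n * d n} > 0" using reg[of n] elim by linarith
      then obtain v where v: "v \<in> V" "\<bar>real (deg v) - d n\<bar> \<le> \<delta> n * d n"
        unfolding card_gt_0_iff by blast
      have "deg v \<le> card V" unfolding degree_of_def using fin by (intro card_mono) auto
      then show ?case using v by (simp add: algebra_simps abs_le_iff)
    qed
  qed
  ultimately have "good_sequence G U \<Delta> (\<lambda>n. sqrt (\<kappa> n)) (\<lambda>n. 1 - \<rho> n + 4 * sqrt (\<kappa> n))"
    using \<Delta>lim by unfold_locales auto
  then show ?thesis by blast
qed

section \<open>Inclusion-exclusion over attached leaves\<close>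

lemma tree_root_at_copy:
  assumes fin: "finite (verts \<Gamma>)" and T: "graph_tree \<Gamma>" and v: "valid_code ps"
    and xs: "xs \<in> copies (verts \<Gamma>) (edges \<Gamma>) ps"
  shows "\<exists>f. f \<in> forests (verts \<Gamma>) {xs ! 0} \<and> \<Gamma> = tree_of (verts \<Gamma>) (xs ! 0) f \<and>
     (\<forall>i<length ps. f (xs ! Suc i) = xs ! (ps ! i))"
proof -
  have "xs ! 0 \<in> verts \<Gamma>" using xs copies_length[OF xs] copies_subset[OF xs] by (metis nth_mem subsetD zero_less_Suc)
  then obtain f where f: "f \<in> forests (verts \<Gamma>) {xs ! 0}" "\<Gamma> = tree_of (verts \<Gamma>) (xs ! 0) f"
    using tree_parent_function[OF fin T] by blast
  have "code_edges ps xs \<subseteq> edges (tree_of (verts \<Gamma>) (xs ! 0) f)" using copies_code_edges[OF xs] f(2) by simp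
  then have "\<forall>(w, u)\<in>set (parent_pairs ps xs). f w = u" by (rule iffD1[OF code_edges_tree_of[OF v xs f(1)]])
  then have "\<forall>i<length ps. f (xs ! Suc i) = xs ! (ps ! i)" unfolding parent_pairs_def by auto
  then show ?thesis using f by blast
qed

text \<open>With the tree rooted at \<open>xs ! 0\<close>, the parent of every other copy vertex is
  again in the copy. An edge to an outside vertex \<open>w\<close> must therefore lead from
  \<open>w\<close> to its parent, which is unique.\<close>

lemma tree_unique_attachment:
  assumes fin: "finite (verts \<Gamma>)" and T: "graph_tree \<Gamma>" and v: "valid_code ps"
    and xs: "xs \<in> copies (verts \<Gamma>) (edges \<Gamma>) ps" and w: "w \<notin> set xs"
    and i: "i \<le> length ps" "{xs ! i, w} \<in> edges \<Gamma>" and j: "j \<le> length ps" "{xs ! j, w} \<in> edges \<Gamma>"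
  shows "i = j"
proof -
  obtain f where f: "f \<in> forests (verts \<Gamma>) {xs ! 0}" "\<Gamma> = tree_of (verts \<Gamma>) (xs ! 0) f"
    "\<forall>i<length ps. f (xs ! Suc i) = xs ! (ps ! i)"
    using tree_root_at_copy[OF fin T v xs] by blast
  have l: "length xs = Suc (length ps)" and d: "distinct xs" using xs unfolding copies_def by auto
  have "f w = xs ! i" if i: "i \<le> length ps" "{xs ! i, w} \<in> edges \<Gamma>" for i
  proof -
    have "{xs ! i, w} \<in> edges (tree_of (verts \<Gamma>) (xs ! 0) f)" using i f(2) by simp
    then obtain y where y: "y \<in> verts \<Gamma> - {xs ! 0}" "{xs ! i, w} = {y, f y}" unfolding tree_of_def by auto
    show ?thesis
    proof (cases "y = w")
      case True
      then show ?thesis using y by (auto simp: doubleton_eq_iff)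
    next
      case False
      then have yi: "y = xs ! i" "f y = w" using y by (auto simp: doubleton_eq_iff)
      then have "i \<noteq> 0" using y by (metis DiffD2 singletonI)
      then obtain i' where i': "i = Suc i'" by (cases i) auto
      then have "f y = xs ! (ps ! i')" using f(3) yi i by simp
      moreover have "ps ! i' < length xs" using v i i' l unfolding valid_code_def
        by (metis Suc_le_lessD less_Suc_eq order_le_less_trans)
      ultimately show ?thesis using yi w by (metis nth_mem)
    qed
  qed
  then have "xs ! i = xs ! j" using i j by metis
  then show ?thesis using d l i j nth_eq_iff_index_eq[of xs i j] by simp
qed

text \<open>An edge between copy vertices joins one of them to its parent, and these parents are
  given by \<open>ps\<close>. So copies in a tree are automatically induced, which turns them into
  isomorphisms later.\<close>

lemma tree_induced_edges:
  assumes fin: "finite (verts \<Gamma>)" and T: "graph_tree \<Gamma>" and v: "valid_code ps"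
    and xs: "xs \<in> copies (verts \<Gamma>) (edges \<Gamma>) ps"
    and ij: "i \<le> length ps" "j \<le> length ps" "{xs ! i, xs ! j} \<in> edges \<Gamma>"
  shows "{xs ! i, xs ! j} \<in> code_edges ps xs"
proof -
  obtain f where f: "f \<in> forests (verts \<Gamma>) {xs ! 0}" "\<Gamma> = tree_of (verts \<Gamma>) (xs ! 0) f"
    "\<forall>i<length ps. f (xs ! Suc i) = xs ! (ps ! i)"
    using tree_root_at_copy[OF fin T v xs] by blast
  have "{xs ! i, xs ! j} \<in> edges (tree_of (verts \<Gamma>) (xs ! 0) f)" using ij f(2) by simp
  then obtain y where y: "y \<in> verts \<Gamma> - {xs ! 0}" "{xs ! i, xs ! j} = {y, f y}" unfolding tree_of_def by auto
  have "\<exists>m\<le>length ps. y = xs ! m" using y(2) ij by (auto simp: doubleton_eq_iff)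
  then obtain m where m: "m \<le> length ps" "y = xs ! m" by blast
  then have "m \<noteq> 0" using y by (metis DiffD2 singletonI)
  then obtain m' where m': "m = Suc m'" by (cases m) auto
  then have "f y = xs ! (ps ! m')" "m' < length ps" using f(3) m by auto
  then show ?thesis using y(2) m m' unfolding code_edges_def by (auto simp: insert_commute)
qed

definition extras :: "'a set \<Rightarrow> 'a set set \<Rightarrow> nat set \<Rightarrow> 'a list \<Rightarrow> (nat \<times> 'a) set" where
  "extras U E S xs = {(i, w). i \<in> S \<and> w \<in> U - set xs \<and> {xs ! i, w} \<in> E}"

definition index_lists :: "nat set \<Rightarrow> nat \<Rightarrow> nat list set" where
  "index_lists S m = {is. set is \<subseteq> S \<and> length is = m}"

lemma index_lists_0 [simp]: "index_lists S 0 = {[]}"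
  unfolding index_lists_def by auto

lemma card_index_lists: "finite S \<Longrightarrow> card (index_lists S m) = card S ^ m"
  unfolding index_lists_def by (rule card_lists_length_eq)

lemma sum_index_lists_Suc:
  assumes "finite S"
  shows "(\<Sum>is\<in>index_lists S (Suc m). g is) = (\<Sum>is\<in>index_lists S m. \<Sum>i\<in>S. g (is @ [i]))"
proof -
  have img: "index_lists S (Suc m) = (\<lambda>(is, i). is @ [i]) ` (index_lists S m \<times> S)"
  proof
    show "index_lists S (Suc m) \<subseteq> (\<lambda>(is, i). is @ [i]) ` (index_lists S m \<times> S)"
    proof
      fix js assume js: "js \<in> index_lists S (Suc m)"
      then have "js \<noteq> []" unfolding index_lists_def by auto
      then obtain "is" i where "js = is @ [i]" by (metis append_butlast_last_id)
      then show "js \<in> (\<lambda>(is, i). is @ [i]) ` (index_lists S m \<times> S)"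
        using js unfolding index_lists_def by force
    qed
  qed (auto simp: index_lists_def)
  have "inj_on (\<lambda>(is, i). is @ [i]) (index_lists S m \<times> S)" by (auto intro!: inj_onI)
  then show ?thesis
    unfolding img by (subst sum.reindex) (auto simp: sum.cartesian_product case_prod_beta)
qed

lemma valid_code_append:
  assumes "valid_code ps" "S \<subseteq> {..length ps}" "is \<in> index_lists S m"
  shows "valid_code (ps @ is)"
proof -
  have "set is \<subseteq> S" using assms unfolding index_lists_def by blast
  then show ?thesis
  proof (induction "is" rule: rev_induct)
    case (snoc i "is")
    then have "valid_code (ps @ is)" "i \<le> length (ps @ is)" using assms(2) by auto
    then show ?case using valid_code_snoc[of "ps @ is" i] by simp
  qed (use assms in simp)
qed

lemma copies_take:
  assumes "valid_code ps" "S \<subseteq> {..length ps}" "is \<in> index_lists S m" "ys \<in> copies U E (ps @ is)"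
  shows "take (Suc (length ps)) ys \<in> copies U E ps"
proof -
  have l: "length ys = Suc (length ps + length is)" using copies_length[OF assms(4)] by simp
  have "set (take (Suc (length ps)) ys) \<subseteq> U" using copies_subset[OF assms(4)] set_take_subset[of _ ys] by blast
  moreover have "distinct (take (Suc (length ps)) ys)" using assms(4) unfolding copies_def by auto
  moreover have "{take (Suc (length ps)) ys ! (ps ! i), take (Suc (length ps)) ys ! Suc i} \<in> E"
    if i: "i < length ps" for i
  proof -
    have "ps ! i \<le> i" using assms(1) i unfolding valid_code_def by blast
    moreover have "{ys ! ((ps @ is) ! i), ys ! Suc i} \<in> E" using assms(4) i unfolding copies_def by auto
    ultimately show ?thesis using i by (simp add: nth_append)
  qed
  ultimately show ?thesis using l unfolding copies_def by auto
qed

lemma fact_choose_Suc: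
  "fact (Suc m) * real (M choose Suc m) = fact m * real (M choose m) * (real M - real m)"
proof (cases "m \<le> M")
  case True
  have "Suc m * (M choose Suc m) = (M - m) * (M choose m)"
    using binomial_absorption[of m M] binomial_absorb_comp[of M m] by (metis)
  then have "real (Suc m) * real (M choose Suc m) = (real M - real m) * real (M choose m)"
    using True by (metis of_nat_diff of_nat_mult)
  then have "fact m * (real (Suc m) * real (M choose Suc m)) = fact m * ((real M - real m) * real (M choose m))" by simp
  then show ?thesis by (simp only: fact_Suc mult_ac)
qed (simp add: binomial_eq_0)

text \<open>The extra leaves attached to a copy inside a tree are distinct vertices, so that counting
  them with multiplicity gives the factorial moments of the number of extra neighbours.\<close>

lemma sum_extensions:
  assumes fin: "finite (verts \<Gamma>)" and T: "graph_tree \<Gamma>" and v: "valid_code ps"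
    and U: "U \<subseteq> verts \<Gamma>" and S: "S \<subseteq> {..length ps}"
  shows "(\<Sum>is\<in>index_lists S m. \<Sum>ys\<in>copies U (edges \<Gamma>) (ps @ is). g (take (Suc (length ps)) ys)) =
     (\<Sum>xs\<in>copies U (edges \<Gamma>) ps. fact m * real (card (extras U (edges \<Gamma>) S xs) choose m) * g xs)"
proof (induction m arbitrary: g)
  case 0
  show ?case by simp (intro sum.cong refl, auto dest!: copies_length)
next
  case (Suc m)
  let ?E = "edges \<Gamma>" and ?k = "Suc (length ps)"
  let ?M = "\<lambda>xs. card (extras U ?E S xs)"
  have finU: "finite U" using U fin finite_subset by blast
  have finS: "finite S" using S finite_subset by blast
  \<comment> \<open>For a copy with \<open>m\<close> leaves already attached, the candidates for the
    next leaf are the extra neighbours of the underlying copy except those \<open>m\<close>.\<close>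
  have inner: "real (card {(i, w). i \<in> S \<and> w \<in> U - set ys \<and> {ys ! i, w} \<in> ?E}) = real (?M (take ?k ys)) - real m"
    if il: "is \<in> index_lists S m" and ys: "ys \<in> copies U ?E (ps @ is)" for "is" ys
  proof -
    let ?xs = "take ?k ys"
    let ?P = "{(i, w). i \<in> S \<and> w \<in> U - set ys \<and> {ys ! i, w} \<in> ?E}"
    let ?Q = "(\<lambda>l. (is ! l, ys ! (?k + l))) ` {..<m}"
    have xs: "?xs \<in> copies U ?E ps" by (rule copies_take[OF v S il ys])
    have xsV: "?xs \<in> copies (verts \<Gamma>) ?E ps" using copies_mono[OF U order_refl] xs by blast
    have li: "length is = m" and si: "set is \<subseteq> S" using il unfolding index_lists_def by auto
    have l: "length ys = ?k + m" using copies_length[OF ys] li by simp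
    have d: "distinct ys" using ys unfolding copies_def by blast
    have same: "?xs ! i = ys ! i" if "i \<in> S" for i using that S by auto
    have isS: "is ! x \<in> S" if "x < m" for x using that li si nth_mem by blast
    have edge: "{ys ! (is ! x), ys ! (?k + x)} \<in> ?E" if x: "x < m" for x
    proof -
      have "\<forall>i<length (ps @ is). {ys ! ((ps @ is) ! i), ys ! Suc i} \<in> ?E"
        using ys unfolding copies_def by blast
      from this[rule_format, of "length ps + x"] show ?thesis using x li by (simp add: nth_append)
    qed
    have fresh: "ys ! (?k + x) \<notin> set ?xs" if x: "x < m" for x
    proof
      assume "ys ! (?k + x) \<in> set ?xs"
      then obtain j where "j < ?k" "ys ! j = ys ! (?k + x)" by (auto simp: in_set_conv_nth)
      then show False using d l x nth_eq_iff_index_eq[of ys j "?k + x"] by simp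
    qed
    \<comment> \<open>An extra neighbour that occurs in \<open>ys\<close> is one of the attached
      leaves, and by \<open>tree_unique_attachment\<close> it occurs with the same index.\<close>
    have ex: "extras U ?E S ?xs = ?P \<union> ?Q"
    proof
      show "extras U ?E S ?xs \<subseteq> ?P \<union> ?Q"
      proof
        fix z assume "z \<in> extras U ?E S ?xs"
        then obtain i w where z: "z = (i, w)" "i \<in> S" "w \<in> U" "w \<notin> set ?xs" "{?xs ! i, w} \<in> ?E"
          unfolding extras_def by auto
        show "z \<in> ?P \<union> ?Q"
        proof (cases "w \<in> set ys")
          case False
          then show ?thesis using z same by auto
        next
          case True
          then obtain j where j: "j < length ys" "ys ! j = w" by (metis in_set_conv_nth)
          have "\<not> j < ?k"
          proof
            assume "j < ?k"
            then have "w \<in> set ?xs" using j l by (metis in_set_conv_nth length_take min_less_iff_conj nth_take)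
            then show False using z by simp
          qed
          then obtain x where x: "j = ?k + x" "x < m" using j l by (metis add_less_cancel_left le_Suc_ex linorder_not_less)
          have "i = is ! x"
          proof (rule tree_unique_attachment[OF fin T v xsV z(4) _ z(5)])
            show "{?xs ! (is ! x), w} \<in> ?E" using edge[OF x(2)] same[OF isS[OF x(2)]] x j by simp
          qed (use z(2) isS[OF x(2)] S in auto)
          then show ?thesis using z x j by auto
        qed
      qed
      show "?P \<union> ?Q \<subseteq> extras U ?E S ?xs"
      proof
        fix z assume "z \<in> ?P \<union> ?Q"
        then consider "z \<in> ?P" | x where "x < m" "z = (is ! x, ys ! (?k + x))" by blast
        then show "z \<in> extras U ?E S ?xs"
        proof cases
          case 1
          then show ?thesis using same set_take_subset[of ?k ys] unfolding extras_def by auto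
        next
          case 2
          have "ys ! (?k + x) \<in> U" using copies_subset[OF ys] l 2(1) by (simp add: subset_iff)
          then show ?thesis using 2 fresh edge isS same unfolding extras_def by simp
        qed
      qed
    qed
    have fP: "finite ?P" by (rule finite_subset[of _ "S \<times> U"]) (auto simp: finS finU)
    have disj: "?P \<inter> ?Q = {}" using l by (auto simp: set_conv_nth)
    have "inj_on (\<lambda>x. (is ! x, ys ! (?k + x))) {..<m}"
      using d l by (intro inj_onI) (simp add: nth_eq_iff_index_eq)
    then have "card ?Q = m" by (simp add: card_image)
    then have "?M ?xs = card ?P + m" unfolding ex by (subst card_Un_disjoint[OF fP _ disj]) auto
    then show ?thesis by simp
  qed
  have "(\<Sum>is\<in>index_lists S (Suc m). \<Sum>ys\<in>copies U ?E (ps @ is). g (take ?k ys)) =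
      (\<Sum>is\<in>index_lists S m. \<Sum>i\<in>S. \<Sum>ys\<in>copies U ?E ((ps @ is) @ [i]). g (take ?k ys))"
    unfolding sum_index_lists_Suc[OF finS] by simp
  also have "\<dots> = (\<Sum>is\<in>index_lists S m. \<Sum>i\<in>S. \<Sum>ys\<in>copies U ?E (ps @ is).
      \<Sum>w | w \<in> U - set ys \<and> {ys ! i, w} \<in> ?E. g (take ?k ys))"
  proof (rule sum.cong[OF refl], rule sum.cong[OF refl])
    fix "is" i assume il: "is \<in> index_lists S m" and i: "i \<in> S"
    have "i \<le> length (ps @ is)" using i S by auto
    then have "(\<Sum>ys\<in>copies U ?E ((ps @ is) @ [i]). g (take ?k ys)) = (\<Sum>ys\<in>copies U ?E (ps @ is).
      \<Sum>w | w \<in> U - set ys \<and> {ys ! i, w} \<in> ?E. g (take ?k (ys @ [w])))"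
      by (rule sum_copies_snoc[OF valid_code_append[OF v S il] _ finU])
    also have "\<dots> = (\<Sum>ys\<in>copies U ?E (ps @ is).
      \<Sum>w | w \<in> U - set ys \<and> {ys ! i, w} \<in> ?E. g (take ?k ys))"
      by (intro sum.cong refl) (auto dest: copies_length)
    finally show "(\<Sum>ys\<in>copies U ?E ((ps @ is) @ [i]). g (take ?k ys)) = \<dots>" .
  qed
  also have "\<dots> = (\<Sum>is\<in>index_lists S m. \<Sum>ys\<in>copies U ?E (ps @ is). (real (?M (take ?k ys)) - real m) * g (take ?k ys))"
  proof (rule sum.cong[OF refl])
    fix "is" assume il: "is \<in> index_lists S m"
    have "(\<Sum>i\<in>S. \<Sum>ys\<in>copies U ?E (ps @ is). \<Sum>w | w \<in> U - set ys \<and> {ys ! i, w} \<in> ?E. g (take ?k ys)) =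
        (\<Sum>ys\<in>copies U ?E (ps @ is). \<Sum>i\<in>S. \<Sum>w | w \<in> U - set ys \<and> {ys ! i, w} \<in> ?E. g (take ?k ys))"
      by (rule sum.swap)
    also have "\<dots> = (\<Sum>ys\<in>copies U ?E (ps @ is). (real (?M (take ?k ys)) - real m) * g (take ?k ys))"
    proof (intro sum.cong refl)
      fix ys assume ys: "ys \<in> copies U ?E (ps @ is)"
      have "(\<Sum>i\<in>S. \<Sum>w | w \<in> U - set ys \<and> {ys ! i, w} \<in> ?E. g (take ?k ys)) =
        (\<Sum>z\<in>(SIGMA i:S. {w. w \<in> U - set ys \<and> {ys ! i, w} \<in> ?E}). g (take ?k ys))"
        by (subst sum.Sigma) (auto simp: finS finU case_prod_beta)
      also have "(SIGMA i:S. {w. w \<in> U - set ys \<and> {ys ! i, w} \<in> ?E}) =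
          {(i, w). i \<in> S \<and> w \<in> U - set ys \<and> {ys ! i, w} \<in> ?E}" by auto
      also have "(\<Sum>z\<in>\<dots>. g (take ?k ys)) = (real (?M (take ?k ys)) - real m) * g (take ?k ys)"
        using inner[OF il ys] by simp
      finally show "(\<Sum>i\<in>S. \<Sum>w | w \<in> U - set ys \<and> {ys ! i, w} \<in> ?E. g (take ?k ys)) = \<dots>" .
    qed
    finally show "(\<Sum>i\<in>S. \<Sum>ys\<in>copies U ?E (ps @ is). \<Sum>w | w \<in> U - set ys \<and> {ys ! i, w} \<in> ?E. g (take ?k ys)) = \<dots>" .
  qed
  \<comment> \<open>The weight \<open>g\<close> is arbitrary so that the new factor can be absorbed
    into it here.\<close>
  also have "\<dots> = (\<Sum>xs\<in>copies U ?E ps. fact m * real (?M xs choose m) * ((real (?M xs) - real m) * g xs))"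
    by (rule Suc.IH)
  also have "\<dots> = (\<Sum>xs\<in>copies U ?E ps. fact (Suc m) * real (?M xs choose Suc m) * g xs)"
    by (intro sum.cong refl) (simp only: fact_choose_Suc mult.assoc)
  finally show ?case .
qed

lemma alternating_choose_sum:
  "(\<Sum>j\<le>m. (-1) ^ j * real (Suc M choose j)) = (-1) ^ m * real (M choose m)"
  by (induction m) (simp_all add: algebra_simps)

text \<open>For \<open>M > 0\<close> the truncated alternating sum is, up to sign,
  \<open>M - 1 choose m\<close>, which Pascal's rule bounds by
  \<open>M choose Suc m\<close>.\<close>

lemma bonferroni:
  "\<bar>(if M = 0 then 1 else 0) - (\<Sum>j\<le>m. (-1) ^ j * real (M choose j))\<bar> \<le> real (M choose Suc m)"
proof (cases M)
  case 0
  have "(\<Sum>j\<le>m. (-1) ^ j * real (0 choose j)) = (\<Sum>j\<in>{0}. (-1) ^ j * real (0 choose j))"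
    by (rule sum.mono_neutral_right) (auto simp: gr0_conv_Suc)
  then show ?thesis using 0 by simp
next
  case (Suc M')
  then show ?thesis unfolding Suc alternating_choose_sum by (simp add: abs_mult)
qed

lemma bonferroni_copies:
  assumes fin: "finite (verts \<Gamma>)" and T: "graph_tree \<Gamma>" and v: "valid_code ps"
    and U: "U \<subseteq> verts \<Gamma>" and S: "S \<subseteq> {..length ps}"
  shows "\<bar>real (card {xs \<in> copies U (edges \<Gamma>) ps. extras U (edges \<Gamma>) S xs = {}}) -
     (\<Sum>j\<le>m. (-1) ^ j / fact j * (\<Sum>is\<in>index_lists S j. real (card (copies U (edges \<Gamma>) (ps @ is)))))\<bar>
     \<le> (\<Sum>is\<in>index_lists S (Suc m). real (card (copies U (edges \<Gamma>) (ps @ is)))) / fact (Suc m)"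
proof -
  let ?E = "edges \<Gamma>"
  let ?M = "\<lambda>xs. card (extras U ?E S xs)"
  let ?C = "copies U ?E ps"
  have finU: "finite U" using U fin finite_subset by blast
  have finS: "finite S" using S finite_subset by blast
  have fx: "finite (extras U ?E S xs)" for xs
    by (rule finite_subset[of _ "S \<times> U"]) (auto simp: finS finU extras_def)
  have moment: "(\<Sum>is\<in>index_lists S j. real (card (copies U ?E (ps @ is)))) = (\<Sum>xs\<in>?C. fact j * real (?M xs choose j))" for j
    using sum_extensions[OF fin T v U S, where m = j and g = "\<lambda>_. 1"] by simp
  have a: "(-1) ^ j / fact j * (\<Sum>is\<in>index_lists S j. real (card (copies U ?E (ps @ is)))) =
      (\<Sum>xs\<in>?C. (-1) ^ j * real (?M xs choose j))" for j
    unfolding moment sum_distrib_left by (intro sum.cong) auto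
  have b: "(\<Sum>is\<in>index_lists S (Suc m). real (card (copies U ?E (ps @ is)))) / fact (Suc m) =
      (\<Sum>xs\<in>?C. real (?M xs choose Suc m))"
    unfolding moment sum_divide_distrib by (intro sum.cong) auto
  have c: "real (card {xs \<in> ?C. extras U ?E S xs = {}}) = (\<Sum>xs\<in>?C. if ?M xs = 0 then 1 else 0)"
    using fx by (simp add: sum.inter_filter[symmetric] finite_copies finU)
  have "\<bar>(\<Sum>xs\<in>?C. if ?M xs = 0 then 1 else 0) - (\<Sum>j\<le>m. \<Sum>xs\<in>?C. (-1) ^ j * real (?M xs choose j))\<bar> =
      \<bar>\<Sum>xs\<in>?C. (if ?M xs = 0 then 1 else 0) - (\<Sum>j\<le>m. (-1) ^ j * real (?M xs choose j))\<bar>"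
    by (subst sum.swap) (simp add: sum_subtractf)
  also have "\<dots> \<le> (\<Sum>xs\<in>?C. real (?M xs choose Suc m))"
    by (rule order_trans[OF sum_abs]) (intro sum_mono bonferroni)
  finally show ?thesis unfolding a b c .
qed

text \<open>Further neighbours are excluded in all of \<open>\<Gamma>\<close>, whereas
  \<open>extras U\<close> sees only those in \<open>U\<close>; the balls correspond to this
  version.\<close>

definition full_copies :: "'a sgraph \<Rightarrow> nat list \<Rightarrow> nat set \<Rightarrow> 'a list set" where
  "full_copies \<Gamma> ps S = {xs \<in> copies (verts \<Gamma>) (edges \<Gamma>) ps.
     \<forall>i\<in>S. \<forall>w\<in>verts \<Gamma>. {xs ! i, w} \<in> edges \<Gamma> \<longrightarrow> w \<in> set xs}"

lemma finite_full_copies: "finite (verts \<Gamma>) \<Longrightarrow> finite (full_copies \<Gamma> ps S)"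
  unfolding full_copies_def by (simp add: finite_copies)

lemma full_copies_degree:
  assumes fin: "finite (verts \<Gamma>)" and xs: "xs \<in> full_copies \<Gamma> ps S" and i: "i \<in> S"
  shows "card {w \<in> verts \<Gamma>. {xs ! i, w} \<in> edges \<Gamma>} \<le> Suc (length ps)"
proof -
  have "{w \<in> verts \<Gamma>. {xs ! i, w} \<in> edges \<Gamma>} \<subseteq> set xs" using xs i unfolding full_copies_def by blast
  then have "card {w \<in> verts \<Gamma>. {xs ! i, w} \<in> edges \<Gamma>} \<le> card (set xs)" by (intro card_mono) auto
  also have "\<dots> = Suc (length ps)" using xs copies_card unfolding full_copies_def by blast
  finally show ?thesis .
qed

text \<open>The parents \<open>ps ! i\<close> lie in \<open>S\<close>, so their neighbours all
  belong to the copy. Choosing the vertices in order leaves at most \<open>Suc (length ps)\<close>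
  possibilities for each vertex after the root.\<close>

lemma full_copies_rooted_bound:
  assumes fin: "finite (verts \<Gamma>)" and v: "valid_code ps" and S: "\<And>i. i < length ps \<Longrightarrow> ps ! i \<in> S"
  shows "card {xs \<in> full_copies \<Gamma> ps S. xs ! 0 = x} \<le> Suc (length ps) ^ length ps"
proof -
  let ?k = "Suc (length ps)"
  let ?A = "{xs \<in> full_copies \<Gamma> ps S. xs ! 0 = x}"
  have fA: "finite ?A" using finite_full_copies[OF fin] by simp
  have len: "length xs = ?k" if "xs \<in> ?A" for xs
    using that copies_length unfolding full_copies_def by blast
  have "card (take (Suc j) ` ?A) \<le> ?k ^ j" if "j \<le> length ps" for j
    using that
  proof (induction j)
    case 0
    have "take (Suc 0) ` ?A \<subseteq> {[x]}" using len by (auto simp: take_Suc_conv_app_nth)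
    then show ?case using card_mono[of "{[x]}" "take (Suc 0) ` ?A"] by simp
  next
    case (Suc j)
    let ?nb = "\<lambda>ys. {w \<in> verts \<Gamma>. {ys ! (ps ! j), w} \<in> edges \<Gamma>}"
    have j: "j < length ps" "ps ! j \<le> j" using Suc.prems v unfolding valid_code_def by auto
    have "take (Suc (Suc j)) ` ?A \<subseteq> (\<Union>ys\<in>take (Suc j) ` ?A. (\<lambda>w. ys @ [w]) ` ?nb ys)"
    proof
      fix zs assume "zs \<in> take (Suc (Suc j)) ` ?A"
      then obtain xs where xs: "xs \<in> ?A" "zs = take (Suc (Suc j)) xs" by blast
      have c: "xs \<in> copies (verts \<Gamma>) (edges \<Gamma>) ps" using xs(1) unfolding full_copies_def by blast
      have "zs = take (Suc j) xs @ [xs ! Suc j]" using xs len[OF xs(1)] j by (simp add: take_Suc_conv_app_nth)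
      moreover have "{xs ! (ps ! j), xs ! Suc j} \<in> edges \<Gamma>" using c j unfolding copies_def by blast
      moreover have "xs ! Suc j \<in> verts \<Gamma>" using copies_subset[OF c] len[OF xs(1)] j by (simp add: subset_iff)
      ultimately show "zs \<in> (\<Union>ys\<in>take (Suc j) ` ?A. (\<lambda>w. ys @ [w]) ` ?nb ys)"
        using xs(1) j by force
    qed
    then have "card (take (Suc (Suc j)) ` ?A) \<le> card (\<Union>ys\<in>take (Suc j) ` ?A. (\<lambda>w. ys @ [w]) ` ?nb ys)"
      by (intro card_mono) (use fA fin in auto)
    also have "\<dots> \<le> (\<Sum>ys\<in>take (Suc j) ` ?A. card ((\<lambda>w. ys @ [w]) ` ?nb ys))"
      by (rule card_UN_le) (use fA in simp)
    also have "\<dots> \<le> (\<Sum>ys\<in>take (Suc j) ` ?A. ?k)"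
    proof (rule sum_mono)
      fix ys assume "ys \<in> take (Suc j) ` ?A"
      then obtain xs where xs: "xs \<in> ?A" "ys = take (Suc j) xs" by blast
      have "ys ! (ps ! j) = xs ! (ps ! j)" using xs j by simp
      then have "card (?nb ys) \<le> ?k"
        using full_copies_degree[OF fin _ S[OF j(1)], of xs ps] xs(1) by simp
      then show "card ((\<lambda>w. ys @ [w]) ` ?nb ys) \<le> ?k"
        using card_image_le[of "?nb ys" "\<lambda>w. ys @ [w]"] fin by simp
    qed
    also have "\<dots> = card (take (Suc j) ` ?A) * ?k" by simp
    also have "\<dots> \<le> ?k ^ j * ?k" by (rule mult_right_mono[OF Suc.IH]) (use Suc.prems in auto)
    finally show ?case by (simp only: power_Suc2)
  qed
  from this[of "length ps"] have "card (take ?k ` ?A) \<le> ?k ^ length ps" by simp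
  moreover have "take ?k ` ?A = ?A" using len by force
  ultimately show ?thesis by simp
qed

text \<open>As the image of an index in \<open>S\<close>, the vertex \<open>a\<close> has few
  neighbours, and one of them is the image of the parent of \<open>p\<close>. Passing to parents
  reaches index 0 after at most \<open>p\<close> moves, each costing one factor.\<close>

lemma full_copies_pointed_bound:
  assumes fin: "finite (verts \<Gamma>)" and v: "valid_code ps" and S: "\<And>i. i < length ps \<Longrightarrow> ps ! i \<in> S"
    and p: "p \<in> S" "p \<le> length ps"
  shows "card {xs \<in> full_copies \<Gamma> ps S. xs ! p = a} \<le> Suc (length ps) ^ (length ps + p)"
  using p
proof (induction p arbitrary: a rule: less_induct)
  case (less p)
  let ?k = "Suc (length ps)"
  let ?A = "{xs \<in> full_copies \<Gamma> ps S. xs ! p = a}"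
  have fF: "finite (full_copies \<Gamma> ps S)" by (rule finite_full_copies[OF fin])
  show ?case
  proof (cases p)
    case 0
    then show ?thesis using full_copies_rooted_bound[OF fin v S] by simp
  next
    case (Suc i)
    show ?thesis
    proof (cases "?A = {}")
      case False
      then obtain xs0 where xs0: "xs0 \<in> full_copies \<Gamma> ps S" "xs0 ! p = a" by blast
      let ?nb = "{w \<in> verts \<Gamma>. {a, w} \<in> edges \<Gamma>}"
      have nb: "card ?nb \<le> ?k" using full_copies_degree[OF fin xs0(1) less.prems(1)] xs0(2) by simp
      have i: "i < length ps" using Suc less.prems by simp
      have pi: "ps ! i \<le> i" using v i unfolding valid_code_def by blast
      have "?A \<subseteq> (\<Union>b\<in>?nb. {xs \<in> full_copies \<Gamma> ps S. xs ! (ps ! i) = b})"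
      proof
        fix xs assume xs: "xs \<in> ?A"
        then have c: "xs \<in> copies (verts \<Gamma>) (edges \<Gamma>) ps" unfolding full_copies_def by blast
        then have "{xs ! (ps ! i), xs ! Suc i} \<in> edges \<Gamma>" using i unfolding copies_def by blast
        then have "{a, xs ! (ps ! i)} \<in> edges \<Gamma>" using xs Suc by (auto simp: insert_commute)
        moreover have "xs ! (ps ! i) \<in> verts \<Gamma>"
          using copies_subset[OF c] copies_length[OF c] i pi by (simp add: subset_iff)
        ultimately show "xs \<in> (\<Union>b\<in>?nb. {xs \<in> full_copies \<Gamma> ps S. xs ! (ps ! i) = b})" using xs by auto
      qed
      then have "card ?A \<le> card (\<Union>b\<in>?nb. {xs \<in> full_copies \<Gamma> ps S. xs ! (ps ! i) = b})"
        by (intro card_mono) (use fF fin in auto)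
      also have "\<dots> \<le> (\<Sum>b\<in>?nb. card {xs \<in> full_copies \<Gamma> ps S. xs ! (ps ! i) = b})"
        by (rule card_UN_le) (use fin in simp)
      also have "\<dots> \<le> (\<Sum>b\<in>?nb. ?k ^ (length ps + i))"
      proof (rule sum_mono)
        fix b
        have "card {xs \<in> full_copies \<Gamma> ps S. xs ! (ps ! i) = b} \<le> ?k ^ (length ps + ps ! i)"
          by (rule less.IH) (use S i pi Suc in auto)
        also have "\<dots> \<le> ?k ^ (length ps + i)" using pi by (intro power_increasing) auto
        finally show "card {xs \<in> full_copies \<Gamma> ps S. xs ! (ps ! i) = b} \<le> ?k ^ (length ps + i)" .
      qed
      also have "\<dots> = card ?nb * ?k ^ (length ps + i)" by simp
      also have "\<dots> \<le> ?k * ?k ^ (length ps + i)" using nb by (rule mult_right_mono) simp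
      finally show ?thesis unfolding Suc by (simp only: add_Suc_right power_Suc)
    next
      case True
      then show ?thesis by (simp only: card.empty)
    qed
  qed
qed

text \<open>A copy that leaves \<open>U\<close> uses a tree edge leaving \<open>U\<close>, and since the inner vertices of a full
  copy have bounded degree, boundedly many full copies use a given edge.\<close>

lemma full_copies_leaving_bound:
  assumes fin: "finite (verts \<Gamma>)" and v: "valid_code ps" and S: "\<And>i. i < length ps \<Longrightarrow> ps ! i \<in> S"
    and ne: "ps \<noteq> []"
  shows "card (full_copies \<Gamma> ps S - copies U (edges \<Gamma>) ps) \<le>
    length ps * (card {(a, b). a \<in> verts \<Gamma> \<and> b \<in> verts \<Gamma> \<and> {a, b} \<in> edges \<Gamma> \<and> \<not> (a \<in> U \<and> b \<in> U)} *
      Suc (length ps) ^ (2 * length ps))"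
proof -
  let ?k = "Suc (length ps)"
  let ?Bad = "{(a, b). a \<in> verts \<Gamma> \<and> b \<in> verts \<Gamma> \<and> {a, b} \<in> edges \<Gamma> \<and> \<not> (a \<in> U \<and> b \<in> U)}"
  let ?F = "full_copies \<Gamma> ps S"
  have fF: "finite ?F" by (rule finite_full_copies[OF fin])
  have fB: "finite ?Bad" by (rule finite_subset[of _ "verts \<Gamma> \<times> verts \<Gamma>"]) (auto simp: fin)
  have "?F - copies U (edges \<Gamma>) ps \<subseteq> (\<Union>i\<in>{..<length ps}. \<Union>z\<in>?Bad. {xs \<in> ?F. xs ! (ps ! i) = fst z})"
  proof
    fix xs assume xs: "xs \<in> ?F - copies U (edges \<Gamma>) ps"
    then have c: "xs \<in> copies (verts \<Gamma>) (edges \<Gamma>) ps" unfolding full_copies_def by blast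
    have l: "length xs = ?k" by (rule copies_length[OF c])
    have "\<not> set xs \<subseteq> U" using xs c unfolding copies_def by auto
    then obtain m where m: "m < ?k" "xs ! m \<notin> U" using l by (metis in_set_conv_nth subsetI)
    \<comment> \<open>Every vertex of the copy is an end of one of its edges; for index 0 this is
      the first edge, as \<open>ps ! 0 = 0\<close>.\<close>
    have "\<exists>i<length ps. m = Suc i \<or> m = ps ! i"
    proof (cases m)
      case 0
      then show ?thesis using v ne unfolding valid_code_def by (metis le_zero_eq length_greater_0_conv)
    qed (use m in auto)
    then obtain i where i: "i < length ps" "m = Suc i \<or> m = ps ! i" by blast
    have pi: "ps ! i \<le> i" using v i unfolding valid_code_def by blast
    have "{xs ! (ps ! i), xs ! Suc i} \<in> edges \<Gamma>" using c i unfolding copies_def by blast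
    moreover have "xs ! (ps ! i) \<in> verts \<Gamma>" "xs ! Suc i \<in> verts \<Gamma>"
      using copies_subset[OF c] l i pi by (simp_all add: subset_iff)
    ultimately have "(xs ! (ps ! i), xs ! Suc i) \<in> ?Bad" using i m by auto
    then show "xs \<in> (\<Union>i\<in>{..<length ps}. \<Union>z\<in>?Bad. {xs \<in> ?F. xs ! (ps ! i) = fst z})"
      using xs i by force
  qed
  then have "card (?F - copies U (edges \<Gamma>) ps) \<le>
      card (\<Union>i\<in>{..<length ps}. \<Union>z\<in>?Bad. {xs \<in> ?F. xs ! (ps ! i) = fst z})"
    by (intro card_mono) (use fF fB in auto)
  also have "\<dots> \<le> (\<Sum>i<length ps. card (\<Union>z\<in>?Bad. {xs \<in> ?F. xs ! (ps ! i) = fst z}))"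
    by (rule card_UN_le) simp
  also have "\<dots> \<le> (\<Sum>i<length ps. \<Sum>z\<in>?Bad. card {xs \<in> ?F. xs ! (ps ! i) = fst z})"
    by (intro sum_mono card_UN_le fB)
  also have "\<dots> \<le> (\<Sum>i<length ps. \<Sum>z\<in>?Bad. ?k ^ (2 * length ps))"
  proof (intro sum_mono)
    fix i z assume "i \<in> {..<length ps}"
    then have i: "i < length ps" "ps ! i \<le> length ps" using v unfolding valid_code_def by force+
    have "card {xs \<in> ?F. xs ! (ps ! i) = fst z} \<le> ?k ^ (length ps + ps ! i)"
      by (rule full_copies_pointed_bound[OF fin v S S[OF i(1)] i(2)])
    also have "\<dots> \<le> ?k ^ (2 * length ps)" using i by (intro power_increasing) auto
    finally show "card {xs \<in> ?F. xs ! (ps ! i) = fst z} \<le> ?k ^ (2 * length ps)" .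
  qed
  also have "\<dots> = length ps * (card ?Bad * ?k ^ (2 * length ps))" by simp
  finally show ?thesis .
qed

section \<open>Balls as full copies\<close>

lemma connected_steps:
  assumes "graph_connected G" "u \<in> verts G" "v \<in> verts G"
  shows "(step G ^^ gdist G u v) u v"
proof -
  have "\<exists>k. (step G ^^ k) u v"
    using assms unfolding connected_iff_reach by (simp add: rtranclp_power)
  then show ?thesis unfolding gdist_eq[OF assms(2)] by (rule LeastI_ex)
qed

lemma gdist_le: "u \<in> verts G \<Longrightarrow> (step G ^^ k) u v \<Longrightarrow> gdist G u v \<le> k"
  unfolding gdist_eq by (rule Least_le)

lemma gdist_self: "u \<in> verts G \<Longrightarrow> gdist G u u = 0"
  using gdist_le[of u G 0 u] by simp

lemma gdist_step:
  assumes "graph_connected G" "u \<in> verts G" "step G v w"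
  shows "gdist G u w \<le> Suc (gdist G u v)"
proof -
  have "(step G ^^ gdist G u v) u v"
    using connected_steps[OF assms(1,2)] assms(3) unfolding step_def by blast
  then have "(step G ^^ Suc (gdist G u v)) u w" using assms(3) by auto
  then show ?thesis by (rule gdist_le[OF assms(2)])
qed

lemma steps_map:
  assumes "\<And>x y. step G x y \<Longrightarrow> step H (g x) (g y)" "(step G ^^ k) u v"
  shows "(step H ^^ k) (g u) (g v)"
  using assms(2)
proof (induction k arbitrary: v)
  case (Suc k)
  then obtain w where "(step G ^^ k) u w" "step G w v" by auto
  then show ?case using Suc.IH assms(1) by auto
qed simp

text \<open>The vertices are listed by increasing distance from the root. A parent is strictly
  nearer, so it comes earlier in the list.\<close>

lemma tree_code_exists:
  assumes T: "finite_rooted_tree T \<rho>"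
  shows "\<exists>ps vs. valid_code ps \<and> vs \<in> copies (verts T) (edges T) ps \<and> set vs = verts T \<and> vs ! 0 = \<rho> \<and>
     code_edges ps vs = edges T \<and>
     (\<forall>i<length ps. gdist T \<rho> (vs ! (ps ! i)) < gdist T \<rho> (vs ! Suc i))"
proof -
  have fin: "finite (verts T)" and gt: "graph_tree T" and \<rho>: "\<rho> \<in> verts T"
    using T unfolding finite_rooted_tree_def by auto
  have con: "graph_connected T" using gt unfolding graph_tree_def by blast
  obtain f where f: "f \<in> forests (verts T) {\<rho>}" "T = tree_of (verts T) \<rho> f"
    "\<forall>y\<in>verts T - {\<rho>}. gdist T \<rho> (f y) < gdist T \<rho> y"
    using tree_parent_function[OF fin gt \<rho>] by blast
  define d where "d = gdist T \<rho>"
  have d0: "y = \<rho>" if "y \<in> verts T" "d y = 0" for y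
    using f(3) that unfolding d_def by (metis DiffI not_less_zero singletonD)
  have d\<rho>: "d \<rho> = 0" unfolding d_def by (rule gdist_self[OF \<rho>])
  obtain ws where ws: "set ws = verts T" "distinct ws" using finite_distinct_list[OF fin] by blast
  define vs where "vs = sort_key d ws"
  have vs: "set vs = verts T" "distinct vs" "sorted (map d vs)" unfolding vs_def using ws by auto
  have mono: "d (vs ! i) \<le> d (vs ! j)" if "i \<le> j" "j < length vs" for i j
    using sorted_nth_mono[OF vs(3), of i j] that by simp
  obtain j where j: "j < length vs" "vs ! j = \<rho>" using \<rho> vs(1) by (metis in_set_conv_nth)
  then have "d (vs ! 0) = 0" using mono[of 0 j] d\<rho> by simp
  moreover have "vs ! 0 \<in> verts T" using j vs(1) by (metis gr_zeroI not_less_zero nth_mem)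
  ultimately have vs0: "vs ! 0 = \<rho>" using d0 by blast
  define m where "m = length vs - 1"
  have lvs: "length vs = Suc m" using j unfolding m_def by simp
  have nr: "vs ! Suc i \<in> verts T - {\<rho>}" if "i < m" for i
    using that lvs vs nth_eq_iff_index_eq[OF vs(2), of "Suc i" 0] vs0 nth_mem[of "Suc i" vs] by auto
  have par: "\<exists>j\<le>i. vs ! j = f (vs ! Suc i)" if i: "i < m" for i
  proof -
    have "f (vs ! Suc i) \<in> set vs" using forests_in[OF f(1)] nr[OF i] vs(1) by blast
    then obtain j where j: "j < length vs" "vs ! j = f (vs ! Suc i)" by (metis in_set_conv_nth)
    have "d (vs ! j) < d (vs ! Suc i)" using f(3) nr[OF i] j unfolding d_def by simp
    then have "\<not> Suc i \<le> j" using mono[of "Suc i" j] j(1) by auto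
    then show ?thesis using j(2) by (intro exI[of _ j]) auto
  qed
  define ps where "ps = map (\<lambda>i. SOME j. j \<le> i \<and> vs ! j = f (vs ! Suc i)) [0..<m]"
  have lps: "length ps = m" unfolding ps_def by simp
  have ps: "ps ! i \<le> i" "vs ! (ps ! i) = f (vs ! Suc i)" if "i < m" for i
    using someI_ex[OF par[OF that, unfolded Bex_def]] that unfolding ps_def by auto
  have "valid_code ps" unfolding valid_code_def lps using ps by blast
  moreover have ce: "code_edges ps vs = edges T"
  proof -
    have "code_edges ps vs = (\<lambda>y. {y, f y}) ` ((\<lambda>i. vs ! Suc i) ` {..<m})"
      unfolding code_edges_def lps image_image by (intro image_cong refl) (simp add: ps insert_commute)
    also have "(\<lambda>i. vs ! Suc i) ` {..<m} = verts T - {\<rho>}"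
    proof
      show "verts T - {\<rho>} \<subseteq> (\<lambda>i. vs ! Suc i) ` {..<m}"
      proof
        fix y assume y: "y \<in> verts T - {\<rho>}"
        then obtain j where j: "j < length vs" "vs ! j = y" using vs(1) by (metis DiffD1 in_set_conv_nth)
        then have "j \<noteq> 0" using vs0 y by (metis DiffD2 singletonI)
        then show "y \<in> (\<lambda>i. vs ! Suc i) ` {..<m}" using j lvs by (cases j) auto
      qed
    qed (use nr in auto)
    also have "(\<lambda>y. {y, f y}) ` (verts T - {\<rho>}) = edges T" by (subst f(2)) (simp add: tree_of_def)
    finally show ?thesis .
  qed
  moreover have "vs \<in> copies (verts T) (edges T) ps"
    using vs lvs lps unfolding copies_def ce[symmetric] code_edges_def by auto
  moreover have "\<forall>i<length ps. gdist T \<rho> (vs ! (ps ! i)) < gdist T \<rho> (vs ! Suc i)"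
    using f(3) nr ps lps by simp
  ultimately show ?thesis using vs vs0 by blast
qed

lemma rooted_isomorphism_compose:
  assumes "rooted_isomorphism f G u H v" "rooted_isomorphism g H v K w"
  shows "rooted_isomorphism (g \<circ> f) G u K w"
proof -
  have bf: "bij_betw f (verts G) (verts H)" and bg: "bij_betw g (verts H) (verts K)"
    using assms unfolding rooted_isomorphism_def by auto
  have "f x \<in> verts H" if "x \<in> verts G" for x using bij_betw_apply[OF bf that] .
  then have "adj G x y \<longleftrightarrow> adj K (g (f x)) (g (f y))" if "x \<in> verts G" "y \<in> verts G" for x y
    using assms that unfolding rooted_isomorphism_def by metis
  then show ?thesis
    using assms bij_betw_trans[OF bf bg] unfolding rooted_isomorphism_def by auto
qed

lemma rooted_isomorphism_inverse:
  assumes f: "rooted_isomorphism f G u H v" and u: "u \<in> verts G"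
  shows "rooted_isomorphism (inv_into (verts G) f) H v G u"
proof -
  let ?g = "inv_into (verts G) f"
  have b: "bij_betw f (verts G) (verts H)" and fu: "f u = v"
    and a: "\<And>x y. x \<in> verts G \<Longrightarrow> y \<in> verts G \<Longrightarrow> adj G x y \<longleftrightarrow> adj H (f x) (f y)"
    using f unfolding rooted_isomorphism_def by auto
  have g: "?g y \<in> verts G" "f (?g y) = y" if "y \<in> verts H" for y
    using that b by (auto simp: bij_betw_def inv_into_into f_inv_into_f)
  have "?g v = u" using b u fu by (metis bij_betw_inv_into_left)
  moreover have "adj H x y \<longleftrightarrow> adj G (?g x) (?g y)" if "x \<in> verts H" "y \<in> verts H" for x y
    using a[OF g(1)[OF that(1)] g(1)[OF that(2)]] g(2) that by simp
  ultimately show ?thesis using bij_betw_inv_into[OF b] unfolding rooted_isomorphism_def by blast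
qed

lemma rooted_isomorphism_cong:
  assumes "\<And>x. x \<in> verts G \<Longrightarrow> f x = g x" "u \<in> verts G" "rooted_isomorphism f G u H v"
  shows "rooted_isomorphism g G u H v"
  using assms bij_betw_cong[of "verts G" f g "verts H"] unfolding rooted_isomorphism_def by auto

text \<open>A ball of radius \<open>r\<close> determines all neighbours of exactly these vertices;
  those at distance \<open>r\<close> may have more outside.\<close>

definition inner_indices :: "'b sgraph \<Rightarrow> 'b \<Rightarrow> nat \<Rightarrow> nat list \<Rightarrow> 'b list \<Rightarrow> nat set" where
  "inner_indices T \<rho> r ps vs = {i. i \<le> length ps \<and> gdist T \<rho> (vs ! i) < r}"

context
  fixes T :: "'b sgraph" and \<rho> :: 'b and r :: nat and ps :: "nat list" and vs :: "'b list" and \<Gamma> :: "'a sgraph"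
  assumes T: "finite_rooted_tree T \<rho>" and r: "rooted_height T \<rho> = r"
    and v: "valid_code ps" and vs: "vs \<in> copies (verts T) (edges T) ps" and set_vs: "set vs = verts T"
    and vs0: "vs ! 0 = \<rho>" and ce: "code_edges ps vs = edges T"
    and fin: "finite (verts \<Gamma>)" and \<Gamma>: "graph_tree \<Gamma>"
begin

lemma T_props: "finite (verts T)" "graph_tree T" "\<rho> \<in> verts T" "graph_connected T" "simple_graph T"
  using T unfolding finite_rooted_tree_def graph_tree_def by auto

lemma \<Gamma>_props: "graph_connected \<Gamma>" "simple_graph \<Gamma>"
  using \<Gamma> unfolding graph_tree_def by auto

lemma length_vs: "length vs = Suc (length ps)"
  by (rule copies_length[OF vs])

lemma distinct_vs: "distinct vs"
  using vs unfolding copies_def by blast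

lemma vs_index: "x \<in> verts T \<Longrightarrow> \<exists>i\<le>length ps. vs ! i = x"
  using set_vs length_vs by (metis in_set_conv_nth less_Suc_eq_le)

lemma vs_nth: "i \<le> length ps \<Longrightarrow> vs ! i \<in> verts T"
  using set_vs length_vs by (metis nth_mem less_Suc_eq_le)

lemma dist_le_r: "x \<in> verts T \<Longrightarrow> gdist T \<rho> x \<le> r"
  unfolding r[symmetric] rooted_height_def using T_props by (intro Max_ge) auto

lemma step_edge: "simple_graph G \<Longrightarrow> {x, y} \<in> edges G \<Longrightarrow> step G x y"
  unfolding simple_graph_def step_def adj_def by auto

lemma code_edges_nth_iff:
  assumes xs: "length xs = Suc (length ps)" "distinct xs" and ij: "i \<le> length ps" "j \<le> length ps"
  shows "{xs ! i, xs ! j} \<in> code_edges ps xs \<longleftrightarrow>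
     (\<exists>m<length ps. (i = ps ! m \<and> j = Suc m) \<or> (j = ps ! m \<and> i = Suc m))"
proof -
  have "ps ! m \<le> length ps" if "m < length ps" for m
    using v that unfolding valid_code_def by (meson less_imp_le order_trans)
  then have "{xs ! i, xs ! j} = {xs ! (ps ! m), xs ! Suc m} \<longleftrightarrow>
      (i = ps ! m \<and> j = Suc m) \<or> (j = ps ! m \<and> i = Suc m)" if "m < length ps" for m
    using that xs ij by (auto simp: doubleton_eq_iff nth_eq_iff_index_eq less_Suc_eq_le)
  then show ?thesis unfolding code_edges_def by auto
qed

lemma adj_copy_iff:
  assumes xs: "xs \<in> copies (verts \<Gamma>) (edges \<Gamma>) ps" and ij: "i \<le> length ps" "j \<le> length ps"
  shows "adj T (vs ! i) (vs ! j) \<longleftrightarrow> adj \<Gamma> (xs ! i) (xs ! j)"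
proof -
  have "adj \<Gamma> (xs ! i) (xs ! j) \<longleftrightarrow> {xs ! i, xs ! j} \<in> code_edges ps xs"
    using tree_induced_edges[OF fin \<Gamma> v xs ij] copies_code_edges[OF xs] unfolding adj_def by blast
  also have "\<dots> \<longleftrightarrow> {vs ! i, vs ! j} \<in> code_edges ps vs"
  proof -
    have d: "length xs = Suc (length ps)" "distinct xs" using xs unfolding copies_def by auto
    show ?thesis unfolding code_edges_nth_iff[OF d ij] code_edges_nth_iff[OF length_vs distinct_vs ij] ..
  qed
  finally show ?thesis unfolding adj_def ce by simp
qed

lemma copy_dist_le:
  assumes xs: "xs \<in> copies (verts \<Gamma>) (edges \<Gamma>) ps" and i: "i \<le> length ps"
  shows "gdist \<Gamma> (xs ! 0) (xs ! i) \<le> gdist T \<rho> (vs ! i)"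
proof -
  define g where "g x = xs ! (THE i. i \<le> length ps \<and> vs ! i = x)" for x
  have g: "g (vs ! i) = xs ! i" if "i \<le> length ps" for i
  proof -
    have "(THE j. j \<le> length ps \<and> vs ! j = vs ! i) = i"
      using that distinct_vs length_vs by (intro the_equality) (auto simp: nth_eq_iff_index_eq)
    then show ?thesis unfolding g_def by simp
  qed
  have xV: "xs ! i \<in> verts \<Gamma>" if "i \<le> length ps" for i
    using that copies_subset[OF xs] copies_length[OF xs] by (simp add: subset_iff)
  have st: "step \<Gamma> (g x) (g y)" if xy: "step T x y" for x y
  proof -
    obtain i j where "i \<le> length ps" "vs ! i = x" "j \<le> length ps" "vs ! j = y"
      using xy vs_index unfolding step_def by metis
    then show ?thesis using xy adj_copy_iff[OF xs] g xV unfolding step_def by metis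
  qed
  have "(step T ^^ gdist T \<rho> (vs ! i)) \<rho> (vs ! i)" by (rule connected_steps[OF T_props(4,3) vs_nth[OF i]])
  from steps_map[of T \<Gamma> g, OF st this] have "(step \<Gamma> ^^ gdist T \<rho> (vs ! i)) (xs ! 0) (xs ! i)"
    using g[OF i] g[of 0] vs0 by simp
  then show ?thesis using gdist_le[OF xV[of 0]] by simp
qed

text \<open>A walk of at most \<open>r\<close> steps from the centre stays in the copy: before its
  last step it is at a vertex whose distance in \<open>T\<close> is below \<open>r\<close>, and all
  neighbours of that vertex belong to the copy. Conversely, a copy cannot increase
  distances.\<close>

lemma full_copy_ball:
  assumes xs: "xs \<in> full_copies \<Gamma> ps (inner_indices T \<rho> r ps vs)"
  shows "{w \<in> verts \<Gamma>. gdist \<Gamma> (xs ! 0) w \<le> r} = set xs"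
proof
  have c: "xs \<in> copies (verts \<Gamma>) (edges \<Gamma>) ps" using xs unfolding full_copies_def by blast
  have l: "length xs = Suc (length ps)" by (rule copies_length[OF c])
  have x0: "xs ! 0 \<in> verts \<Gamma>" using copies_subset[OF c] l by (simp add: subset_iff)
  show "set xs \<subseteq> {w \<in> verts \<Gamma>. gdist \<Gamma> (xs ! 0) w \<le> r}"
  proof
    fix w assume "w \<in> set xs"
    then obtain i where i: "i \<le> length ps" "w = xs ! i" using l by (metis in_set_conv_nth less_Suc_eq_le)
    then have "gdist \<Gamma> (xs ! 0) w \<le> r" using copy_dist_le[OF c i(1)] dist_le_r[OF vs_nth[OF i(1)]] by simp
    then show "w \<in> {w \<in> verts \<Gamma>. gdist \<Gamma> (xs ! 0) w \<le> r}"
      using \<open>w \<in> set xs\<close> copies_subset[OF c] by auto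
  qed
  show "{w \<in> verts \<Gamma>. gdist \<Gamma> (xs ! 0) w \<le> r} \<subseteq> set xs"
  proof
    have reach: "\<exists>i\<le>length ps. w = xs ! i \<and> gdist T \<rho> (vs ! i) \<le> m"
      if "(step \<Gamma> ^^ m) (xs ! 0) w" "m \<le> r" for m w
      using that
    proof (induction m arbitrary: w)
      case 0
      then show ?case using vs0 gdist_self[OF T_props(3)] by (intro exI[of _ 0]) auto
    next
      case (Suc m)
      then obtain w' where w': "(step \<Gamma> ^^ m) (xs ! 0) w'" "step \<Gamma> w' w" by auto
      then obtain i where i: "i \<le> length ps" "w' = xs ! i" "gdist T \<rho> (vs ! i) \<le> m"
        using Suc by auto
      have "i \<in> inner_indices T \<rho> r ps vs" using i Suc.prems unfolding inner_indices_def by simp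
      then have "w \<in> set xs" using xs w'(2) i(2) unfolding full_copies_def step_def adj_def by blast
      then obtain j where j: "j \<le> length ps" "w = xs ! j" using l by (metis in_set_conv_nth less_Suc_eq_le)
      have "adj T (vs ! i) (vs ! j)"
        using adj_copy_iff[OF c i(1) j(1)] w'(2) i j unfolding step_def by simp
      then have "step T (vs ! i) (vs ! j)" using vs_nth i j unfolding step_def by simp
      then have "gdist T \<rho> (vs ! j) \<le> Suc m" using gdist_step[OF T_props(4,3)] i(3) by (meson Suc_le_mono order_trans)
      then show ?case using j by blast
    qed
    fix w assume "w \<in> {w \<in> verts \<Gamma>. gdist \<Gamma> (xs ! 0) w \<le> r}"
    then have w: "w \<in> verts \<Gamma>" "gdist \<Gamma> (xs ! 0) w \<le> r" by auto
    obtain i where "i \<le> length ps" "w = xs ! i"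
      using reach[OF connected_steps[OF \<Gamma>_props(1) x0 w(1)] w(2)] by blast
    then show "w \<in> set xs" using l by simp
  qed
qed

lemma adj_ball:
  assumes "x \<in> verts (graph_ball \<Gamma> u r)" "y \<in> verts (graph_ball \<Gamma> u r)"
  shows "adj (graph_ball \<Gamma> u r) x y \<longleftrightarrow> adj \<Gamma> x y"
  using assms unfolding graph_ball_def induced_subgraph_def adj_def by auto

text \<open>A full copy fills the ball and is induced, so sending \<open>vs\<close> to it is an
  isomorphism. Conversely, under an isomorphism every neighbour of an inner vertex is within
  distance \<open>r\<close> of \<open>u\<close> and hence in the image.\<close>

lemma full_copies_isomorphisms:
  assumes u: "u \<in> verts \<Gamma>"
  shows "{xs \<in> full_copies \<Gamma> ps (inner_indices T \<rho> r ps vs). xs ! 0 = u} =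
     {map g vs |g. rooted_isomorphism g T \<rho> (graph_ball \<Gamma> u r) u}"
proof
  let ?B = "graph_ball \<Gamma> u r"
  show "{xs \<in> full_copies \<Gamma> ps (inner_indices T \<rho> r ps vs). xs ! 0 = u} \<subseteq> {map g vs |g. rooted_isomorphism g T \<rho> ?B u}"
  proof
    fix xs assume "xs \<in> {xs \<in> full_copies \<Gamma> ps (inner_indices T \<rho> r ps vs). xs ! 0 = u}"
    then have xs: "xs \<in> full_copies \<Gamma> ps (inner_indices T \<rho> r ps vs)" and x0: "xs ! 0 = u" by auto
    have c: "xs \<in> copies (verts \<Gamma>) (edges \<Gamma>) ps" using xs unfolding full_copies_def by blast
    have l: "length xs = Suc (length ps)" and d: "distinct xs" using c unfolding copies_def by auto
    have B: "verts ?B = set xs"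
      using full_copy_ball[OF xs] x0 unfolding graph_ball_def induced_subgraph_def by simp
    define g where "g x = xs ! (THE i. i \<le> length ps \<and> vs ! i = x)" for x
    have g: "g (vs ! i) = xs ! i" if "i \<le> length ps" for i
    proof -
      have "(THE j. j \<le> length ps \<and> vs ! j = vs ! i) = i"
        using that distinct_vs length_vs by (intro the_equality) (auto simp: nth_eq_iff_index_eq)
      then show ?thesis unfolding g_def by simp
    qed
    have m: "map g vs = xs"
      using g l length_vs by (intro nth_equalityI) auto
    have "inj_on g (verts T)"
      using d m distinct_map[of g vs] set_vs by simp
    moreover have "g ` verts T = verts ?B" unfolding B m[symmetric] by (simp add: set_vs)
    moreover have "g \<rho> = u" using g[of 0] vs0 x0 by simp
    moreover have "adj T x y \<longleftrightarrow> adj ?B (g x) (g y)" if xy: "x \<in> verts T" "y \<in> verts T" for x y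
    proof -
      obtain i j where ij: "i \<le> length ps" "vs ! i = x" "j \<le> length ps" "vs ! j = y"
        using xy vs_index by metis
      have "adj T x y \<longleftrightarrow> adj \<Gamma> (xs ! i) (xs ! j)" using adj_copy_iff[OF c ij(1,3)] ij by simp
      also have "\<dots> \<longleftrightarrow> adj ?B (xs ! i) (xs ! j)"
        using adj_ball[of "xs ! i" u "xs ! j"] B l ij by simp
      finally show ?thesis using g ij by auto
    qed
    ultimately have "rooted_isomorphism g T \<rho> ?B u"
      unfolding rooted_isomorphism_def bij_betw_def by blast
    then show "xs \<in> {map g vs |g. rooted_isomorphism g T \<rho> ?B u}" using m by blast
  qed
  show "{map g vs |g. rooted_isomorphism g T \<rho> ?B u} \<subseteq> {xs \<in> full_copies \<Gamma> ps (inner_indices T \<rho> r ps vs). xs ! 0 = u}"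
  proof
    fix xs assume "xs \<in> {map g vs |g. rooted_isomorphism g T \<rho> ?B u}"
    then obtain g where g: "xs = map g vs" "rooted_isomorphism g T \<rho> ?B u" by blast
    then have bij: "bij_betw g (verts T) (verts ?B)" and g\<rho>: "g \<rho> = u"
      and ga: "\<And>x y. x \<in> verts T \<Longrightarrow> y \<in> verts T \<Longrightarrow> adj T x y \<longleftrightarrow> adj ?B (g x) (g y)"
      unfolding rooted_isomorphism_def by auto
    have l: "length xs = Suc (length ps)" using g length_vs by simp
    have nth: "xs ! i = g (vs ! i)" if "i \<le> length ps" for i using that g(1) length_vs by simp
    have B: "verts ?B = {w \<in> verts \<Gamma>. gdist \<Gamma> u w \<le> r}"
      unfolding graph_ball_def induced_subgraph_def by simp
    have sx: "set xs = verts ?B" using g(1) set_vs bij unfolding bij_betw_def by simp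
    have gV: "g x \<in> verts ?B" if "x \<in> verts T" for x using that bij by (rule bij_betw_apply[rotated])
    have "distinct xs" unfolding g(1) distinct_map using distinct_vs bij set_vs unfolding bij_betw_def by simp
    moreover have "{xs ! (ps ! i), xs ! Suc i} \<in> edges \<Gamma>" if i: "i < length ps" for i
    proof -
      have pi: "ps ! i \<le> length ps" using v i unfolding valid_code_def by (meson less_imp_le order_trans)
      have "adj T (vs ! (ps ! i)) (vs ! Suc i)" using vs i unfolding copies_def adj_def by blast
      then have "adj ?B (xs ! (ps ! i)) (xs ! Suc i)"
        using ga vs_nth[OF pi] vs_nth[of "Suc i"] i nth pi by simp
      then show ?thesis unfolding graph_ball_def induced_subgraph_def adj_def by simp
    qed
    ultimately have c: "xs \<in> copies (verts \<Gamma>) (edges \<Gamma>) ps" using l sx B unfolding copies_def by auto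
    have x0: "xs ! 0 = u" using nth[of 0] vs0 g\<rho> by simp
    have "w \<in> set xs" if i: "i \<in> inner_indices T \<rho> r ps vs" and w: "w \<in> verts \<Gamma>" "{xs ! i, w} \<in> edges \<Gamma>" for i w
    proof -
      have i': "i \<le> length ps" "gdist T \<rho> (vs ! i) < r" using i unfolding inner_indices_def by auto
      have "gdist \<Gamma> u (xs ! i) < r" using copy_dist_le[OF c i'(1)] i'(2) x0 by simp
      moreover have "step \<Gamma> (xs ! i) w" by (rule step_edge[OF \<Gamma>_props(2) w(2)])
      ultimately have "gdist \<Gamma> u w \<le> r" using gdist_step[OF \<Gamma>_props(1) u, of "xs ! i" w] by simp
      then show ?thesis using w(1) sx B by simp
    qed
    then show "xs \<in> {xs \<in> full_copies \<Gamma> ps (inner_indices T \<rho> r ps vs). xs ! 0 = u}"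
      using c x0 unfolding full_copies_def by simp
  qed
qed

text \<open>Two isomorphisms onto \<open>H\<close> differ by a root-preserving automorphism of
  \<open>T\<close>, so composing \<open>g0\<close> with the stabilizer gives all of them. The lists
  record only the values on \<open>verts T\<close>.\<close>

lemma card_isomorphism_lists:
  assumes iso: "rooted_isomorphism g0 T \<rho> H u"
  shows "card {map g vs |g. rooted_isomorphism g T \<rho> H u} = card (rooted_stab T \<rho>)"
proof -
  let ?L = "{map g vs |g. rooted_isomorphism g T \<rho> H u}"
  have inj0: "inj_on g0 (verts T)" using iso unfolding rooted_isomorphism_def bij_betw_def by blast
  have "bij_betw (\<lambda>\<sigma>. map (g0 \<circ> \<sigma>) vs) (rooted_stab T \<rho>) ?L"
    unfolding bij_betw_def
  proof
    show "inj_on (\<lambda>\<sigma>. map (g0 \<circ> \<sigma>) vs) (rooted_stab T \<rho>)"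
    proof (rule inj_onI)
      fix \<sigma> \<tau> assume st: "\<sigma> \<in> rooted_stab T \<rho>" "\<tau> \<in> rooted_stab T \<rho>" "map (g0 \<circ> \<sigma>) vs = map (g0 \<circ> \<tau>) vs"
      then have p: "\<sigma> permutes verts T" "\<tau> permutes verts T" unfolding rooted_stab_def by auto
      show "\<sigma> = \<tau>"
      proof
        fix x show "\<sigma> x = \<tau> x"
        proof (cases "x \<in> verts T")
          case True
          then have "g0 (\<sigma> x) = g0 (\<tau> x)" using st(3) set_vs by auto
          then show ?thesis using inj0 p True by (metis inj_onD permutes_in_image)
        next
          case False
          then show ?thesis using p by (metis permutes_not_in)
        qed
      qed
    qed
    show "(\<lambda>\<sigma>. map (g0 \<circ> \<sigma>) vs) ` rooted_stab T \<rho> = ?L"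
    proof
      show "(\<lambda>\<sigma>. map (g0 \<circ> \<sigma>) vs) ` rooted_stab T \<rho> \<subseteq> ?L"
      proof (rule image_subsetI)
        fix \<sigma> assume "\<sigma> \<in> rooted_stab T \<rho>"
        then have s: "rooted_isomorphism \<sigma> T \<rho> T \<rho>" unfolding rooted_stab_def by simp
        show "map (g0 \<circ> \<sigma>) vs \<in> ?L" using rooted_isomorphism_compose[OF s iso] by blast
      qed
      show "?L \<subseteq> (\<lambda>\<sigma>. map (g0 \<circ> \<sigma>) vs) ` rooted_stab T \<rho>"
      proof
        fix xs assume "xs \<in> ?L"
        then obtain g where g: "xs = map g vs" "rooted_isomorphism g T \<rho> H u" by blast
        let ?h = "inv_into (verts T) g0 \<circ> g"
        define \<sigma> where "\<sigma> x = (if x \<in> verts T then ?h x else x)" for x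
        have "rooted_isomorphism ?h T \<rho> T \<rho>"
          by (rule rooted_isomorphism_compose[OF g(2) rooted_isomorphism_inverse[OF iso T_props(3)]])
        then have i\<sigma>: "rooted_isomorphism \<sigma> T \<rho> T \<rho>"
          by (rule rooted_isomorphism_cong[rotated 2]) (use T_props in \<open>auto simp: \<sigma>_def\<close>)
        then have "bij_betw \<sigma> (verts T) (verts T)" unfolding rooted_isomorphism_def by blast
        then have "\<sigma> permutes verts T" by (rule bij_imp_permutes) (simp add: \<sigma>_def)
        then have "\<sigma> \<in> rooted_stab T \<rho>" using i\<sigma> unfolding rooted_stab_def by blast
        moreover have "map (g0 \<circ> \<sigma>) vs = xs"
        proof -
          have "g0 (\<sigma> x) = g x" if x: "x \<in> verts T" for x
          proof -
            have "g x \<in> g0 ` verts T"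
              using x g(2) iso unfolding rooted_isomorphism_def bij_betw_def by blast
            then show ?thesis using x unfolding \<sigma>_def by (simp add: f_inv_into_f)
          qed
          then show ?thesis unfolding g(1) using set_vs by simp
        qed
        ultimately show "xs \<in> (\<lambda>\<sigma>. map (g0 \<circ> \<sigma>) vs) ` rooted_stab T \<rho>" by blast
      qed
    qed
  qed
  then show ?thesis by (rule bij_betw_same_card[symmetric])
qed

lemma card_full_copies: "card (full_copies \<Gamma> ps (inner_indices T \<rho> r ps vs)) = ball_count \<Gamma> r T \<rho> * card (rooted_stab T \<rho>)"
proof -
  let ?F = "full_copies \<Gamma> ps (inner_indices T \<rho> r ps vs)"
  let ?iso = "\<lambda>u. rooted_isomorphic (graph_ball \<Gamma> u r) u T \<rho>"
  have fF: "finite ?F" by (rule finite_full_copies[OF fin])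
  have root: "xs ! 0 \<in> verts \<Gamma>" if "xs \<in> ?F" for xs
    using that copies_subset copies_length unfolding full_copies_def
    by (metis (no_types, lifting) mem_Collect_eq nth_mem subsetD zero_less_Suc)
  have each: "card {xs \<in> ?F. xs ! 0 = u} = (if ?iso u then card (rooted_stab T \<rho>) else 0)" if u: "u \<in> verts \<Gamma>" for u
  proof (cases "\<exists>g. rooted_isomorphism g T \<rho> (graph_ball \<Gamma> u r) u")
    case True
    then obtain g where g: "rooted_isomorphism g T \<rho> (graph_ball \<Gamma> u r) u" by blast
    have "?iso u" using rooted_isomorphism_inverse[OF g T_props(3)] unfolding rooted_isomorphic_def by blast
    then show ?thesis using card_isomorphism_lists[OF g] full_copies_isomorphisms[OF u] by simp
  next
    case False
    have ub: "u \<in> verts (graph_ball \<Gamma> u r)"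
      using u gdist_self[OF u] unfolding graph_ball_def induced_subgraph_def by simp
    have "\<not> ?iso u"
    proof
      assume "?iso u"
      then obtain f where f: "rooted_isomorphism f (graph_ball \<Gamma> u r) u T \<rho>" unfolding rooted_isomorphic_def by blast
      show False using False rooted_isomorphism_inverse[OF f ub] by blast
    qed
    moreover have "{xs \<in> ?F. xs ! 0 = u} = {}" using False full_copies_isomorphisms[OF u] by auto
    ultimately show ?thesis by (simp only: card.empty if_False)
  qed
  have "card ?F = (\<Sum>xs\<in>?F. 1)" by simp
  also have "\<dots> = (\<Sum>u\<in>verts \<Gamma>. \<Sum>xs\<in>{xs \<in> ?F. xs ! 0 = u}. 1)"
    by (rule sum.group[symmetric]) (use fF fin root in auto)
  also have "\<dots> = (\<Sum>u\<in>verts \<Gamma>. if ?iso u then card (rooted_stab T \<rho>) else 0)"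
    by (intro sum.cong refl) (simp only: each card_eq_sum[symmetric])
  also have "\<dots> = ball_count \<Gamma> r T \<rho> * card (rooted_stab T \<rho>)"
    unfolding ball_count_def using fin by (simp add: sum.inter_filter[symmetric])
  finally show ?thesis .
qed

end

section \<open>Concentration of the ball count\<close>

text \<open>The summand \<open>k\<close> gives the exponential series, and the summand
  \<open>j\<close> gives the same series shifted by one index and multiplied by
  \<open>- s\<close>.\<close>

lemma weighted_exp_series:
  fixes s k :: real
  shows "(\<lambda>j. (-1) ^ j / fact j * (s ^ j * (k + real j))) sums ((k - s) * exp (- s))"
proof -
  have e: "(\<lambda>j. (- s) ^ j / fact j) sums exp (- s)"
    using exp_converges[of "- s"] by (simp add: scaleR_conv_of_real divide_inverse mult.commute)
  have "(\<lambda>j. real (Suc j) * ((- s) ^ Suc j / fact (Suc j))) sums (- s * exp (- s))"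
  proof -
    have "real (Suc j) * ((- s) ^ Suc j / fact (Suc j)) = - s * ((- s) ^ j / fact j)" for j
    proof -
      have "fact (Suc j) = real (Suc j) * fact j" by (simp only: fact_Suc)
      then show ?thesis by (simp del: fact_Suc of_nat_Suc)
    qed
    then show ?thesis using sums_mult[OF e, of "- s"] by (simp only:)
  qed
  then have "(\<lambda>j. real j * ((- s) ^ j / fact j)) sums (- s * exp (- s))"
    using sums_Suc_iff[of "\<lambda>j. real j * ((- s) ^ j / fact j)" "- s * exp (- s)"] by simp
  from sums_add[OF sums_mult[OF e, of k] this]
  have "(\<lambda>j. k * ((- s) ^ j / fact j) + real j * ((- s) ^ j / fact j)) sums (k * exp (- s) + - s * exp (- s))" .
  moreover have "k * ((- s) ^ j / fact j) + real j * ((- s) ^ j / fact j) =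
      (-1) ^ j / fact j * (s ^ j * (k + real j))" for j
    by (simp add: power_minus[of s] algebra_simps add_divide_distrib)
  ultimately show ?thesis by (simp add: algebra_simps)
qed

context good_set
begin

text \<open>Only neighbours in \<open>U\<close> are excluded, since limits are available for copies
  inside \<open>U\<close>; \<open>leaving\<close> and \<open>outer_pairs\<close> measure the
  difference to \<open>full_copies\<close>.\<close>

definition closed_count :: "nat list \<Rightarrow> nat set \<Rightarrow> 'a sgraph \<Rightarrow> real" where
  "closed_count ps A \<Gamma> = real (card {xs \<in> copies U (edges \<Gamma>) ps. extras U (edges \<Gamma>) A xs = {}})"

text \<open>The three terms are the fluctuation of the counts with up to \<open>m\<close> attached
  leaves, the Bonferroni remainder, which enters only through its mean, and the truncation of the
  exponential series.\<close>

lemma closed_count_deviation: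
  assumes v: "valid_code ps" and A: "A \<subseteq> {..length ps}"
  defines "k \<equiv> real (Suc (length ps))" and "s \<equiv> real (card A)"
  shows "avg (\<lambda>\<Gamma>. \<bar>closed_count ps A \<Gamma> / N - c\<bar>) \<le>
     (\<Sum>j\<le>m. 1 / fact j * (\<Sum>is\<in>index_lists A j. avg (\<lambda>\<Gamma>. \<bar>tree_copies (ps @ is) \<Gamma> / N - (k + real j)\<bar>))) +
     (\<Sum>is\<in>index_lists A (Suc m). mean_copies (ps @ is) / N) / fact (Suc m) +
     \<bar>(\<Sum>j\<le>m. (-1) ^ j / fact j * (s ^ j * (k + real j))) - c\<bar>"
    (is "_ \<le> ?R")
proof -
  have finA: "finite A" using A finite_subset by blast
  let ?cm = "\<Sum>j\<le>m. (-1) ^ j / fact j * (s ^ j * (k + real j))"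
  let ?dev = "\<lambda>j \<Gamma>. \<Sum>is\<in>index_lists A j. \<bar>tree_copies (ps @ is) \<Gamma> / N - (k + real j)\<bar>"
  let ?tail = "\<lambda>\<Gamma>. \<Sum>is\<in>index_lists A (Suc m). tree_copies (ps @ is) \<Gamma>"
  have pointwise: "\<bar>closed_count ps A \<Gamma> / N - c\<bar> \<le>
      (\<Sum>j\<le>m. 1 / fact j * ?dev j \<Gamma>) + ((1 / (fact (Suc m) * N)) * ?tail \<Gamma> + \<bar>?cm - c\<bar>)"
    if \<Gamma>: "\<Gamma> \<in> spanning_trees G" for \<Gamma>
  proof -
    let ?Z = "\<Sum>j\<le>m. (-1) ^ j / fact j * (\<Sum>is\<in>index_lists A j. tree_copies (ps @ is) \<Gamma>)"
    have "\<bar>closed_count ps A \<Gamma> - ?Z\<bar> \<le> ?tail \<Gamma> / fact (Suc m)"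
      unfolding closed_count_def tree_copies_def
      by (rule bonferroni_copies) (use ST_props[OF \<Gamma>] fin v U A in auto)
    then have "\<bar>closed_count ps A \<Gamma> - ?Z\<bar> / N \<le> ?tail \<Gamma> / fact (Suc m) / N"
      by (rule divide_right_mono) simp
    then have 1: "\<bar>closed_count ps A \<Gamma> / N - ?Z / N\<bar> \<le> (1 / (fact (Suc m) * N)) * ?tail \<Gamma>"
      using N_pos by (simp add: diff_divide_distrib[symmetric] abs_divide)
    have "?Z / N - ?cm = (\<Sum>j\<le>m. (-1) ^ j / fact j * (\<Sum>is\<in>index_lists A j. tree_copies (ps @ is) \<Gamma> / N - (k + real j)))"
      unfolding sum_divide_distrib sum_subtractf[symmetric]
    proof (rule sum.cong[OF refl])
      fix j
      have "(\<Sum>is\<in>index_lists A j. tree_copies (ps @ is) \<Gamma> / N - (k + real j)) =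
          (\<Sum>is\<in>index_lists A j. tree_copies (ps @ is) \<Gamma>) / N - s ^ j * (k + real j)"
        by (simp add: sum_subtractf sum_divide_distrib card_index_lists[OF finA] s_def)
      then show "(-1) ^ j / fact j * (\<Sum>is\<in>index_lists A j. tree_copies (ps @ is) \<Gamma>) / N -
          (-1) ^ j / fact j * (s ^ j * (k + real j)) =
        (-1) ^ j / fact j * (\<Sum>is\<in>index_lists A j. tree_copies (ps @ is) \<Gamma> / N - (k + real j))"
        by (simp only: right_diff_distrib times_divide_eq_right)
    qed
    also have "\<bar>\<dots>\<bar> \<le> (\<Sum>j\<le>m. 1 / fact j * ?dev j \<Gamma>)"
    proof (rule order_trans[OF sum_abs], rule sum_mono)
      fix j
      have "\<bar>(-1) ^ j / fact j * (\<Sum>is\<in>index_lists A j. tree_copies (ps @ is) \<Gamma> / N - (k + real j))\<bar> =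
          1 / fact j * \<bar>\<Sum>is\<in>index_lists A j. tree_copies (ps @ is) \<Gamma> / N - (k + real j)\<bar>"
        by (simp add: abs_mult)
      also have "\<dots> \<le> 1 / fact j * ?dev j \<Gamma>" by (intro mult_left_mono sum_abs) simp
      finally show "\<bar>(-1) ^ j / fact j * (\<Sum>is\<in>index_lists A j. tree_copies (ps @ is) \<Gamma> / N - (k + real j))\<bar> \<le> \<dots>" .
    qed
    finally have 2: "\<bar>?Z / N - ?cm\<bar> \<le> (\<Sum>j\<le>m. 1 / fact j * ?dev j \<Gamma>)" .
    show ?thesis using 1 2 by linarith
  qed
  have "avg (\<lambda>\<Gamma>. \<bar>closed_count ps A \<Gamma> / N - c\<bar>) \<le>
      avg (\<lambda>\<Gamma>. (\<Sum>j\<le>m. 1 / fact j * ?dev j \<Gamma>) + ((1 / (fact (Suc m) * N)) * ?tail \<Gamma> + \<bar>?cm - c\<bar>))"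
    by (rule avg_mono) (rule pointwise)
  also have "\<dots> = (\<Sum>j\<le>m. 1 / fact j * (\<Sum>is\<in>index_lists A j. avg (\<lambda>\<Gamma>. \<bar>tree_copies (ps @ is) \<Gamma> / N - (k + real j)\<bar>))) +
      ((1 / (fact (Suc m) * N)) * (\<Sum>is\<in>index_lists A (Suc m). avg (tree_copies (ps @ is))) + \<bar>?cm - c\<bar>)"
    unfolding avg_add avg_sum avg_cmult avg_const ..
  also have "(\<Sum>is\<in>index_lists A (Suc m). avg (tree_copies (ps @ is))) = (\<Sum>is\<in>index_lists A (Suc m). mean_copies (ps @ is))"
    by (intro sum.cong refl avg_tree_copies valid_code_append[OF v A])
  also have "(1 / (fact (Suc m) * N)) * \<dots> = (\<Sum>is\<in>index_lists A (Suc m). mean_copies (ps @ is) / N) / fact (Suc m)"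
    by (simp add: sum_divide_distrib[symmetric] mult.commute)
  finally show ?thesis by simp
qed

definition leaving :: "nat list \<Rightarrow> nat \<Rightarrow> 'a sgraph \<Rightarrow> ('a list \<times> 'a) set" where
  "leaving ps i \<Gamma> = {(xs, w). xs \<in> copies U (edges \<Gamma>) ps \<and> w \<in> V - U \<and> {xs ! i, w} \<in> edges \<Gamma>}"

text \<open>Attached leaves outside \<open>U\<close> are all attached leaves minus those inside
  \<open>U\<close>. Both means have the same limit after division by \<open>N\<close>, so this
  quantity is negligible.\<close>

lemma avg_leaving:
  assumes v: "valid_code ps" and i: "i \<le> length ps"
  shows "avg (\<lambda>\<Gamma>. real (card (leaving ps i \<Gamma>))) = mean_extensions ps i - mean_copies (ps @ [i])"
proof -
  let ?Z = "SIGMA xs:copies U E ps. {w. w \<in> V - U \<and> {xs ! i, w} \<in> E}"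
  let ?A = "\<lambda>z. code_edges (ps @ [i]) (fst z @ [snd z])"
  have fZ: "finite ?Z" by (intro finite_SigmaI) (auto simp: finite_copies finU fin)
  have vi: "valid_code (ps @ [i])" using v i by simp
  have "avg (\<lambda>\<Gamma>. real (card (leaving ps i \<Gamma>))) = avg (\<lambda>\<Gamma>. real (card {z \<in> ?Z. ?A z \<subseteq> edges \<Gamma>}))"
  proof (rule avg_cong)
    fix \<Gamma> assume \<Gamma>: "\<Gamma> \<in> spanning_trees G"
    have ce: "code_edges (ps @ [i]) (xs @ [w]) = insert {xs ! i, w} (code_edges ps xs)"
      if "xs \<in> copies U E ps" for xs w
      by (rule code_edges_snoc[OF v i copies_length[OF that]])
    have "leaving ps i \<Gamma> = {z \<in> ?Z. ?A z \<subseteq> edges \<Gamma>}"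
      unfolding leaving_def copies_iff_code_edges[OF ST_props(2)[OF \<Gamma>]]
      using ST_props(2)[OF \<Gamma>] by (auto simp: ce)
    then show "real (card (leaving ps i \<Gamma>)) = real (card {z \<in> ?Z. ?A z \<subseteq> edges \<Gamma>})" by simp
  qed
  also have "\<dots> = (\<Sum>z\<in>?Z. tree_prob (?A z))" by (rule avg_card[OF fZ])
  also have "\<dots> = (\<Sum>z\<in>?Z. forest_ratio (insert (snd z) (set (fst z))))"
  proof (rule sum.cong[OF refl])
    fix z assume "z \<in> ?Z"
    then obtain xs w where z: "z = (xs, w)" "xs \<in> copies U E ps" "w \<in> V" "w \<notin> U" "{xs ! i, w} \<in> E" by auto
    have "xs \<in> copies V E ps" "w \<notin> set xs"
      using copies_mono[OF U order_refl] z copies_subset[OF z(2)] by auto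
    then have "xs @ [w] \<in> copies V E (ps @ [i])" unfolding copies_snoc_iff[OF v i] using z by simp
    from tree_prob_copy[OF vi this] show "tree_prob (?A z) = forest_ratio (insert (snd z) (set (fst z)))" using z by simp
  qed
  also have "\<dots> = (\<Sum>xs\<in>copies U E ps. \<Sum>w | w \<in> V - U \<and> {xs ! i, w} \<in> E. forest_ratio (insert w (set xs)))"
    by (subst sum.Sigma) (auto simp: finite_copies finU fin case_prod_beta)
  also have "\<dots> = (\<Sum>xs\<in>copies U E ps. (\<Sum>w | w \<in> V - set xs \<and> {xs ! i, w} \<in> E. forest_ratio (insert w (set xs))) -
      (\<Sum>w | w \<in> U - set xs \<and> {xs ! i, w} \<in> E. forest_ratio (insert w (set xs))))"
  proof (rule sum.cong[OF refl])
    fix xs assume xs: "xs \<in> copies U E ps"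
    have "{w. w \<in> V - set xs \<and> {xs ! i, w} \<in> E} =
        {w. w \<in> V - U \<and> {xs ! i, w} \<in> E} \<union> {w. w \<in> U - set xs \<and> {xs ! i, w} \<in> E}"
      using copies_subset[OF xs] U by auto
    then have "(\<Sum>w | w \<in> V - set xs \<and> {xs ! i, w} \<in> E. forest_ratio (insert w (set xs))) =
       (\<Sum>w | w \<in> V - U \<and> {xs ! i, w} \<in> E. forest_ratio (insert w (set xs))) +
       (\<Sum>w | w \<in> U - set xs \<and> {xs ! i, w} \<in> E. forest_ratio (insert w (set xs)))"
      by (simp only:) (rule sum.union_disjoint, auto simp: fin finU)
    then show "(\<Sum>w | w \<in> V - U \<and> {xs ! i, w} \<in> E. forest_ratio (insert w (set xs))) =
       (\<Sum>w | w \<in> V - set xs \<and> {xs ! i, w} \<in> E. forest_ratio (insert w (set xs))) -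
      (\<Sum>w | w \<in> U - set xs \<and> {xs ! i, w} \<in> E. forest_ratio (insert w (set xs)))" by simp
  qed
  also have "\<dots> = mean_extensions ps i - mean_copies (ps @ [i])"
    unfolding mean_extensions_def mean_copies_def sum_copies_snoc[OF v i finU] by (simp add: sum_subtractf)
  finally show ?thesis .
qed

lemma finite_leaving: "finite (leaving ps i \<Gamma>)"
  unfolding leaving_def
  by (rule finite_subset[of _ "copies U (edges \<Gamma>) ps \<times> V"]) (auto simp: finite_copies finU fin)

definition outer_pairs :: "'a sgraph \<Rightarrow> ('a \<times> 'a) set" where
  "outer_pairs \<Gamma> = {(a, b). a \<in> V \<and> b \<in> V \<and> {a, b} \<in> edges \<Gamma> \<and> \<not> (a \<in> U \<and> b \<in> U)}"

text \<open>The total number of tree edges is fixed, and those inside \<open>U\<close> are the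
  copies of the one-edge tree, whose mean is about \<open>2 * N\<close> in ordered pairs.\<close>

lemma avg_outer_pairs: "avg (\<lambda>\<Gamma>. real (card (outer_pairs \<Gamma>))) = 2 * (N - 1) - mean_copies [0]"
proof -
  have "real (card (outer_pairs \<Gamma>)) = 2 * (N - 1) + (-1) * tree_copies [0] \<Gamma>" if \<Gamma>: "\<Gamma> \<in> spanning_trees G" for \<Gamma>
  proof -
    let ?all = "{(a, b). a \<in> V \<and> b \<in> V \<and> {a, b} \<in> edges \<Gamma>}"
    let ?in = "{(a, b). a \<in> U \<and> b \<in> U \<and> {a, b} \<in> edges \<Gamma>}"
    have "?all = outer_pairs \<Gamma> \<union> ?in" "outer_pairs \<Gamma> \<inter> ?in = {}" using U unfolding outer_pairs_def by auto
    moreover have "finite ?all" by (rule finite_subset[of _ "V \<times> V"]) (auto simp: fin)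
    ultimately have "card ?all = card (outer_pairs \<Gamma>) + card ?in" by (simp add: card_Un_disjoint)
    moreover have "card ?in = card (copies U (edges \<Gamma>) [0])"
    proof (rule bij_betw_same_card[of "\<lambda>(a, b). [a, b]"])
      have "a \<noteq> b" if "{a, b} \<in> edges \<Gamma>" for a b using that ST_props(2)[OF \<Gamma>] edge_props by blast
      then show "bij_betw (\<lambda>(a, b). [a, b]) ?in (copies U (edges \<Gamma>) [0])"
        unfolding bij_betw_def copies_def
        by (auto simp: inj_on_def length_Suc_conv image_iff)
    qed
    moreover have "card ?all = 2 * (card V - 1)" by (rule tree_edges_card[OF \<Gamma>])
    ultimately show ?thesis unfolding tree_copies_def using N_pos by (simp add: of_nat_diff)
  qed
  then have "avg (\<lambda>\<Gamma>. real (card (outer_pairs \<Gamma>))) = avg (\<lambda>\<Gamma>. 2 * (N - 1) + (-1) * tree_copies [0] \<Gamma>)"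
    by (rule avg_cong)
  also have "\<dots> = 2 * (N - 1) - mean_copies [0]"
    unfolding avg_add avg_cmult avg_const using avg_tree_copies[of "[0]"] by (simp add: valid_code_def)
  finally show ?thesis .
qed

text \<open>A closed copy in \<open>U\<close> that is not full has a tree neighbour outside
  \<open>U\<close>, counted by \<open>leaving\<close>. A full copy that is not a closed copy leaves
  \<open>U\<close>, and \<open>full_copies_leaving_bound\<close> charges it to an outer
  pair.\<close>

lemma full_copies_deviation:
  assumes v: "valid_code ps" and A: "A \<subseteq> {..length ps}" and ne: "ps \<noteq> []"
    and par: "\<And>i. i < length ps \<Longrightarrow> ps ! i \<in> A"
  shows "avg (\<lambda>\<Gamma>. \<bar>real (card (full_copies \<Gamma> ps A)) / N - c\<bar>) \<le>
     avg (\<lambda>\<Gamma>. \<bar>closed_count ps A \<Gamma> / N - c\<bar>) + (\<Sum>i\<in>A. mean_extensions ps i / N - mean_copies (ps @ [i]) / N) +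
     real (length ps * Suc (length ps) ^ (2 * length ps)) * ((2 * (N - 1) - mean_copies [0]) / N)"
proof -
  let ?M = "real (length ps * Suc (length ps) ^ (2 * length ps))"
  have finA: "finite A" using A finite_subset by blast
  have pointwise: "\<bar>real (card (full_copies \<Gamma> ps A)) / N - c\<bar> \<le> \<bar>closed_count ps A \<Gamma> / N - c\<bar> +
      ((1 / N) * (\<Sum>i\<in>A. real (card (leaving ps i \<Gamma>))) + (?M / N) * real (card (outer_pairs \<Gamma>)))"
    if \<Gamma>: "\<Gamma> \<in> spanning_trees G" for \<Gamma>
  proof -
    let ?F = "full_copies \<Gamma> ps A" and ?C = "copies U (edges \<Gamma>) ps"
    let ?W = "{xs \<in> ?C. extras U (edges \<Gamma>) A xs = {}}"
    have vG: "verts \<Gamma> = V" by (rule ST_props(1)[OF \<Gamma>])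
    have fF: "finite ?F" using finite_full_copies[of \<Gamma>] vG fin by simp
    have fW: "finite ?W" by (simp add: finite_copies finU)
    have "card (?F - ?W) \<le> card (?F - ?C)"
    proof (rule card_mono)
      show "?F - ?W \<subseteq> ?F - ?C"
        using U unfolding full_copies_def extras_def vG by auto
    qed (use fF in simp)
    also have "\<dots> \<le> length ps * (card (outer_pairs \<Gamma>) * Suc (length ps) ^ (2 * length ps))"
      unfolding outer_pairs_def vG[symmetric]
      by (rule full_copies_leaving_bound) (use v par ne fin vG in auto)
    finally have 1: "real (card (?F - ?W)) \<le> ?M * real (card (outer_pairs \<Gamma>))"
      by (metis (no_types, lifting) mult.assoc mult.commute of_nat_le_iff of_nat_mult)
    have "?W - ?F \<subseteq> (\<Union>i\<in>A. fst ` leaving ps i \<Gamma>)"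
    proof
      fix xs assume xs: "xs \<in> ?W - ?F"
      then have "xs \<in> copies V (edges \<Gamma>) ps" using copies_mono[OF U order_refl] by blast
      then obtain i w where iw: "i \<in> A" "w \<in> V" "{xs ! i, w} \<in> edges \<Gamma>" "w \<notin> set xs"
        using xs unfolding full_copies_def vG by auto
      then have "w \<notin> U" using xs unfolding extras_def by auto
      then have "(xs, w) \<in> leaving ps i \<Gamma>" using xs iw unfolding leaving_def by auto
      then show "xs \<in> (\<Union>i\<in>A. fst ` leaving ps i \<Gamma>)" using iw by force
    qed
    then have "card (?W - ?F) \<le> card (\<Union>i\<in>A. fst ` leaving ps i \<Gamma>)"
      by (intro card_mono) (use finA finite_leaving in auto)
    also have "\<dots> \<le> (\<Sum>i\<in>A. card (fst ` leaving ps i \<Gamma>))" by (rule card_UN_le[OF finA])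
    also have "\<dots> \<le> (\<Sum>i\<in>A. card (leaving ps i \<Gamma>))"
      by (intro sum_mono card_image_le finite_leaving)
    finally have "real (card (?W - ?F)) \<le> real (\<Sum>i\<in>A. card (leaving ps i \<Gamma>))" by (rule of_nat_mono)
    then have 2: "real (card (?W - ?F)) \<le> (\<Sum>i\<in>A. real (card (leaving ps i \<Gamma>)))" by simp
    have "card ?F = card (?F \<inter> ?W) + card (?F - ?W)" "card ?W = card (?F \<inter> ?W) + card (?W - ?F)"
      using card_Int_Diff[OF fF, of ?W] card_Int_Diff[OF fW, of ?F] by (simp_all add: Int_commute)
    then have "\<bar>real (card ?F) - closed_count ps A \<Gamma>\<bar> \<le> real (card (?W - ?F)) + real (card (?F - ?W))"
      unfolding closed_count_def by linarith
    also have "\<dots> \<le> (\<Sum>i\<in>A. real (card (leaving ps i \<Gamma>))) + ?M * real (card (outer_pairs \<Gamma>))"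
      using 1 2 by linarith
    finally have "\<bar>real (card ?F) - closed_count ps A \<Gamma>\<bar> / N \<le>
        ((\<Sum>i\<in>A. real (card (leaving ps i \<Gamma>))) + ?M * real (card (outer_pairs \<Gamma>))) / N"
      by (rule divide_right_mono) simp
    also have "\<dots> = (1 / N) * (\<Sum>i\<in>A. real (card (leaving ps i \<Gamma>))) + (?M / N) * real (card (outer_pairs \<Gamma>))"
      by (simp add: add_divide_distrib)
    also have "\<bar>real (card ?F) - closed_count ps A \<Gamma>\<bar> / N = \<bar>real (card ?F) / N - closed_count ps A \<Gamma> / N\<bar>"
      by (simp add: diff_divide_distrib[symmetric] abs_divide)
    finally show ?thesis by linarith
  qed
  have "avg (\<lambda>\<Gamma>. \<bar>real (card (full_copies \<Gamma> ps A)) / N - c\<bar>) \<le>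
      avg (\<lambda>\<Gamma>. \<bar>closed_count ps A \<Gamma> / N - c\<bar> +
      ((1 / N) * (\<Sum>i\<in>A. real (card (leaving ps i \<Gamma>))) + (?M / N) * real (card (outer_pairs \<Gamma>))))"
    by (rule avg_mono) (rule pointwise)
  also have "\<dots> = avg (\<lambda>\<Gamma>. \<bar>closed_count ps A \<Gamma> / N - c\<bar>) +
      ((1 / N) * (\<Sum>i\<in>A. avg (\<lambda>\<Gamma>. real (card (leaving ps i \<Gamma>)))) + (?M / N) * (2 * (N - 1) - mean_copies [0]))"
    unfolding avg_add avg_sum avg_cmult avg_outer_pairs ..
  also have "(\<Sum>i\<in>A. avg (\<lambda>\<Gamma>. real (card (leaving ps i \<Gamma>)))) = (\<Sum>i\<in>A. mean_extensions ps i - mean_copies (ps @ [i]))"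
    using A by (intro sum.cong refl avg_leaving[OF v]) auto
  also have "(1 / N) * \<dots> = (\<Sum>i\<in>A. mean_extensions ps i / N - mean_copies (ps @ [i]) / N)"
    by (simp add: sum_distrib_left diff_divide_distrib)
  finally show ?thesis by simp
qed

end

section \<open>Passage to the limit for closed and full copies\<close>

context good_sequence
begin

lemma avg_nonneg_eventually:
  assumes "\<And>n \<Gamma>. 0 \<le> f n \<Gamma>"
  shows "\<forall>\<^sub>F n in sequentially. 0 \<le> finite_connected_graph.avg (G n) (f n)"
  using good
proof eventually_elim
  case (elim n)
  then interpret good_set "G n" "U n" "\<Delta> n" "\<eta> n" "\<theta> n" .
  show ?case using avg_mono[of "\<lambda>_. 0" "f n"] assms by (simp add: avg_const)
qed

text \<open>The truncation level \<open>m\<close> is fixed first, so that the remainders of the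
  series are below the tolerance; only then does \<open>n\<close> grow, with finitely many terms
  left.\<close>

lemma closed_count_limit:
  assumes v: "valid_code ps" and A: "A \<subseteq> {..length ps}"
  defines "c \<equiv> (real (Suc (length ps)) - real (card A)) * exp (- real (card A))"
  shows "(\<lambda>n. finite_connected_graph.avg (G n) (\<lambda>\<Gamma>. \<bar>good_set.closed_count (U n) ps A \<Gamma> / order n - c\<bar>)) \<longlonglongrightarrow> 0"
proof -
  define k s where "k = real (Suc (length ps))" and "s = real (card A)"
  have finA: "finite A" using A finite_subset by blast
  let ?f = "\<lambda>n. finite_connected_graph.avg (G n) (\<lambda>\<Gamma>. \<bar>good_set.closed_count (U n) ps A \<Gamma> / order n - c\<bar>)"
  let ?t = "\<lambda>j. (-1) ^ j / fact j * (s ^ j * (k + real j))"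
  \<comment> \<open>The limit of the error bound at level \<open>m\<close>: the mean Bonferroni
    remainder tends to the absolute value of \<open>?t (Suc m)\<close>.\<close>
  define rest where "rest m = \<bar>?t (Suc m)\<bar> + \<bar>(\<Sum>j\<le>m. ?t j) - c\<bar>" for m
  have sums: "?t sums c" unfolding c_def k_def[symmetric] s_def[symmetric] by (rule weighted_exp_series)
  have "?t \<longlonglongrightarrow> 0" using sums summable_LIMSEQ_zero sums_summable by blast
  then have "(\<lambda>m. ?t (Suc m)) \<longlonglongrightarrow> 0" by (rule LIMSEQ_Suc)
  moreover have "(\<lambda>m. \<Sum>j\<le>m. ?t j) \<longlonglongrightarrow> c" using sums unfolding sums_def_le .
  ultimately have "rest \<longlonglongrightarrow> \<bar>0\<bar> + \<bar>c - c\<bar>"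
    unfolding rest_def by (intro tendsto_intros)
  then have rest0: "rest \<longlonglongrightarrow> 0" by simp
  have upper: "\<forall>\<^sub>F n in sequentially. ?f n < e" if e: "e > 0" for e
  proof -
    obtain m where m: "rest m < e"
      using order_tendstoD(2)[OF rest0 e] by (auto simp: eventually_sequentially)
    let ?h = "\<lambda>n. (\<Sum>j\<le>m. 1 / fact j * (\<Sum>is\<in>index_lists A j.
          finite_connected_graph.avg (G n) (\<lambda>\<Gamma>. \<bar>good_set.tree_copies (U n) (ps @ is) \<Gamma> / order n - (k + real j)\<bar>))) +
        (\<Sum>is\<in>index_lists A (Suc m). good_set.mean_copies (G n) (U n) (ps @ is) / order n) / fact (Suc m) +
        \<bar>(\<Sum>j\<le>m. ?t j) - c\<bar>"
    have va: "valid_code (ps @ is)" if "is \<in> index_lists A j" for "is" j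
      by (rule valid_code_append[OF v A that])
    have le: "real (Suc (length (ps @ is))) = k + real j" if "is \<in> index_lists A j" for "is" j
      using that unfolding index_lists_def k_def by simp
    have "?h \<longlonglongrightarrow> (\<Sum>j\<le>m. 1 / fact j * (\<Sum>is\<in>index_lists A j. 0)) +
        (\<Sum>is\<in>index_lists A (Suc m). k + real (Suc m)) / fact (Suc m) + \<bar>(\<Sum>j\<le>m. ?t j) - c\<bar>"
    proof (intro tendsto_add tendsto_sum tendsto_mult tendsto_const tendsto_divide)
      show "(\<lambda>n. finite_connected_graph.avg (G n) (\<lambda>\<Gamma>. \<bar>good_set.tree_copies (U n) (ps @ is) \<Gamma> / order n - (k + real j)\<bar>)) \<longlonglongrightarrow> 0"
        if "is \<in> index_lists A j" for "is" j
        using tree_copies_limit[OF va[OF that]] unfolding le[OF that] .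
      show "(\<lambda>n. good_set.mean_copies (G n) (U n) (ps @ is) / order n) \<longlonglongrightarrow> k + real (Suc m)"
        if "is \<in> index_lists A (Suc m)" for "is"
        using mean_copies_limit[OF va[OF that]] unfolding le[OF that] .
    qed simp
    moreover have "(\<Sum>j\<le>m. 1 / fact j * (\<Sum>is\<in>index_lists A j. 0)) +
        (\<Sum>is\<in>index_lists A (Suc m). k + real (Suc m)) / fact (Suc m) + \<bar>(\<Sum>j\<le>m. ?t j) - c\<bar> = rest m"
    proof -
      have "(\<Sum>is\<in>index_lists A (Suc m). k + real (Suc m)) / fact (Suc m) = \<bar>?t (Suc m)\<bar>"
        unfolding sum_constant card_index_lists[OF finA] s_def k_def by (simp add: abs_mult)
      then show ?thesis unfolding rest_def by simp
    qed
    ultimately have "?h \<longlonglongrightarrow> rest m" by (simp only:)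
    then have "\<forall>\<^sub>F n in sequentially. ?h n < e" using m by (rule order_tendstoD(2))
    then show ?thesis
      using good
    proof eventually_elim
      case (elim n)
      interpret good_set "G n" "U n" "\<Delta> n" "\<eta> n" "\<theta> n" by (rule elim(2))
      show ?case
        using closed_count_deviation[OF v A, of c m] elim(1) unfolding k_def s_def by linarith
    qed
  qed
  show ?thesis
  proof (rule order_tendstoI)
    fix a :: real assume "a < 0"
    then show "\<forall>\<^sub>F n in sequentially. a < ?f n"
      using avg_nonneg_eventually[of "\<lambda>n \<Gamma>. \<bar>good_set.closed_count (U n) ps A \<Gamma> / order n - c\<bar>"]
      by (auto elim!: eventually_mono)
  qed (rule upper)
qed

lemma full_copies_limit:
  assumes v: "valid_code ps" and A: "A \<subseteq> {..length ps}" and ne: "ps \<noteq> []"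
    and par: "\<And>i. i < length ps \<Longrightarrow> ps ! i \<in> A"
  defines "c \<equiv> (real (Suc (length ps)) - real (card A)) * exp (- real (card A))"
  shows "(\<lambda>n. finite_connected_graph.avg (G n) (\<lambda>\<Gamma>. \<bar>real (card (full_copies \<Gamma> ps A)) / order n - c\<bar>)) \<longlonglongrightarrow> 0"
proof (rule real_tendsto_sandwich[OF _ _ tendsto_const])
  let ?M = "real (length ps * Suc (length ps) ^ (2 * length ps))"
  let ?h = "\<lambda>n. finite_connected_graph.avg (G n) (\<lambda>\<Gamma>. \<bar>good_set.closed_count (U n) ps A \<Gamma> / order n - c\<bar>) +
     (\<Sum>i\<in>A. good_set.mean_extensions (G n) (U n) ps i / order n - good_set.mean_copies (G n) (U n) (ps @ [i]) / order n) +
     ?M * (2 - 2 / order n - good_set.mean_copies (G n) (U n) [0] / order n)"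
  show "\<forall>\<^sub>F n in sequentially. 0 \<le> finite_connected_graph.avg (G n) (\<lambda>\<Gamma>. \<bar>real (card (full_copies \<Gamma> ps A)) / order n - c\<bar>)"
    by (rule avg_nonneg_eventually) simp
  show "\<forall>\<^sub>F n in sequentially. finite_connected_graph.avg (G n) (\<lambda>\<Gamma>. \<bar>real (card (full_copies \<Gamma> ps A)) / order n - c\<bar>) \<le> ?h n"
    using good
  proof eventually_elim
    case (elim n)
    then interpret good_set "G n" "U n" "\<Delta> n" "\<eta> n" "\<theta> n" .
    have "(2 * (order n - 1) - mean_copies [0]) / order n = 2 - 2 / order n - mean_copies [0] / order n"
      using N_pos by (simp add: field_simps)
    then show ?case using full_copies_deviation[OF v A ne par, of c] by simp
  qed
  have "(\<lambda>n. 2 / order n) \<longlonglongrightarrow> 0"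
    by (rule tendsto_divide_0[OF tendsto_const]) (rule filterlim_at_top_imp_at_infinity[OF N_lim])
  moreover have "(\<lambda>n. good_set.mean_copies (G n) (U n) [0] / order n) \<longlonglongrightarrow> 2"
    using mean_copies_limit[of "[0]"] by (simp add: valid_code_def)
  moreover have "(\<lambda>n. \<Sum>i\<in>A. good_set.mean_extensions (G n) (U n) ps i / order n - good_set.mean_copies (G n) (U n) (ps @ [i]) / order n) \<longlonglongrightarrow> (\<Sum>i\<in>A. 0)"
  proof (rule tendsto_sum)
    fix i assume "i \<in> A"
    then have i: "i \<le> length ps" using A by auto
    have "valid_code (ps @ [i])" using v i by simp
    from tendsto_diff[OF mean_extensions_limit[OF v i] mean_copies_limit[OF this]]
    show "(\<lambda>n. good_set.mean_extensions (G n) (U n) ps i / order n - good_set.mean_copies (G n) (U n) (ps @ [i]) / order n) \<longlonglongrightarrow> 0" by simp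
  qed
  moreover have "(\<lambda>n. finite_connected_graph.avg (G n) (\<lambda>\<Gamma>. \<bar>good_set.closed_count (U n) ps A \<Gamma> / order n - c\<bar>)) \<longlonglongrightarrow> 0"
    unfolding c_def by (rule closed_count_limit[OF v A])
  ultimately have "?h \<longlonglongrightarrow> 0 + (\<Sum>i\<in>A. 0) + ?M * (2 - 0 - 2)"
    by (intro tendsto_add tendsto_mult tendsto_diff tendsto_const)
  then show "?h \<longlonglongrightarrow> 0" by simp
qed

end

text \<open>Markov's inequality, which passes from averages over spanning trees to the measure
  \<open>ust G\<close>.\<close>

lemma (in finite_connected_graph) ust_prob_le:
  assumes e: "e > 0"
  shows "measure_pmf.prob (ust G) {\<Gamma>. e < \<bar>f \<Gamma>\<bar>} \<le> avg (\<lambda>\<Gamma>. \<bar>f \<Gamma>\<bar>) / e"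
proof -
  let ?B = "spanning_trees G \<inter> {\<Gamma>. e < \<bar>f \<Gamma>\<bar>}"
  have "measure_pmf.prob (ust G) {\<Gamma>. e < \<bar>f \<Gamma>\<bar>} = real (card ?B) / tau"
    unfolding ust_def tau_def
    by (rule measure_pmf_of_set[OF spanning_trees_nonempty[OF fin conn] finite_ST])
  moreover have "real (card ?B) * e \<le> (\<Sum>\<Gamma>\<in>spanning_trees G. \<bar>f \<Gamma>\<bar>)"
  proof -
    have "real (card ?B) * e = (\<Sum>\<Gamma>\<in>?B. e)" by simp
    also have "\<dots> \<le> (\<Sum>\<Gamma>\<in>?B. \<bar>f \<Gamma>\<bar>)" by (intro sum_mono) auto
    also have "\<dots> \<le> (\<Sum>\<Gamma>\<in>spanning_trees G. \<bar>f \<Gamma>\<bar>)" by (intro sum_mono2) (auto simp: finite_ST)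
    finally show ?thesis .
  qed
  ultimately show ?thesis unfolding avg_def using e tau_pos by (simp add: field_simps)
qed

theorem theorem1p5:
  fixes G :: "nat \<Rightarrow> 'a sgraph" and T :: "'b sgraph" and \<rho> :: 'b and r :: nat
  assumes "high_degree_almost_regular G"
    and "finite_rooted_tree T \<rho>"
    and "rooted_height T \<rho> = r"
    and "r \<ge> 1"
  shows "\<forall>\<epsilon>>0. (\<lambda>n. measure_pmf.prob (ust (G n))
           {\<Gamma>. \<bar>real (ball_count \<Gamma> r T \<rho>) /
                 (real (card (verts (G n))) * real (card (level T \<rho> r)) *
                    exp (- real (card (verts T)) + real (card (level T \<rho> r))) /
                  real (card (rooted_stab T \<rho>))) - 1\<bar> > \<epsilon>}) \<longlonglongrightarrow> 0"
proof (intro allI impI)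
  fix \<epsilon> :: real assume \<epsilon>: "\<epsilon> > 0"
  obtain U \<Delta> \<eta> \<theta> where "good_sequence G U \<Delta> \<eta> \<theta>" using good_sequence_exists[OF assms(1)] by blast
  then interpret good_sequence G U \<Delta> \<eta> \<theta> .
  obtain ps vs where v: "valid_code ps" and vs: "vs \<in> copies (verts T) (edges T) ps"
    and set_vs: "set vs = verts T" and vs0: "vs ! 0 = \<rho>" and ce: "code_edges ps vs = edges T"
    and dist: "\<And>i. i < length ps \<Longrightarrow> gdist T \<rho> (vs ! (ps ! i)) < gdist T \<rho> (vs ! Suc i)"
    using tree_code_exists[OF assms(2)] by blast
  have finT: "finite (verts T)" and \<rho>T: "\<rho> \<in> verts T" using assms(2) unfolding finite_rooted_tree_def by auto
  have lvs: "length vs = Suc (length ps)" and dvs: "distinct vs" using vs unfolding copies_def by auto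
  have dist_r: "gdist T \<rho> x \<le> r" if "x \<in> verts T" for x
    using that finT unfolding assms(3)[symmetric] rooted_height_def by (intro Max_ge) auto
  have nthT: "vs ! i \<in> verts T" if "i \<le> length ps" for i
    using that lvs set_vs by (metis nth_mem less_Suc_eq_le)
  define A where "A = inner_indices T \<rho> r ps vs"
  have A_eq: "A = {i. i \<le> length ps \<and> gdist T \<rho> (vs ! i) < r}" unfolding A_def inner_indices_def ..
  let ?b = "card (level T \<rho> r)" and ?st = "card (rooted_stab T \<rho>)"
  have kT: "card (verts T) = Suc (length ps)" using set_vs distinct_card[OF dvs] lvs by simp
  have A: "A \<subseteq> {..length ps}" unfolding A_eq by auto
  let ?L = "{i. i \<le> length ps \<and> gdist T \<rho> (vs ! i) = r}"
  have "(\<lambda>i. vs ! i) ` ?L = level T \<rho> r"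
    unfolding level_def using nthT lvs set_vs by (auto simp: in_set_conv_nth less_Suc_eq_le image_iff) (metis in_set_conv_nth less_Suc_eq_le)
  moreover have "inj_on (\<lambda>i. vs ! i) ?L"
    using dvs lvs by (intro inj_onI) (auto simp: nth_eq_iff_index_eq)
  ultimately have cL: "card ?L = ?b" using card_image by metis
  have "gdist T \<rho> (vs ! i) < r \<or> gdist T \<rho> (vs ! i) = r" if "i \<le> length ps" for i
    using dist_r[OF nthT[OF that]] by linarith
  then have "{..length ps} = A \<union> ?L" unfolding A_eq by auto
  moreover have "A \<inter> ?L = {}" unfolding A_eq by auto
  moreover have "finite A" using A finite_subset by blast
  \<comment> \<open>The indices split into inner ones and those at level \<open>r\<close>. Hence
    \<open>Suc (length ps) - card A\<close> is the factor \<open>card (level T \<rho> r)\<close>,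
    and \<open>- card A\<close> is the exponent in the claim.\<close>
  ultimately have cA: "Suc (length ps) = card A + ?b"
    using card_Un_disjoint[of A ?L] cL by (metis card_atMost finite_Un finite_atMost)
  have "r \<in> gdist T \<rho> ` verts T"
    unfolding assms(3)[symmetric] rooted_height_def using finT \<rho>T by (intro Max_in) auto
  then obtain x where x: "x \<in> verts T" "gdist T \<rho> x = r" by blast
  then have "level T \<rho> r \<noteq> {}" unfolding level_def by blast
  moreover have "finite (level T \<rho> r)" unfolding level_def using finT by simp
  ultimately have b0: "?b > 0" by (simp add: card_gt_0_iff)
  \<comment> \<open>A single vertex has height 0, which \<open>r \<ge> 1\<close> excludes.\<close>
  have "ps \<noteq> []"
  proof
    assume "ps = []"
    then obtain y where y: "vs = [y]" using lvs by (auto simp: length_Suc_conv)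
    then have "verts T = {\<rho>}" unfolding set_vs[symmetric] using vs0 by simp
    then have "x = \<rho>" using x(1) by blast
    then show False using x(2) gdist_self[OF \<rho>T] assms(4) by simp
  qed
  \<comment> \<open>A parent is strictly nearer to the root than its child, whose distance is at
    most \<open>r\<close>.\<close>
  moreover have "ps ! i \<in> A" if i: "i < length ps" for i
  proof -
    have "gdist T \<rho> (vs ! (ps ! i)) < r" using dist[OF i] dist_r[OF nthT[of "Suc i"]] i by simp
    moreover have "ps ! i \<le> length ps" using v i unfolding valid_code_def by (meson less_imp_le order_trans)
    ultimately show ?thesis unfolding A_eq by simp
  qed
  ultimately have lim: "(\<lambda>n. finite_connected_graph.avg (G n) (\<lambda>\<Gamma>. \<bar>real (card (full_copies \<Gamma> ps A)) / order n -
      (real (Suc (length ps)) - real (card A)) * exp (- real (card A))\<bar>)) \<longlonglongrightarrow> 0"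
    by (rule full_copies_limit[OF v A])
  define c where "c = real ?b * exp (- real (card (verts T)) + real ?b)"
  have c_eq: "(real (Suc (length ps)) - real (card A)) * exp (- real (card A)) = c"
    unfolding c_def kT cA by simp
  have c0: "c > 0" unfolding c_def using b0 by simp
  have "finite (rooted_stab T \<rho>)"
    by (rule finite_subset[OF _ finite_permutations[OF finT]]) (auto simp: rooted_stab_def)
  moreover have "id \<in> rooted_stab T \<rho>"
    unfolding rooted_stab_def rooted_isomorphism_def by (simp add: permutes_id)
  ultimately have st0: "?st > 0" by (auto simp: card_gt_0_iff)
  let ?ratio = "\<lambda>n \<Gamma>. real (ball_count \<Gamma> r T \<rho>) / (order n * real ?b *
      exp (- real (card (verts T)) + real ?b) / real ?st)"
  let ?dev = "\<lambda>n. finite_connected_graph.avg (G n) (\<lambda>\<Gamma>. \<bar>real (card (full_copies \<Gamma> ps A)) / order n - c\<bar>)"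
  show "(\<lambda>n. measure_pmf.prob (ust (G n)) {\<Gamma>. \<epsilon> < \<bar>?ratio n \<Gamma> - 1\<bar>}) \<longlonglongrightarrow> 0"
  proof (rule real_tendsto_sandwich[OF _ _ tendsto_const])
    show "\<forall>\<^sub>F n in sequentially. 0 \<le> measure_pmf.prob (ust (G n)) {\<Gamma>. \<epsilon> < \<bar>?ratio n \<Gamma> - 1\<bar>}"
      by simp
    show "\<forall>\<^sub>F n in sequentially. measure_pmf.prob (ust (G n)) {\<Gamma>. \<epsilon> < \<bar>?ratio n \<Gamma> - 1\<bar>} \<le> (1 / c) * ?dev n / \<epsilon>"
      using good
    proof eventually_elim
      case (elim n)
      then interpret good_set "G n" "U n" "\<Delta> n" "\<eta> n" "\<theta> n" .
      have "avg (\<lambda>\<Gamma>. \<bar>?ratio n \<Gamma> - 1\<bar>) = avg (\<lambda>\<Gamma>. (1 / c) * \<bar>real (card (full_copies \<Gamma> ps A)) / order n - c\<bar>)"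
      proof (rule avg_cong)
        fix \<Gamma> assume \<Gamma>: "\<Gamma> \<in> spanning_trees (G n)"
        have "card (full_copies \<Gamma> ps A) = ball_count \<Gamma> r T \<rho> * ?st"
          unfolding A_def
          by (rule card_full_copies[OF assms(2,3) v vs set_vs vs0 ce])
            (use ST_props[OF \<Gamma>] fin in auto)
        moreover have "y / (m * b * x / t) - 1 = (1 / (b * x)) * (y * t / m - b * x)"
          if "m \<noteq> 0" "b \<noteq> 0" "x \<noteq> 0" "t \<noteq> 0" for y m b x t :: real
          using that by (simp add: field_simps)
        ultimately have "?ratio n \<Gamma> - 1 = (1 / c) * (real (card (full_copies \<Gamma> ps A)) / order n - c)"
          using b0 st0 N_pos unfolding c_def by simp
        then show "\<bar>?ratio n \<Gamma> - 1\<bar> = (1 / c) * \<bar>real (card (full_copies \<Gamma> ps A)) / order n - c\<bar>"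
          using c0 by (simp only: abs_mult) simp
      qed
      then show ?case using ust_prob_le[OF \<epsilon>, of "\<lambda>\<Gamma>. ?ratio n \<Gamma> - 1"] unfolding avg_cmult by simp
    qed
    have "(\<lambda>n. (1 / c) * ?dev n / \<epsilon>) \<longlonglongrightarrow> (1 / c) * 0 / \<epsilon>"
      using lim \<epsilon> unfolding c_eq by (intro tendsto_intros) auto
    then show "(\<lambda>n. (1 / c) * ?dev n / \<epsilon>) \<longlonglongrightarrow> 0" by simp
  qed
qed

end
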